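(* Let $d\ge2$, $\alpha\in[0,(d+1)/2)$, $\beta=\frac12-\frac{\alpha}{d+1}$ and let $K\ge0$ be a constant. There is a constant $N=N(d,\alpha,K)$ such that the following holds. Let $T\in(0,\infty)$ and $C=[0,T)\times B$. Let $a(t,x)=(a^{ij}(t,x))$ be a measurable function on $C$ with values in symmetric nonnegative definite $d\times d$ matrices and $r(t,x)$ a nonnegative measurable function on $C$ such that $r+\mathrm{tr}\,a>0$ in $C$; let $\mu(t,x)$ be the smallest eigenvalue of $a(t,x)$. Let $b=(b^i(t,x))$ be a measurable $\mathbb{R}^d$-valued function on $C$ with $|b|\le K\mu$ in $C$, and let $c=c(t,x)$ be a nonnegative bounded measurable function on $C$. Let $u\in W^{1,2}_{d+1,\mathrm{loc}}(C)\cap C(\bar C)$ and $$Lu=r\partial_tu+a^{ij}D_{ij}u+b^iD_iu-cu.$$ Then for every $x_0\in B$ $$u(0,x_0)\le\sup_{\partial'C}u_++N\psi^{\beta}(x_0)\Big(\int_C\psi^{\alpha}\,I_{Lu<0}\,(r\det a)^{-1}|Lu|^{d+1}\,dx\,dt\Big)^{1/(d+1)}.$$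
   Context: $B=\{x\in\mathbb{R}^d:|x|<1\}$, $\psi(x)=1-|x|^2$, $\partial'C=\partial C\setminus(\{0\}\times\bar B)$ is the parabolic boundary of $C$, $D_i=\partial/\partial x^i$, $D_{ij}=D_iD_j$, $\partial_t=\partial/\partial t$, summation over repeated indices is understood, $u_+=(|u|+u)/2$. $C(\bar C)$ is the space of continuous functions on $\bar C$. $W^{1,2}_{p,\mathrm{loc}}(C)$ is the parabolic Sobolev space of functions $u$ such that $u,\partial_tu,Du,D^2u$ (generalized derivatives; $D$ in $x$) are in $L_p$ on $[\varepsilon,T-\varepsilon)\times\{|x|<1-\varepsilon\}$ for all small $\varepsilon>0$. $I_{Lu<0}$ is the indicator function of the set where $Lu<0$. In the integrand, regarded as the quotient $I_{Lu<0}|Lu|^{d+1}/(r\det a)$, one uses $0/0:=0$ (and a positive number divided by $0$ is $+\infty$; the right-hand side may be $+\infty$). *)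

theory Defs
  imports "HOL-Analysis.Analysis"
begin

section \<open>Generalized derivatives\<close>

text \<open>\<open>dir_derivs [e\<^sub>1, \<dots>, e\<^sub>k] f\<close> differentiates \<open>f\<close> first along \<open>e\<^sub>1\<close>, then along \<open>e\<^sub>2\<close>, and so on.\<close>

fun dir_derivs :: "'a::real_normed_vector list \<Rightarrow> ('a \<Rightarrow> real) \<Rightarrow> 'a \<Rightarrow> real" where
  "dir_derivs [] f = f"
| "dir_derivs (e # es) f = dir_derivs es (\<lambda>z. frechet_derivative f (at z) e)"

text \<open>The underspecified \<^const>\<open>frechet_derivative\<close> is harmless below: starting with \<open>es = []\<close>,
  differentiability at each stage makes the next iterated derivative the true one.\<close>

definition smooth :: "('a::real_normed_vector \<Rightarrow> real) \<Rightarrow> bool" where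
  "smooth f \<longleftrightarrow> (\<forall>es z. dir_derivs es f differentiable (at z))"

definition test_functions :: "'a::real_normed_vector set \<Rightarrow> ('a \<Rightarrow> real) set" where
  "test_functions \<Omega> =
     {\<phi>. smooth \<phi> \<and> compact (closure {z. \<phi> z \<noteq> 0}) \<and> closure {z. \<phi> z \<noteq> 0} \<subseteq> \<Omega>}"

definition locally_integrable :: "'a::euclidean_space set \<Rightarrow> ('a \<Rightarrow> real) \<Rightarrow> bool" where
  "locally_integrable \<Omega> f \<longleftrightarrow> (\<forall>S. compact S \<and> S \<subseteq> \<Omega> \<longrightarrow> set_integrable lebesgue S f)"

text \<open>\<open>v\<close> is a version of the generalized derivative of \<open>u\<close> in the open set \<open>\<Omega>\<close>,
  taken successively along the directions in the list \<open>es\<close>.\<close>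

definition weak_deriv ::
  "'a::euclidean_space set \<Rightarrow> 'a list \<Rightarrow> ('a \<Rightarrow> real) \<Rightarrow> ('a \<Rightarrow> real) \<Rightarrow> bool" where
  "weak_deriv \<Omega> es u v \<longleftrightarrow>
     locally_integrable \<Omega> u \<and> locally_integrable \<Omega> v \<and>
     (\<forall>\<phi>\<in>test_functions \<Omega>.
        (LINT z:\<Omega>|lebesgue. u z * dir_derivs es \<phi> z)
          = (- 1) ^ length es * (LINT z:\<Omega>|lebesgue. v z * \<phi> z))"

definition Lp_on :: "real \<Rightarrow> 'a::euclidean_space set \<Rightarrow> ('a \<Rightarrow> real) set" where
  "Lp_on p S = {f. f \<in> borel_measurable (lebesgue_on S) \<and>
                   integrable (lebesgue_on S) (\<lambda>z. \<bar>f z\<bar> powr p)}"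


section \<open>The cylinder and its parabolic Sobolev space\<close>

definition cyl :: "real \<Rightarrow> (real \<times> (real^'n)) set" where
  "cyl T = {0..<T} \<times> ball 0 1"

definition parabolic_boundary :: "real \<Rightarrow> (real \<times> (real^'n)) set" where
  "parabolic_boundary T = frontier (cyl T) - {0} \<times> cball 0 1"

definition psi :: "real^'n \<Rightarrow> real" where
  "psi x = 1 - (norm x)\<^sup>2"

definition dt :: "real \<times> (real^'n)" where
  "dt = (1, 0)"

definition dx :: "'n \<Rightarrow> real \<times> (real^'n)" where
  "dx i = (0, axis i 1)"

definition Lp_loc :: "real \<Rightarrow> real \<Rightarrow> (real \<times> (real^'n) \<Rightarrow> real) set" where
  "Lp_loc p T = {f. \<forall>\<epsilon>>0. f \<in> Lp_on p ({\<epsilon>..<T - \<epsilon>} \<times> ball 0 (1 - \<epsilon>))}"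

definition W12_loc :: "real \<Rightarrow> real \<Rightarrow> (real \<times> (real^'n) \<Rightarrow> real) set" where
  "W12_loc p T = {u. u \<in> Lp_loc p T \<and>
     (\<exists>v\<in>Lp_loc p T. weak_deriv (interior (cyl T)) [dt] u v) \<and>
     (\<forall>i. \<exists>v\<in>Lp_loc p T. weak_deriv (interior (cyl T)) [dx i] u v) \<and>
     (\<forall>i j. \<exists>v\<in>Lp_loc p T. weak_deriv (interior (cyl T)) [dx i, dx j] u v)}"

text \<open>\<open>ut\<close>, \<open>Du\<close>, \<open>D2u\<close> are (arbitrary versions of) \<open>\<partial>\<^sub>t u\<close>, the gradient and the Hessian in \<open>x\<close>.\<close>

definition generalized_derivs ::
  "real \<Rightarrow> (real \<times> (real^'n) \<Rightarrow> real) \<Rightarrow> (real \<times> (real^'n) \<Rightarrow> real) \<Rightarrow>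
   (real \<times> (real^'n) \<Rightarrow> real^'n) \<Rightarrow> (real \<times> (real^'n) \<Rightarrow> real^'n^'n) \<Rightarrow> bool" where
  "generalized_derivs T u ut Du D2u \<longleftrightarrow>
     weak_deriv (interior (cyl T)) [dt] u ut \<and>
     (\<forall>i. weak_deriv (interior (cyl T)) [dx i] u (\<lambda>z. Du z $ i)) \<and>
     (\<forall>i j. weak_deriv (interior (cyl T)) [dx i, dx j] u (\<lambda>z. D2u z $ i $ j))"


section \<open>The operator and the right-hand side\<close>

definition eigenvalues :: "real^'n^'n \<Rightarrow> real set" where
  "eigenvalues A = {l. \<exists>v. v \<noteq> 0 \<and> A *v v = l *\<^sub>R v}"

definition smallest_eigenvalue :: "real^'n^'n \<Rightarrow> real" where
  "smallest_eigenvalue A = Min (eigenvalues A)"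

definition sym_nonneg_definite :: "real^'n^'n \<Rightarrow> bool" where
  "sym_nonneg_definite A \<longleftrightarrow> transpose A = A \<and> (\<forall>v. 0 \<le> v \<bullet> (A *v v))"

definition Lop ::
  "('z \<Rightarrow> real) \<Rightarrow> ('z \<Rightarrow> real^'n^'n) \<Rightarrow> ('z \<Rightarrow> real^'n) \<Rightarrow> ('z \<Rightarrow> real) \<Rightarrow>
   ('z \<Rightarrow> real) \<Rightarrow> ('z \<Rightarrow> real) \<Rightarrow> ('z \<Rightarrow> real^'n) \<Rightarrow> ('z \<Rightarrow> real^'n^'n) \<Rightarrow> 'z \<Rightarrow> real" where
  "Lop r a b c u ut Du D2u z =
     r z * ut z + (\<Sum>i\<in>UNIV. \<Sum>j\<in>UNIV. a z $ i $ j * D2u z $ i $ j)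
     + (\<Sum>i\<in>UNIV. b z $ i * Du z $ i) - c z * u z"

definition pos_part :: "real \<Rightarrow> real" where
  "pos_part s = (\<bar>s\<bar> + s) / 2"

text \<open>Powers with a positive real exponent, extended by \<open>\<infinity>\<^sup>q = \<infinity>\<close>.\<close>

definition ennrpow :: "ennreal \<Rightarrow> real \<Rightarrow> ennreal" where
  "ennrpow s q = (if s = \<infinity> then \<infinity> else ennreal (enn2real s powr q))"

text \<open>Division in \<^typ>\<open>ennreal\<close> satisfies \<open>0 / 0 = 0\<close> and \<open>s / 0 = \<infinity>\<close> for \<open>s > 0\<close>.\<close>

definition weighted_integral ::
  "real \<Rightarrow> real \<Rightarrow> (real \<times> (real^'n) \<Rightarrow> real) \<Rightarrow> (real \<times> (real^'n) \<Rightarrow> real^'n^'n) \<Rightarrow>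
   (real \<times> (real^'n) \<Rightarrow> real) \<Rightarrow> ennreal" where
  "weighted_integral \<alpha> T r a f =
     (\<integral>\<^sup>+ z. ennreal (psi (snd z) powr \<alpha>) *
            (ennreal (indicator {z. f z < 0} z * \<bar>f z\<bar> ^ (CARD('n) + 1))
              / ennreal (r z * det (a z)))
      \<partial>lebesgue_on (cyl T))"

end

theory Submission
  imports Defs
begin

text \<open>This is a parabolic Aleksandrov estimate, proved with a barrier that vanishes on the lateral boundary
like \<open>\<psi>\<^sup>\<beta>\<close>. Write \<open>n\<close> for the dimension and let \<open>m\<close> exceed the supremum of \<open>u\<^sub>+\<close> over the parabolic
boundary by a small slack. Put \<open>\<theta> = g(\<psi>)\<close> with \<open>g(s) = 1 - exp(- \<kappa> s\<^sup>\<beta>)\<close>. The profile \<open>g\<close> is concave,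
lies below \<open>\<kappa> s\<^sup>\<beta>\<close>, and for large \<open>\<kappa> \<beta>\<close> the function \<open>\<theta>\<close> is a supersolution of the elliptic part,
with a margin proportional to the smallest eigenvalue of \<open>a\<close> that exceeds the drift
(\<open>frob_hess_\<theta>_le\<close>, \<open>pointwise_operator_bound\<close>). It therefore suffices to bound \<open>M = sup (u - m) / \<theta>\<close> by a
constant times the integral to the power \<open>1 / (n + 1)\<close>.

Choose \<open>(t0, x0)\<close> where the supremum \<open>M\<close> is almost attained and set \<open>v = u - m - (1 - \<epsilon>) M \<theta>\<close>. Then
\<open>v \<le> \<epsilon> M \<theta>\<close> with almost equality at \<open>(t0, x0)\<close>. Lower and tilt the tangent plane of \<open>\<epsilon> M \<theta>\<close> at \<open>x0\<close> a
little: the resulting affine functions \<open>l\<close> are below \<open>v\<close> at \<open>(t0, x0)\<close>, but positive on the ball, whereas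
\<open>v\<close> is negative near the top and the lateral boundary. So there is a last time at which \<open>v\<close> reaches \<open>l\<close>
(\<open>last_contact\<close>), and there \<open>v\<^sub>t \<le> 0\<close>, \<open>Dv = Dl\<close> and \<open>D\<^sup>2v \<le> 0\<close> (\<open>contact_derivatives\<close>). Consequently the
parabolic Legendre map \<open>(t, x) \<mapsto> (v - Dv \<bullet> (x - x0), Dv)\<close> sends the contact set onto all pairs
\<open>(l(x0), Dl)\<close>. Its Jacobian determinant is \<open>v\<^sub>t det D\<^sup>2v\<close>, whence the volume of the set of these pairs
is at most the integral of \<open>\<bar>v\<^sub>t det D\<^sup>2v\<bar>\<close> over the contact set (\<open>emeasure_legendre_image_le\<close>).

On the contact set \<open>- Lu \<ge> r (- v\<^sub>t) + tr (a (- D\<^sup>2v))\<close>. Here the margin for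
\<open>(1 - \<epsilon>) M \<theta>\<close> absorbs the drift term of \<open>v\<close>, whose gradient is only of size \<open>\<epsilon> M g'\<close>, and \<open>c u \<ge> 0\<close> because
\<open>l > 0\<close> forces \<open>u > m\<close>. A determinant inequality (\<open>weighted_det_bound\<close>) turns this into
\<open>r det a \<bar>v\<^sub>t det D\<^sup>2v\<bar> \<le> n! \<bar>Lu\<bar>\<^bsup>n + 1\<^esup>\<close>.

The weights come from two facts about the planes. First, the concavity of \<open>g\<close> is strong enough that
contact happens only where \<open>\<psi>\<close> is comparable with \<open>\<psi>(x0)\<close> (\<open>plane_contact_localized\<close>), so the factor
\<open>\<psi>\<^sup>\<alpha>\<close> in the integral may be replaced by a multiple of \<open>\<psi>(x0)\<^sup>\<alpha>\<close>. Secondly, in units of \<open>g'(\<psi>(x0))\<close>, a plane may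
be lowered by the order of \<open>\<psi>(x0)\<close> and tilted by the order of \<open>1\<close> in the direction of \<open>x0\<close> and of \<open>\<psi>(x0)\<^bsup>1/2\<^esup>\<close>
in the \<open>n - 1\<close> tangential directions. The volume of the set of planes is thus of the order of
\<open>M\<^bsup>n + 1\<^esup> \<psi>(x0)\<^bsup>(\<beta> - 1)(n + 1) + 1 + (n - 1)/2\<^esup> = M\<^bsup>n + 1\<^esup> \<psi>(x0)\<^bsup>- \<alpha>\<^esup>\<close> by the choice of \<open>\<beta>\<close>, and the two
powers of \<open>\<psi>(x0)\<close> cancel.

Since \<open>u\<close> has only generalized derivatives, the contact argument is applied to mollifications of \<open>u\<close>.
The derivatives of the mollifications converge almost everywhere and are controlled in the
\<open>n + 1\<close>-st power, so the integrals over the contact sets pass to the limit, the limit set being the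
upper limit of the contact sets (\<open>contact_limit\<close>).\<close>

section \<open>Nonnegative matrices and a determinant inequality\<close>

lemma symmetric_matrix_inner:
  fixes A :: "real^'n^'n"
  assumes "transpose A = A"
  shows "x \<bullet> (A *v y) = (A *v x) \<bullet> y"
proof -
  have "x v* A = A *v x" using transpose_matrix_vector[of A x] assms by simp
  then show ?thesis using dot_lmul_matrix[of x A y] by simp
qed

lemma quadratic_form_expand:
  fixes A :: "real^'n^'n"
  assumes "transpose A = A"
  shows "(x + t *\<^sub>R y) \<bullet> (A *v (x + t *\<^sub>R y)) = x \<bullet> (A *v x) + 2 * t * (y \<bullet> (A *v x)) + t\<^sup>2 * (y \<bullet> (A *v y))"
proof -
  have "x \<bullet> (A *v y) = y \<bullet> (A *v x)"
    using symmetric_matrix_inner[OF assms, of x y] by (simp add: inner_commute)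
  then show ?thesis
    by (simp add: matrix_vector_right_distrib matrix_vector_mult_scaleR inner_add_left inner_add_right
        power2_eq_square distrib_left mult.assoc)
qed

lemma linear_term_zero:
  fixes b c :: real
  assumes "\<And>t. 0 \<le> 2 * t * b + t\<^sup>2 * c"
  shows "b = 0"
proof (rule ccontr)
  assume "b \<noteq> 0"
  define k where "k = \<bar>c\<bar> + 1"
  have k: "k > 0" "c < k" unfolding k_def by linarith+
  have "0 \<le> 2 * (- b / k) * b + (- b / k)\<^sup>2 * c" using assms .
  also have "\<dots> = b\<^sup>2 / k * (c / k - 2)" using k by (simp add: field_simps power2_eq_square)
  finally have "0 \<le> b\<^sup>2 / k * (c / k - 2)" .
  moreover have "c / k - 2 < 0" "b\<^sup>2 / k > 0" using k \<open>b \<noteq> 0\<close> by (auto simp: field_simps)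
  ultimately show False using mult_pos_neg[of "b\<^sup>2 / k" "c / k - 2"] by linarith
qed

text \<open>Minimise the quadratic form on the unit sphere of \<open>V\<close>. The first variation at a minimiser \<open>v\<close> shows that
\<open>A v - l v\<close> is orthogonal to \<open>V\<close>; as it lies in \<open>V\<close> by invariance, it vanishes.\<close>

lemma Rayleigh_minimum_eigenvector:
  fixes A :: "real^'n^'n"
  assumes sym: "transpose A = A" and V: "subspace V" and inv: "\<And>v. v \<in> V \<Longrightarrow> A *v v \<in> V"
    and nz: "\<exists>v\<in>V. v \<noteq> 0"
  obtains v l where "v \<in> V" "norm v = 1" "A *v v = l *\<^sub>R v"
    "\<And>w. w \<in> V \<Longrightarrow> l * (norm w)\<^sup>2 \<le> w \<bullet> (A *v w)"
proof -
  let ?S = "V \<inter> sphere 0 1"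
  have comp: "compact ?S"
    using closed_subspace[OF V] by (simp add: closed_Int_compact)
  obtain v0 where v0: "v0 \<in> V" "v0 \<noteq> 0" using nz by blast
  then have "(1 / norm v0) *\<^sub>R v0 \<in> ?S" using subspace_scale[OF V] by auto
  then have ne: "?S \<noteq> {}" by blast
  have cont: "continuous_on ?S (\<lambda>v. v \<bullet> (A *v v))"
    by (rule continuous_on_inner[OF continuous_on_id matrix_vector_mult_linear_continuous_on])
  obtain v where v: "v \<in> ?S" and min: "\<And>w. w \<in> ?S \<Longrightarrow> v \<bullet> (A *v v) \<le> w \<bullet> (A *v w)"
    using continuous_attains_inf[OF comp ne cont] by blast
  define l where "l = v \<bullet> (A *v v)"
  have ray: "l * (norm w)\<^sup>2 \<le> w \<bullet> (A *v w)" if "w \<in> V" for w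
  proof (cases "w = 0")
    case False
    let ?u = "(1 / norm w) *\<^sub>R w"
    have "?u \<in> ?S" using that False subspace_scale[OF V] by auto
    then have "l \<le> ?u \<bullet> (A *v ?u)" unfolding l_def by (rule min)
    also have "\<dots> = (w \<bullet> (A *v w)) / (norm w)\<^sup>2"
      by (simp add: matrix_vector_mult_scaleR power2_eq_square)
    finally show ?thesis using False by (simp add: field_simps)
  qed simp
  have nv: "norm v = 1" "v \<in> V" using v by auto
  have orth: "w \<bullet> (A *v v - l *\<^sub>R v) = 0" if "w \<in> V" for w
  proof (rule linear_term_zero)
    fix t
    have "v + t *\<^sub>R w \<in> V" using that nv V by (simp add: subspace_add subspace_scale)
    from ray[OF this] have "l * ((v + t *\<^sub>R w) \<bullet> (v + t *\<^sub>R w)) \<le> (v + t *\<^sub>R w) \<bullet> (A *v (v + t *\<^sub>R w))"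
      by (simp add: power2_norm_eq_inner)
    then have "l * (v \<bullet> v + 2 * t * (w \<bullet> v) + t\<^sup>2 * (w \<bullet> w))
        \<le> v \<bullet> (A *v v) + 2 * t * (w \<bullet> (A *v v)) + t\<^sup>2 * (w \<bullet> (A *v w))"
      unfolding quadratic_form_expand[OF sym]
      by (simp add: inner_add_left inner_add_right power2_eq_square algebra_simps inner_commute)
    moreover have "v \<bullet> v = 1" using nv by (metis power2_norm_eq_inner power_one)
    ultimately show "0 \<le> 2 * t * (w \<bullet> (A *v v - l *\<^sub>R v)) + t\<^sup>2 * (w \<bullet> (A *v w) - l * (w \<bullet> w))"
      by (simp add: l_def inner_diff_right algebra_simps)
  qed
  have "A *v v - l *\<^sub>R v \<in> V" using inv nv V by (simp add: subspace_diff subspace_scale)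
  from orth[OF this] have "A *v v = l *\<^sub>R v" by simp
  then show ?thesis using that nv ray by blast
qed

text \<open>Induction on the dimension of the invariant subspace: split off one eigenvector; its orthogonal
complement in \<open>V\<close> is again invariant.\<close>

lemma symmetric_matrix_eigenbasis:
  fixes A :: "real^'n^'n"
  assumes sym: "transpose A = A"
  shows "subspace V \<Longrightarrow> (\<And>v. v \<in> V \<Longrightarrow> A *v v \<in> V) \<Longrightarrow> 
    \<exists>B. B \<subseteq> V \<and> pairwise orthogonal B \<and> (\<forall>v\<in>B. norm v = 1 \<and> (\<exists>l. A *v v = l *\<^sub>R v)) \<and> card B = dim V \<and> finite B"
proof (induction "dim V" arbitrary: V)
  case 0
  then have "V \<subseteq> {0}" by (metis dim_eq_0)
  then show ?case using 0 by (intro exI[of _ "{}"]) auto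
next
  case (Suc k)
  have "\<exists>v\<in>V. v \<noteq> 0" using Suc(2) by (metis dim_eq_0 nat.distinct(1) singletonI subsetI)
  then obtain v l where v: "v \<in> V" "norm v = 1" "A *v v = l *\<^sub>R v"
    using Rayleigh_minimum_eigenvector[OF sym Suc.prems] by metis
  let ?V = "{w \<in> V. orthogonal v w}"
  have sub: "subspace ?V"
    using Suc.prems(1) by (auto simp: subspace_def orthogonal_def inner_add_right)
  have inv: "A *v w \<in> ?V" if "w \<in> ?V" for w
  proof -
    have "v \<bullet> (A *v w) = (A *v v) \<bullet> w" using symmetric_matrix_inner[OF sym] .
    then show ?thesis using that Suc.prems(2) v by (auto simp: orthogonal_def)
  qed
  have d: "dim ?V = k"
  proof -
    have eq: "{y \<in> V. \<forall>x \<in> span {v}. orthogonal x y} = ?V"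
    proof (intro Collect_cong conj_cong refl iffI ballI)
      fix y x assume "orthogonal v y" "x \<in> span {v}"
      then show "orthogonal x y" by (auto simp: span_singleton orthogonal_clauses)
    next
      fix y assume "\<forall>x\<in>span {v}. orthogonal x y"
      then show "orthogonal v y" by (simp add: span_base)
    qed
    have "dim {y \<in> V. \<forall>x \<in> span {v}. orthogonal x y} + dim (span {v}) = dim V"
    proof (rule dim_subspace_orthogonal_to_vectors)
      show "span {v} \<subseteq> V" using v(1) Suc.prems(1) by (simp add: span_minimal)
    qed (use Suc.prems(1) in auto)
    then have "dim ?V + dim (span {v}) = dim V" unfolding eq .
    moreover have "v \<noteq> 0" using v by auto
    ultimately show ?thesis using Suc(2) by (simp add: dim_singleton)
  qed
  obtain B where B: "B \<subseteq> ?V" "pairwise orthogonal B" "\<forall>v\<in>B. norm v = 1 \<and> (\<exists>l. A *v v = l *\<^sub>R v)"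
      "card B = dim ?V" "finite B"
    using Suc.hyps(1)[OF d[symmetric] sub inv] by blast
  have nin: "v \<notin> B" using B(1) v by (auto simp: orthogonal_def power2_norm_eq_inner[symmetric])
  show ?case
  proof (intro exI conjI)
    show "insert v B \<subseteq> V" using B v by auto
    show "pairwise orthogonal (insert v B)" using B by (auto simp: pairwise_insert orthogonal_commute)
    show "\<forall>v\<in>insert v B. norm v = 1 \<and> (\<exists>l. A *v v = l *\<^sub>R v)" using B v by auto
    show "card (insert v B) = dim V" using B nin d Suc(2) by simp
    show "finite (insert v B)" using B by simp
  qed
qed

text \<open>Scale an orthonormal eigenbasis by the square roots of the eigenvalues.\<close>

lemma sym_nonneg_factorization:
  fixes A :: "real^'n^'n"
  assumes "sym_nonneg_definite A"
  obtains R :: "real^'n^'n" where "A = R ** transpose R"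
proof -
  have sym: "transpose A = A" and nn: "\<And>v. 0 \<le> v \<bullet> (A *v v)"
    using assms by (auto simp: sym_nonneg_definite_def)
  obtain B where B: "pairwise orthogonal B" "\<forall>v\<in>B. norm v = 1 \<and> (\<exists>l. A *v v = l *\<^sub>R v)"
      "card B = dim (UNIV :: (real^'n) set)" "finite B"
    using symmetric_matrix_eigenbasis[OF sym, of UNIV] by auto
  have cB: "card B = CARD('n)" using B(3) by (simp add: dim_UNIV)
  obtain e :: "'n \<Rightarrow> real^'n" where e: "bij_betw e UNIV B"
    using cB B(4) by (metis finite_same_card_bij finite)
  define l where "l i = (SOME l. A *v e i = l *\<^sub>R e i)" for i
  have eB: "e i \<in> B" for i using e by (auto simp: bij_betw_def)
  have l: "A *v e i = l i *\<^sub>R e i" for i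
    unfolding l_def by (rule someI_ex) (use B(2) eB in blast)
  have on: "e i \<bullet> e j = (if i = j then 1 else 0)" for i j
  proof (cases "i = j")
    case True
    have "e i \<bullet> e i = 1" using B(2) eB by (metis power2_norm_eq_inner power_one)
    then show ?thesis using True by simp
  next
    case False
    then have "e i \<noteq> e j" using e by (auto simp: bij_betw_def inj_on_def)
    then show ?thesis using B(1) eB False by (auto simp: pairwise_def orthogonal_def)
  qed
  have l0: "0 \<le> l i" for i
    using nn[of "e i"] by (simp add: l on)
  define Q where "Q = (\<chi> i j. e j $ i)"
  have QTQ: "transpose Q ** Q = mat 1"
    using on by (simp add: Q_def matrix_matrix_mult_def transpose_def mat_def inner_vec_def vec_eq_iff)
  then have QQT: "Q ** transpose Q = mat 1" by (rule matrix_left_right_inverse1)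
  define R where "R = (\<chi> i j. sqrt (l j) * e j $ i)"
  have R: "R ** transpose R = (\<chi> i k. \<Sum>j\<in>UNIV. l j * (e j $ i * e j $ k))"
  proof -
    have *: "sqrt (l j) * e j $ i * (sqrt (l j) * e j $ k) = l j * (e j $ i * e j $ k)" for i j k
    proof -
      have "sqrt (l j) * e j $ i * (sqrt (l j) * e j $ k) = (sqrt (l j) * sqrt (l j)) * (e j $ i * e j $ k)"
        by algebra
      then show ?thesis using l0[of j] by simp
    qed
    show ?thesis by (simp add: R_def matrix_matrix_mult_def transpose_def vec_eq_iff *)
  qed
  have AQ: "A ** Q = (\<chi> i j. l j * e j $ i)"
  proof -
    have "(A ** Q) $ i $ j = (A *v e j) $ i" for i j
      by (simp add: Q_def matrix_matrix_mult_def matrix_vector_mult_def)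
    then show ?thesis by (simp add: vec_eq_iff l)
  qed
  have "A = A ** (Q ** transpose Q)" by (simp add: QQT)
  also have "\<dots> = (A ** Q) ** transpose Q" by (simp add: matrix_mul_assoc)
  also have "\<dots> = R ** transpose R"
    unfolding AQ R by (simp add: Q_def matrix_matrix_mult_def transpose_def vec_eq_iff ac_simps)
  finally show ?thesis using that by blast
qed

text \<open>The minimum over the set of eigenvalues is meaningful only once that set is known to be finite: eigenvectors
for distinct eigenvalues are orthogonal, hence independent.\<close>

lemma smallest_eigenvalue_le_quadratic_form:
  fixes A :: "real^'n^'n"
  assumes sym: "transpose A = A"
  shows "smallest_eigenvalue A * (norm w)\<^sup>2 \<le> w \<bullet> (A *v w)"
    and "smallest_eigenvalue A \<in> eigenvalues A"
proof -
  have "\<exists>v\<in>UNIV. (v::real^'n) \<noteq> 0" using vector_choose_size[of 1] by (metis UNIV_I norm_zero zero_le_one zero_neq_one)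
  then obtain v l where v: "norm v = 1" "A *v v = l *\<^sub>R v"
    and ray: "\<And>w. l * (norm w)\<^sup>2 \<le> w \<bullet> (A *v w)"
    using Rayleigh_minimum_eigenvector[OF sym, of UNIV] by auto
  have lin: "l \<in> eigenvalues A" using v by (auto simp: eigenvalues_def intro!: exI[of _ v])
  define ev where "ev l = (SOME v. v \<noteq> 0 \<and> A *v v = l *\<^sub>R v)" for l
  have ev: "ev l \<noteq> 0 \<and> A *v ev l = l *\<^sub>R ev l" if "l \<in> eigenvalues A" for l
    unfolding ev_def by (rule someI_ex) (use that in \<open>auto simp: eigenvalues_def\<close>)
  have orth: "ev a \<bullet> ev b = 0" if "a \<in> eigenvalues A" "b \<in> eigenvalues A" "a \<noteq> b" for a b
  proof -
    have "ev a \<bullet> (A *v ev b) = (A *v ev a) \<bullet> ev b" using symmetric_matrix_inner[OF sym] .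
    then have "b * (ev a \<bullet> ev b) = a * (ev a \<bullet> ev b)" using ev that by simp
    then show ?thesis using that by simp
  qed
  have inj: "inj_on ev (eigenvalues A)"
  proof (rule inj_onI)
    fix a b assume ab: "a \<in> eigenvalues A" "b \<in> eigenvalues A" "ev a = ev b"
    show "a = b"
    proof (rule ccontr)
      assume "a \<noteq> b"
      then have "ev a \<bullet> ev a = 0" using orth ab by metis
      then show False using ev ab by simp
    qed
  qed
  have "pairwise orthogonal (ev ` eigenvalues A)"
    using orth by (auto simp: pairwise_def orthogonal_def)
  moreover have "0 \<notin> ev ` eigenvalues A" using ev by auto
  ultimately have "independent (ev ` eigenvalues A)" by (rule pairwise_orthogonal_independent)
  then have "finite (ev ` eigenvalues A)" by (rule independent_imp_finite)
  then have fin: "finite (eigenvalues A)" using inj by (simp add: finite_image_iff)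
  show "smallest_eigenvalue A \<in> eigenvalues A"
    unfolding smallest_eigenvalue_def using fin lin by (intro Min_in) auto
  have "smallest_eigenvalue A \<le> l" unfolding smallest_eigenvalue_def using fin lin by simp
  then have "smallest_eigenvalue A * (norm w)\<^sup>2 \<le> l * (norm w)\<^sup>2" by (simp add: mult_right_mono)
  also have "\<dots> \<le> w \<bullet> (A *v w)" by (rule ray)
  finally show "smallest_eigenvalue A * (norm w)\<^sup>2 \<le> w \<bullet> (A *v w)" .
qed

lemma smallest_eigenvalue_nonneg:
  fixes A :: "real^'n^'n"
  assumes "sym_nonneg_definite A"
  shows "0 \<le> smallest_eigenvalue A"
proof -
  have "smallest_eigenvalue A \<in> eigenvalues A"
    using smallest_eigenvalue_le_quadratic_form(2) assms by (auto simp: sym_nonneg_definite_def)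
  then obtain v where v: "v \<noteq> 0" "A *v v = smallest_eigenvalue A *\<^sub>R v" by (auto simp: eigenvalues_def)
  then have "0 \<le> smallest_eigenvalue A * (v \<bullet> v)"
    using assms by (metis inner_scaleR_right sym_nonneg_definite_def)
  moreover have "v \<bullet> v > 0" using v by simp
  ultimately show ?thesis by (simp add: zero_le_mult_iff)
qed

lemma trace_ge_smallest_eigenvalue:
  fixes A :: "real^'n^'n"
  assumes "transpose A = A"
  shows "CARD('n) * smallest_eigenvalue A \<le> trace A"
proof -
  have "smallest_eigenvalue A \<le> A $ i $ i" for i
    using smallest_eigenvalue_le_quadratic_form(1)[OF assms, of "axis i 1"]
    by (simp add: matrix_vector_mul_component inner_axis' inner_axis inner_commute column_def matrix_vector_mult_basis)
  then have "(\<Sum>i\<in>(UNIV::'n set). smallest_eigenvalue A) \<le> trace A"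
    unfolding trace_def by (intro sum_mono)
  then show ?thesis by simp
qed

text \<open>The Frobenius pairing, that is \<open>tr (A\<^sup>T B)\<close>.\<close>

definition frob :: "real^'n^'n \<Rightarrow> real^'n^'n \<Rightarrow> real" where
  "frob A B = (\<Sum>i\<in>UNIV. \<Sum>j\<in>UNIV. A $ i $ j * B $ i $ j)"

lemma frob_commute: "frob A B = frob B A"
  by (simp add: frob_def mult.commute)

lemma frob_trace: "transpose B = B \<Longrightarrow> frob A B = trace (A ** B)"
proof -
  assume "transpose B = B"
  then have "B $ i $ j = B $ j $ i" for i j by (metis transpose_def vec_lambda_beta)
  then show ?thesis by (simp add: frob_def trace_def matrix_matrix_mult_def)
qed

lemma frob_factor: "frob A (R ** transpose R) = trace (transpose R ** A ** R)"
proof -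
  have "frob A (R ** transpose R) = trace (A ** (R ** transpose R))"
    by (rule frob_trace) (simp add: matrix_transpose_mul)
  also have "\<dots> = trace ((A ** R) ** transpose R)" by (simp add: matrix_mul_assoc)
  also have "\<dots> = trace (transpose R ** (A ** R))" by (rule trace_mul_sym)
  finally show ?thesis by (simp add: matrix_mul_assoc)
qed

lemma congruence_diag:
  fixes A R :: "real^'n^'n"
  shows "(transpose R ** A ** R) $ i $ j = column i R \<bullet> (A *v column j R)"
proof -
  have e: "(transpose R ** B) $ i $ j = (\<Sum>l\<in>UNIV. R $ l $ i * B $ l $ j)" for B :: "real^'n^'n"
    by (simp add: matrix_matrix_mult_def transpose_def)
  have "(A ** R) $ l $ j = (A *v column j R) $ l" for l
    by (simp add: matrix_matrix_mult_def matrix_vector_mult_def column_def)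
  then have "(transpose R ** (A ** R)) $ i $ j = column i R \<bullet> (A *v column j R)"
    unfolding e inner_vec_def by (simp add: column_def)
  then show ?thesis by (simp add: matrix_mul_assoc)
qed

lemma frob_ge_smallest_eigenvalue:
  fixes A P :: "real^'n^'n"
  assumes A: "transpose A = A" and P: "sym_nonneg_definite P"
  shows "smallest_eigenvalue A * trace P \<le> frob A P"
proof -
  obtain R :: "real^'n^'n" where R: "P = R ** transpose R" using sym_nonneg_factorization[OF P] by blast
  have "trace P = trace (transpose R ** R)" unfolding R by (rule trace_mul_sym)
  also have "\<dots> = (\<Sum>i\<in>UNIV. (norm (column i R))\<^sup>2)"
    using congruence_diag[of R "mat 1"] by (simp add: trace_def power2_norm_eq_inner)
  finally have t: "trace P = (\<Sum>i\<in>UNIV. (norm (column i R))\<^sup>2)" .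
  have "(\<Sum>i\<in>UNIV. smallest_eigenvalue A * (norm (column i R))\<^sup>2)
      \<le> (\<Sum>i\<in>UNIV. column i R \<bullet> (A *v column i R))"
    by (intro sum_mono smallest_eigenvalue_le_quadratic_form(1) A)
  also have "\<dots> = frob A P"
    unfolding R frob_factor by (simp add: trace_def congruence_diag)
  finally show ?thesis unfolding t by (simp add: sum_distrib_left)
qed

lemma frob_nonneg:
  fixes A P :: "real^'n^'n"
  assumes "sym_nonneg_definite A" "sym_nonneg_definite P"
  shows "0 \<le> frob A P"
proof -
  obtain R :: "real^'n^'n" where R: "P = R ** transpose R" using sym_nonneg_factorization[OF assms(2)] by blast
  show ?thesis unfolding R frob_factor
    using assms(1) by (auto simp: trace_def congruence_diag sym_nonneg_definite_def intro!: sum_nonneg)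
qed

lemma sym_nonneg_entry_le_trace:
  fixes A :: "real^'n^'n"
  assumes "sym_nonneg_definite A"
  shows "\<bar>A $ i $ j\<bar> \<le> trace A"
proof -
  have sym: "transpose A = A" and nn: "\<And>v. 0 \<le> v \<bullet> (A *v v)"
    using assms by (auto simp: sym_nonneg_definite_def)
  have ent: "axis i 1 \<bullet> (A *v axis j 1) = A $ i $ j" for i j
    by (simp add: matrix_vector_mult_basis column_def inner_axis')
  have d: "0 \<le> A $ i $ i" for i using nn[of "axis i 1"] ent by simp
  have s: "A $ i $ j = A $ j $ i" using sym by (metis transpose_def vec_lambda_beta)
  have tr: "A $ i $ i \<le> trace A" for i
    unfolding trace_def using d by (intro member_le_sum) auto
  show ?thesis
  proof (cases "i = j")
    case True then show ?thesis using d tr by simp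
  next
    case False
    have "0 \<le> A $ i $ i + 2 * t * A $ i $ j + t\<^sup>2 * A $ j $ j" for t
      using nn[of "axis i 1 + t *\<^sub>R axis j 1"] unfolding quadratic_form_expand[OF sym] ent s .
    from this[of 1] this[of "-1"] have "2 * \<bar>A $ i $ j\<bar> \<le> A $ i $ i + A $ j $ j" by simp
    also have "\<dots> \<le> 2 * trace A" using tr[of i] tr[of j] by simp
    finally show ?thesis by simp
  qed
qed

lemma abs_det_le_fact_entries:
  fixes A :: "real^'n^'n"
  assumes "\<And>i j. \<bar>A $ i $ j\<bar> \<le> b"
  shows "\<bar>det A\<bar> \<le> fact CARD('n) * b ^ CARD('n)"
proof -
  have "\<bar>det A\<bar> \<le> (\<Sum>p\<in>{p. p permutes (UNIV::'n set)}. \<bar>of_int (sign p) * (\<Prod>i\<in>UNIV. A $ i $ p i)\<bar>)"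
    unfolding det_def by (rule sum_abs)
  also have "\<dots> \<le> (\<Sum>p\<in>{p. p permutes (UNIV::'n set)}. b ^ CARD('n))"
  proof (rule sum_mono)
    fix p :: "'n \<Rightarrow> 'n"
    have "\<bar>of_int (sign p) * (\<Prod>i\<in>UNIV. A $ i $ p i)\<bar> = (\<Prod>i\<in>UNIV. \<bar>A $ i $ p i\<bar>)"
      by (simp add: abs_mult abs_prod sign_def)
    also have "\<dots> \<le> (\<Prod>i\<in>(UNIV::'n set). b)" by (intro prod_mono) (use assms in auto)
    finally show "\<bar>of_int (sign p) * (\<Prod>i\<in>UNIV. A $ i $ p i)\<bar> \<le> b ^ CARD('n)" by simp
  qed
  also have "\<dots> = fact CARD('n) * b ^ CARD('n)"
    by (simp add: card_permutations)
  finally show ?thesis .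
qed

lemma det_sym_nonneg: 
  fixes A :: "real^'n^'n"
  assumes "sym_nonneg_definite A" shows "0 \<le> det A"
proof -
  obtain R :: "real^'n^'n" where "A = R ** transpose R" using sym_nonneg_factorization[OF assms] by blast
  then show ?thesis by (simp add: det_mul det_transpose)
qed

text \<open>Writing \<open>W = R R\<^sup>T\<close>, both sides concern the nonnegative matrix \<open>R\<^sup>T A R\<close>: its determinant is
\<open>det A det W\<close> and its trace is \<open>frob A W\<close>. The entries of a nonnegative matrix are bounded by its trace, and
the Leibniz formula then costs only the factor \<open>n!\<close>. The inequality of arithmetic and geometric means would
give a better constant.\<close>

lemma det_mult_le_frob_power:
  fixes A W :: "real^'n^'n"
  assumes A: "sym_nonneg_definite A" and W: "sym_nonneg_definite W"
  shows "det A * det W \<le> fact CARD('n) * frob A W ^ CARD('n)"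
proof -
  obtain R :: "real^'n^'n" where R: "W = R ** transpose R" using sym_nonneg_factorization[OF W] by blast
  let ?C = "transpose R ** A ** R"
  have C: "sym_nonneg_definite ?C"
    unfolding sym_nonneg_definite_def
  proof (intro conjI allI)
    show "transpose ?C = ?C"
      using A by (simp add: matrix_transpose_mul sym_nonneg_definite_def matrix_mul_assoc)
    fix v
    have "v \<bullet> (?C *v v) = (R *v v) \<bullet> (A *v (R *v v))"
      by (metis (no_types, opaque_lifting) dot_lmul_matrix matrix_vector_mul_assoc transpose_matrix_vector transpose_transpose)
    then show "0 \<le> v \<bullet> (?C *v v)" using A by (simp add: sym_nonneg_definite_def)
  qed
  have "det A * det W = det ?C" unfolding R by (simp add: det_mul det_transpose)
  also have "\<dots> \<le> \<bar>det ?C\<bar>" by simp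
  also have "\<dots> \<le> fact CARD('n) * trace ?C ^ CARD('n)"
    by (rule abs_det_le_fact_entries) (rule sym_nonneg_entry_le_trace[OF C])
  finally show ?thesis unfolding R frob_factor .
qed

lemma det_eq_0_if_frob_eq_0:
  fixes A W :: "real^'n^'n"
  assumes A: "sym_nonneg_definite A" and W: "sym_nonneg_definite W"
    and "frob A W = 0" "trace A > 0"
  shows "det W = 0"
proof -
  have "smallest_eigenvalue W * trace A \<le> 0"
    using frob_ge_smallest_eigenvalue[of W A] assms frob_commute[of A W] by (simp add: sym_nonneg_definite_def)
  then have "smallest_eigenvalue W = 0"
    using smallest_eigenvalue_nonneg[OF W] assms(4) by (simp add: mult_le_0_iff)
  then have "0 \<in> eigenvalues W"
    using smallest_eigenvalue_le_quadratic_form(2)[of W] W by (simp add: sym_nonneg_definite_def)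
  then obtain v where "v \<noteq> 0" "W *v v = 0" by (auto simp: eigenvalues_def)
  then have "\<not> invertible W" using matrix_left_invertible_ker invertible_left_inverse by metis
  then show ?thesis by (simp add: invertible_det_nz)
qed

text \<open>This is where the quantity \<open>r det a\<close> in the denominator of the integrand comes from. The second part
covers the points with \<open>Lu = 0\<close>, where the integrand is \<open>0\<close> even if \<open>r det a = 0\<close>: the condition
\<open>r + tr A > 0\<close> excludes that \<open>r\<close> and \<open>A\<close> degenerate simultaneously.\<close>

lemma weighted_det_bound:
  fixes A W :: "real^'n^'n"
  assumes A: "sym_nonneg_definite A" and W: "sym_nonneg_definite W"
    and r: "0 \<le> r" and s: "0 \<le> s" and pos: "r + trace A > 0"
    and f: "r * s + frob A W \<le> f"
  shows "s * det W * (r * det A) \<le> fact CARD('n) * f ^ (CARD('n) + 1)"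
    and "f = 0 \<Longrightarrow> s * det W = 0"
proof -
  have fn: "0 \<le> frob A W" "0 \<le> r * s" using frob_nonneg[OF A W] r s by auto
  have "s * det W * (r * det A) = (r * s) * (det A * det W)" by simp
  also have "\<dots> \<le> f * (fact CARD('n) * f ^ CARD('n))"
  proof (rule mult_mono)
    show "det A * det W \<le> fact CARD('n) * f ^ CARD('n)"
      using det_mult_le_frob_power[OF A W] fn f
      by (smt (verit) mult_left_mono power_mono fact_ge_zero)
    show "0 \<le> det A * det W" by (intro mult_nonneg_nonneg det_sym_nonneg A W)
  qed (use fn f in auto)
  finally show "s * det W * (r * det A) \<le> fact CARD('n) * f ^ (CARD('n) + 1)" by (simp add: ac_simps)
  assume "f = 0"
  then have z: "r * s = 0" "frob A W = 0" using fn f \<open>f = 0\<close> by linarith+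
  show "s * det W = 0"
  proof (cases "s = 0")
    case False
    then have "trace A > 0" using z(1) pos by auto
    then show ?thesis using det_eq_0_if_frob_eq_0[OF A W z(2)] by simp
  qed simp
qed

section \<open>Space-time as a Euclidean space and the Legendre map\<close>

text \<open>Space-time \<open>\<real> \<times> \<real>\<^sup>n\<close> is identified with \<open>\<real>\<^bsup>n + 1\<^esup>\<close>, where determinants and the change of variables formula
are available; \<open>Origin\<close> is the index of the time coordinate. The change of variables formula asks for a
well-ordered index type, for which any injective numbering of the indices will do.\<close>

datatype 'a idx = Origin | Index 'a

lemma UNIV_idx: "(UNIV :: 'a idx set) = insert Origin (range Index)"
  using idx.exhaust by auto

instance idx :: (finite) finite
  by standard (simp add: UNIV_idx)

definition idx_rank :: "'a::finite idx \<Rightarrow> nat" where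
  "idx_rank i = (case i of Origin \<Rightarrow> 0 | Index a \<Rightarrow> Suc ((SOME f :: 'a \<Rightarrow> nat. inj f) a))"

lemma inj_idx_rank: "idx_rank i = idx_rank j \<longleftrightarrow> i = j"
proof -
  have "\<exists>f :: 'a \<Rightarrow> nat. inj f"
    using finite_imp_inj_to_nat_seg[of "UNIV :: 'a set"] by auto
  then have inj: "inj (SOME f :: 'a \<Rightarrow> nat. inj f)" by (rule someI_ex)
  show ?thesis by (auto simp: idx_rank_def inj_eq[OF inj] split: idx.splits)
qed

instantiation idx :: (finite) wellorder
begin
definition "i \<le> (j :: 'a idx) \<longleftrightarrow> idx_rank i \<le> idx_rank j"
definition "i < (j :: 'a idx) \<longleftrightarrow> idx_rank i < idx_rank j"
instance
proof
  fix P and a :: "'a idx"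
  assume step: "\<And>x::'a idx. (\<And>y. y < x \<Longrightarrow> P y) \<Longrightarrow> P x"
  show "P a"
    by (rule measure_induct_rule[of idx_rank]) (rule step, simp add: less_idx_def)
qed (auto simp: less_idx_def less_eq_idx_def inj_idx_rank)
end

definition join :: "real \<times> (real^'n) \<Rightarrow> real^('n::finite) idx" where
  "join z = (\<chi> i. case i of Origin \<Rightarrow> fst z | Index j \<Rightarrow> snd z $ j)"

definition unjoin :: "real^('n::finite) idx \<Rightarrow> real \<times> (real^'n)" where
  "unjoin y = (y $ Origin, \<chi> j. y $ Index j)"

lemma join_unjoin [simp]: "join (unjoin y) = y"
  by (simp add: join_def unjoin_def vec_eq_iff split: idx.splits)

lemma unjoin_join [simp]: "unjoin (join z) = z"
  by (simp add: join_def unjoin_def vec_eq_iff prod_eq_iff)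

lemma linear_join: "linear join"
  by (rule linearI) (simp_all add: join_def vec_eq_iff split: idx.splits)

lemma linear_unjoin: "linear unjoin"
  by (rule linearI) (simp_all add: unjoin_def vec_eq_iff prod_eq_iff)

lemma bounded_linear_join: "bounded_linear join"
  using linear_join linear_conv_bounded_linear by blast

lemma bounded_linear_unjoin: "bounded_linear unjoin"
  using linear_unjoin linear_conv_bounded_linear by blast

lemma measurable_join [measurable]: "join \<in> borel_measurable borel"
  by (intro borel_measurable_continuous_onI linear_continuous_on bounded_linear_join)

lemma measurable_unjoin [measurable]: "unjoin \<in> borel_measurable borel"
  by (intro borel_measurable_continuous_onI linear_continuous_on bounded_linear_unjoin)

lemma prod_idx: "(\<Prod>i\<in>(UNIV::'a::finite idx set). f i) = f Origin * (\<Prod>j\<in>UNIV. f (Index j))"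
proof -
  have "(\<Prod>i\<in>(UNIV::'a idx set). f i) = f Origin * (\<Prod>i\<in>range Index. f i)"
    unfolding UNIV_idx by (subst prod.insert) auto
  then show ?thesis by (simp add: prod.reindex inj_def)
qed

lemma prod_Basis_vec: "(\<Prod>b\<in>Basis. f (b :: real^'n)) = (\<Prod>i\<in>UNIV. f (axis i 1))"
proof -
  have B: "(Basis :: (real^'n) set) = (\<lambda>i. axis i 1) ` UNIV" by (auto simp: Basis_vec_def)
  have inj: "inj (\<lambda>i::'n. axis i (1::real))" by (auto simp: inj_def axis_eq_axis)
  show ?thesis unfolding B by (simp add: prod.reindex[OF inj])
qed

lemma prod_Basis_pair:
  "(\<Prod>b\<in>Basis. f (b :: real \<times> (real^'n))) = f (1, 0) * (\<Prod>i\<in>UNIV. f (0, axis i 1))"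
proof -
  have B: "(Basis :: (real \<times> (real^'n)) set) = insert (1, 0) ((\<lambda>i. (0, axis i 1)) ` UNIV)"
    by (auto simp: Basis_prod_def Basis_vec_def)
  have inj: "inj (\<lambda>i::'n. (0::real, axis i (1::real)))" by (auto simp: inj_def axis_eq_axis)
  show ?thesis unfolding B by (subst prod.insert) (auto simp: prod.reindex[OF inj])
qed

lemma lborel_join: "lborel = distr lborel borel (join :: _ \<Rightarrow> real^('n::finite) idx)"
proof (rule lborel_eqI)
  fix l u :: "real^'n idx"
  assume le: "\<And>b. b \<in> Basis \<Longrightarrow> l \<bullet> b \<le> u \<bullet> b"
  have le': "l $ i \<le> u $ i" for i
  proof -
    have "axis i (1::real) \<in> Basis" by (auto simp: Basis_vec_def)
    from le[OF this] show ?thesis by (simp add: inner_axis)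
  qed
  have eq: "join -` box l u = box (unjoin l) (unjoin u)"
  proof (rule set_eqI)
    fix z :: "real \<times> (real^'n)"
    have "z \<in> join -` box l u \<longleftrightarrow> (\<forall>i. l $ i < join z $ i \<and> join z $ i < u $ i)"
      by (simp add: mem_box_cart)
    also have "\<dots> \<longleftrightarrow> (l $ Origin < fst z \<and> fst z < u $ Origin)
        \<and> (\<forall>j. l $ Index j < snd z $ j \<and> snd z $ j < u $ Index j)"
      unfolding join_def by (auto split: idx.splits)
    also have "\<dots> \<longleftrightarrow> z \<in> box (unjoin l) (unjoin u)"
      by (cases z) (auto simp: unjoin_def mem_box Basis_prod_def Basis_vec_def inner_axis)
    finally show "z \<in> join -` box l u \<longleftrightarrow> z \<in> box (unjoin l) (unjoin u)" .
  qed
  have "emeasure (distr lborel borel join) (box l u) = emeasure lborel (box (unjoin l) (unjoin u))"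
    by (simp add: emeasure_distr eq)
  also have "\<dots> = (\<Prod>b\<in>Basis. (unjoin u - unjoin l) \<bullet> b)"
    using le' by (intro emeasure_lborel_box)
      (auto simp: Basis_prod_def Basis_vec_def unjoin_def inner_axis)
  also have "\<dots> = (\<Prod>b\<in>Basis. (u - l) \<bullet> b)"
    unfolding prod_Basis_pair prod_Basis_vec by (simp add: prod_idx unjoin_def inner_axis)
  finally show "emeasure (distr lborel borel join) (box l u) = (\<Prod>b\<in>Basis. (u - l) \<bullet> b)" .
qed simp

text \<open>In the Leibniz formula only the permutations fixing \<open>Origin\<close> contribute, and these correspond to the
permutations of the remaining indices with the same sign.\<close>

lemma det_idx_block:
  fixes N :: "real^('n::finite) idx^'n idx"
  assumes z: "\<And>j. N $ Origin $ Index j = 0"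
  shows "det N = N $ Origin $ Origin * det (\<chi> i j. N $ Index i $ Index j)"
proof -
  let ?P = "{p. p permutes (UNIV :: 'n idx set)}"
  let ?Q = "{p. p permutes (UNIV :: 'n idx set) \<and> p Origin = Origin}"
  let ?t = "\<lambda>p. of_int (sign p) * (\<Prod>i\<in>UNIV. N $ i $ p i)"
  define L where "L q = map_permutation UNIV Index q" for q :: "'n \<Rightarrow> 'n"
  have injX: "inj_on Index (UNIV::'n set)" by (simp add: inj_def)
  have LI: "L q (Index j) = Index (q j)" if "q permutes UNIV" for q j
    unfolding L_def by (rule map_permutation_apply[OF injX UNIV_I])
  have LO: "L q Origin = Origin" for q
    unfolding L_def map_permutation_def restrict_id_def by auto
  have Lp: "L q permutes UNIV" if "q permutes UNIV" for q
  proof -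
    have "L q permutes range Index"
      unfolding L_def using that injX by (intro map_permutation_permutes) (auto simp: bij_betw_def)
    then show ?thesis by (rule permutes_subset) simp
  qed
  have Ls: "sign (L q) = sign q" if "q permutes UNIV" for q
    unfolding L_def by (rule sign_map_permutation) (use that injX in auto)
  have LQ: "bij_betw L {q. q permutes (UNIV::'n set)} ?Q"
  proof (rule bij_betw_imageI)
    show "inj_on L {q. q permutes UNIV}"
    proof (rule inj_onI)
      fix q r assume q: "q \<in> {q. q permutes UNIV}" "r \<in> {q. q permutes UNIV}" "L q = L r"
      then have "Index (q j) = Index (r j)" for j using LI by (metis mem_Collect_eq)
      then show "q = r" by auto
    qed
    show "L ` {q. q permutes UNIV} = ?Q"
    proof (intro equalityI subsetI)
      fix p assume p: "p \<in> ?Q"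
      then have inj: "inj p" using permutes_inj[of p UNIV] by simp
      have ex: "\<exists>k. p (Index j) = Index k" for j
      proof (cases "p (Index j)")
        case Origin
        then have "p (Index j) = p Origin" using p by simp
        then show ?thesis using inj by (auto dest: injD)
      qed auto
      define q where "q j = (THE k. p (Index j) = Index k)" for j
      have q: "p (Index j) = Index (q j)" for j
        using ex[of j] unfolding q_def by auto
      have "inj q"
      proof (rule injI)
        fix a b assume "q a = q b"
        then have "p (Index a) = p (Index b)" by (simp add: q)
        then show "a = b" using inj by (auto dest: injD)
      qed
      then have "bij q" by (simp add: bij_def finite_UNIV_inj_surj)
      then have qp: "q permutes UNIV" by (intro bij_imp_permutes) auto
      have "L q i = p i" for i
        using LI[OF qp] LO q p by (cases i) auto
      then have "p = L q" by auto
      then show "p \<in> L ` {q. q permutes UNIV}" using qp by blast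
    qed (use Lp LO in auto)
  qed
  have "det N = sum ?t ?P" by (simp add: det_def)
  also have "\<dots> = sum ?t ?Q"
  proof (rule sum.mono_neutral_right)
    show "\<forall>p\<in>?P - ?Q. ?t p = 0"
    proof
      fix p assume "p \<in> ?P - ?Q"
      then have "p Origin \<noteq> Origin" by auto
      then obtain j where "p Origin = Index j" by (cases "p Origin") auto
      then show "?t p = 0" using z by (simp add: prod_idx)
    qed
  qed (auto simp: finite_permutations)
  also have "\<dots> = (\<Sum>q\<in>{q. q permutes (UNIV::'n set)}. ?t (L q))"
    by (rule sum.reindex_bij_betw[OF LQ, symmetric])
  also have "\<dots> = (\<Sum>q\<in>{q. q permutes (UNIV::'n set)}. N $ Origin $ Origin *
      (of_int (sign q) * (\<Prod>i\<in>UNIV. N $ Index i $ Index (q i))))"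
    by (rule sum.cong) (simp_all add: Ls LI LO prod_idx)
  also have "\<dots> = N $ Origin $ Origin * det (\<chi> i j. N $ Index i $ Index j)"
    by (simp add: det_def sum_distrib_left)
  finally show ?thesis .
qed

text \<open>The first row of the Jacobian matrix of the Legendre map is \<open>(v\<^sub>t, 0)\<close> minus the combination of the
other rows with coefficients \<open>y = x - x0\<close>. Adding that combination back leaves the determinant unchanged
and makes the matrix block triangular.\<close>

lemma det_legendre_matrix:
  fixes M :: "real^('n::finite) idx^'n idx" and H :: "real^'n^'n" and p y :: "real^'n"
  assumes OO: "M $ Origin $ Origin = s - y \<bullet> p"
    and OI: "\<And>j. M $ Origin $ Index j = - (\<Sum>i\<in>UNIV. y $ i * H $ i $ j)"
    and IO: "\<And>i. M $ Index i $ Origin = p $ i"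
    and II: "\<And>i j. M $ Index i $ Index j = H $ i $ j"
  shows "det M = s * det H"
proof -
  define x where "x = (\<Sum>i\<in>UNIV. y $ i *s row (Index i) M)"
  have "x \<in> vec.span {row j M |j. j \<noteq> Origin}"
    unfolding x_def by (intro vec.span_sum vec.span_scale vec.span_base) auto
  then have "det M = det (\<chi> k. if k = Origin then row Origin M + x else row k M)" (is "_ = det ?N")
    by (rule det_row_span[symmetric])
  also have "\<dots> = ?N $ Origin $ Origin * det (\<chi> i j. ?N $ Index i $ Index j)"
    by (rule det_idx_block) (simp add: row_def x_def OI II)
  also have "?N $ Origin $ Origin = s"
    by (simp add: row_def x_def OO IO inner_vec_def)
  also have "(\<chi> i j. ?N $ Index i $ Index j) = H"
    by (simp add: row_def II vec_eq_iff)
  finally show ?thesis .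
qed

text \<open>Only the inequality for differentiable, possibly non-injective maps is needed: the volume of the
image is at most the integral of the absolute Jacobian determinant. The time derivative \<open>pt\<close> of the gradient
enters the Jacobian matrix, but not its determinant.\<close>

lemma emeasure_legendre_image_le:
  fixes v vt :: "real \<times> (real^'n) \<Rightarrow> real" and p pt :: "real \<times> (real^'n) \<Rightarrow> real^'n"
    and H :: "real \<times> (real^'n) \<Rightarrow> real^'n^'n" and G S :: "(real \<times> (real^'n)) set" and x0 :: "real^'n"
  assumes G: "G \<in> sets borel" and S: "S \<in> sets borel"
    and dv: "\<And>z. z \<in> G \<Longrightarrow> (v has_derivative (\<lambda>h. vt z * fst h + p z \<bullet> snd h)) (at z)"
    and dp: "\<And>z. z \<in> G \<Longrightarrow> (p has_derivative (\<lambda>h. fst h *\<^sub>R pt z + H z *v snd h)) (at z)"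
    and meas: "(\<lambda>z. indicator G z * \<bar>vt z * det (H z)\<bar>) \<in> borel_measurable borel"
    and sub: "S \<subseteq> (\<lambda>z. (v z - p z \<bullet> (snd z - x0), p z)) ` G"
  shows "emeasure lborel S \<le> (\<integral>\<^sup>+z. ennreal (indicator G z * \<bar>vt z * det (H z)\<bar>) \<partial>lborel)"
proof (cases "(\<integral>\<^sup>+z. ennreal (indicator G z * \<bar>vt z * det (H z)\<bar>) \<partial>lborel) = \<infinity>")
  case False
  define F where "F z = (v z - p z \<bullet> (snd z - x0), p z)" for z
  define F' where "F' z h = (vt z * fst h - (fst h *\<^sub>R pt z + H z *v snd h) \<bullet> (snd z - x0),
      fst h *\<^sub>R pt z + H z *v snd h)" for z h
  have dF: "(F has_derivative F' z) (at z)" if "z \<in> G" for z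
    unfolding F_def[abs_def] F'_def
    by (rule derivative_eq_intros dv[OF that] dp[OF that] refl)+
       (auto simp: fun_eq_iff inner_diff_right inner_add_left algebra_simps)
  define f where "f y = join (F (unjoin y))" for y
  define f' where "f' y h = join (F' (unjoin y) (unjoin h))" for y h
  let ?G = "unjoin -` G"
  have df: "(f has_derivative f' y) (at y within ?G)" if "y \<in> ?G" for y
  proof -
    have "((F \<circ> unjoin) has_derivative (F' (unjoin y) \<circ> unjoin)) (at y)"
      using that by (intro diff_chain_at[OF bounded_linear_imp_has_derivative[OF bounded_linear_unjoin] dF]) auto
    then have "((join \<circ> (F \<circ> unjoin)) has_derivative (join \<circ> (F' (unjoin y) \<circ> unjoin))) (at y)"
      by (rule diff_chain_at[OF _ bounded_linear_imp_has_derivative[OF bounded_linear_join]])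
    then show ?thesis by (auto simp: f_def[abs_def] f'_def[abs_def] o_def intro: has_derivative_at_withinI)
  qed
  have det: "det (matrix (f' y)) = vt (unjoin y) * det (H (unjoin y))" for y
  proof (rule det_legendre_matrix[where y="snd (unjoin y) - x0" and p="pt (unjoin y)"])
    have uO: "unjoin (axis Origin 1 :: real^'n idx) = (1, 0)"
      by (simp add: unjoin_def axis_def vec_eq_iff)
    have uI: "unjoin (axis (Index j) 1 :: real^'n idx) = (0, axis j 1)" for j
      by (simp add: unjoin_def axis_def vec_eq_iff)
    show "matrix (f' y) $ Origin $ Origin = vt (unjoin y) - (snd (unjoin y) - x0) \<bullet> pt (unjoin y)"
      by (simp add: matrix_def f'_def uO F'_def join_def inner_commute)
    show "matrix (f' y) $ Index i $ Origin = pt (unjoin y) $ i" for i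
      by (simp add: matrix_def f'_def uO F'_def join_def)
    show "matrix (f' y) $ Index i $ Index j = H (unjoin y) $ i $ j" for i j
      by (simp add: matrix_def f'_def uI F'_def join_def matrix_vector_mult_basis column_def)
    show "matrix (f' y) $ Origin $ Index j
        = - (\<Sum>i\<in>UNIV. (snd (unjoin y) - x0) $ i * H (unjoin y) $ i $ j)" for j
      by (simp add: matrix_def f'_def uI F'_def join_def matrix_vector_mult_basis column_def inner_vec_def mult.commute)
  qed
  let ?g = "\<lambda>z. indicator G z * \<bar>vt z * det (H z)\<bar>"
  have Gm: "?G \<in> sets borel" using measurable_sets[OF measurable_unjoin G] by simp
  have nn: "(\<integral>\<^sup>+y. ennreal (?g (unjoin y)) \<partial>lborel) = (\<integral>\<^sup>+z. ennreal (?g z) \<partial>lborel)"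
    by (subst lborel_join) (subst nn_integral_distr, use meas in auto)
  have gi: "integrable lborel (\<lambda>y. ?g (unjoin y))"
    by (rule integrableI_nonneg) (use meas nn False in \<open>auto simp: top.not_eq_extremum\<close>)
  then have gi': "integrable lebesgue (\<lambda>y. ?g (unjoin y))" 
    using integrable_completion borel_measurable_integrable by blast
  have g_eq: "?g (unjoin y) = (if y \<in> ?G then \<bar>det (matrix (f' y))\<bar> else 0)" for y
    by (simp add: det indicator_def)
  have int: "(\<lambda>y. \<bar>det (matrix (f' y))\<bar>) integrable_on ?G"
    using integrable_on_lebesgue[OF gi'] unfolding g_eq by (simp only: integrable_restrict_UNIV)
  have ie: "integral ?G (\<lambda>y. \<bar>det (matrix (f' y))\<bar>) = integral\<^sup>L lborel (\<lambda>y. ?g (unjoin y))"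
  proof -
    have "integral ?G (\<lambda>y. \<bar>det (matrix (f' y))\<bar>) = integral UNIV (\<lambda>y. ?g (unjoin y))"
      unfolding g_eq by (simp only: integral_restrict_UNIV)
    then show ?thesis using integral_lborel[OF gi] by simp
  qed
  have Gl: "?G \<in> sets lebesgue" using Gm by auto
  have m1: "f ` ?G \<in> lmeasurable" and m2: "measure lebesgue (f ` ?G) \<le> integral ?G (\<lambda>y. \<bar>det (matrix (f' y))\<bar>)"
    using measurable_differentiable_image[OF Gl df int] measure_differentiable_image[OF Gl df int] by auto
  have Sm: "unjoin -` S \<in> sets borel" using measurable_sets[OF measurable_unjoin S] by simp
  have "unjoin -` S \<subseteq> f ` ?G"
  proof
    fix y assume "y \<in> unjoin -` S"
    then obtain z where z: "z \<in> G" "unjoin y = F z" using sub by (auto simp: F_def)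
    then have "y = f (join z)" by (metis f_def join_unjoin unjoin_join)
    then show "y \<in> f ` ?G" using z by auto
  qed
  then have "emeasure lebesgue (unjoin -` S) \<le> emeasure lebesgue (f ` ?G)"
    using m1 by (intro emeasure_mono) auto
  also have "\<dots> = ennreal (measure lebesgue (f ` ?G))" using m1 by (simp add: emeasure_eq_measure2)
  also have "\<dots> \<le> ennreal (integral\<^sup>L lborel (\<lambda>y. ?g (unjoin y)))" using m2 ie by (simp add: ennreal_leI)
  also have "\<dots> = (\<integral>\<^sup>+z. ennreal (?g z) \<partial>lborel)"
    using nn_integral_eq_integral[OF gi] nn by simp
  finally have "emeasure lebesgue (unjoin -` S) \<le> (\<integral>\<^sup>+z. ennreal (?g z) \<partial>lborel)" .
  moreover have "emeasure lebesgue (unjoin -` S) = emeasure lborel S"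
  proof -
    have "emeasure lebesgue (unjoin -` S) = emeasure lborel (unjoin -` S)" using Sm by simp
    also have "\<dots> = emeasure lborel (join -` (unjoin -` S))"
      by (subst lborel_join) (subst emeasure_distr, use Sm in auto)
    also have "join -` (unjoin -` S) = S" by (auto simp: vimage_def)
    finally show ?thesis .
  qed
  ultimately show ?thesis by simp
qed simp

section \<open>Smooth mollifiers\<close>

text \<open>All derivatives of the standard bump function \<open>exp (- 1 / s)\<close> are combinations of the functions
\<open>flat k\<close>. This makes smoothness a matter of a differentiation rule for one family, rather than of an
induction over derivatives at the point \<open>0\<close>.\<close>

definition flat :: "nat \<Rightarrow> real \<Rightarrow> real" where
  "flat k s = (if s \<le> 0 then 0 else exp (- 1 / s) / s ^ k)"

lemma power_le_fact_exp:
  fixes x :: real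
  assumes "0 \<le> x"
  shows "x ^ n \<le> fact n * exp x"
proof -
  have "(\<Sum>i\<in>{n}. x ^ i /\<^sub>R fact i) \<le> (\<Sum>i. x ^ i /\<^sub>R fact i)"
    by (rule sum_le_suminf[OF summable_exp_generic]) (use assms in auto)
  then show ?thesis by (simp add: exp_def field_simps)
qed

lemma flat_nonneg: "0 \<le> flat k s"
  by (simp add: flat_def)

lemma flat_le: "flat k s \<le> fact (k + 2) * s\<^sup>2"
proof (cases "s \<le> 0")
  case False
  then have "(1 / s) ^ (k + 2) \<le> fact (k + 2) * exp (1 / s)" by (intro power_le_fact_exp) simp
  then have "1 \<le> fact (k + 2) * exp (1 / s) * s ^ (k + 2)"
    using False by (simp add: power_divide divide_le_eq)
  then have "exp (- (1 / s)) * 1 \<le> exp (- (1 / s)) * (fact (k + 2) * exp (1 / s) * s ^ (k + 2))"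
    by (intro mult_left_mono) auto
  also have "\<dots> = (exp (- (1 / s)) * exp (1 / s)) * (fact (k + 2) * s ^ (k + 2))" by (simp only: ac_simps)
  also have "\<dots> = (fact (k + 2) * s\<^sup>2) * s ^ k" by (simp add: power_add power2_eq_square flip: exp_add)
  finally have "exp (- (1 / s)) \<le> (fact (k + 2) * s\<^sup>2) * s ^ k" by simp
  then show ?thesis using False unfolding flat_def by (simp add: divide_le_eq)
qed (simp add: flat_def)

lemma has_field_derivative_flat:
  "(flat k has_field_derivative flat (k + 2) s - real k * flat (k + 1) s) (at s)"
proof (cases s "0 :: real" rule: linorder_cases)
  case less
  show ?thesis
    by (rule has_field_derivative_transform_within_open[of "\<lambda>_. 0" _ _ "{..<0}"])
       (use less in \<open>auto simp: flat_def\<close>)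
next
  case greater
  have "((\<lambda>s. exp (- 1 / s) / s ^ k) has_field_derivative flat (k + 2) s - real k * flat (k + 1) s) (at s)"
  proof -
    have "((\<lambda>s. exp (- 1 / s) / s ^ k) has_field_derivative
       (exp (- 1 / s) * (1 / s\<^sup>2) * s ^ k - exp (- 1 / s) * (real k * s ^ (k - 1))) / (s ^ k * s ^ k)) (at s)"
      by (rule derivative_eq_intros refl | use greater in \<open>simp add: power2_eq_square\<close>)+
    moreover have "(exp (- 1 / s) * (1 / s\<^sup>2) * s ^ k - exp (- 1 / s) * (real k * s ^ (k - 1))) / (s ^ k * s ^ k)
        = flat (k + 2) s - real k * flat (k + 1) s"
      using greater by (cases k) (auto simp: flat_def field_simps power2_eq_square)
    ultimately show ?thesis by simp
  qed
  then show ?thesis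
    by (rule has_field_derivative_transform_within_open[of _ _ _ "{0<..}"])
       (use greater in \<open>auto simp: flat_def\<close>)
next
  case equal
  have "((\<lambda>h. (flat k h - flat k 0) / (h - 0)) \<longlongrightarrow> 0) (at 0)"
  proof (rule Lim_null_comparison)
    show "((\<lambda>h. fact (k + 2) * \<bar>h\<bar>) \<longlongrightarrow> (0::real)) (at 0)"
      by (rule tendsto_eq_intros refl | simp)+
    show "\<forall>\<^sub>F h in at 0. norm ((flat k h - flat k 0) / (h - 0)) \<le> fact (k + 2) * \<bar>h\<bar>"
    proof (rule always_eventually, rule allI)
      fix h :: real
      have "\<bar>flat k h\<bar> \<le> fact (k + 2) * \<bar>h\<bar> * \<bar>h\<bar>"
        using flat_le[of k h] flat_nonneg[of k h] by (simp add: power2_eq_square flip: abs_mult)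
      then show "norm ((flat k h - flat k 0) / (h - 0)) \<le> fact (k + 2) * \<bar>h\<bar>"
        by (cases "h = 0") (auto simp: flat_def[of k 0] divide_le_eq)
    qed
  qed
  then show ?thesis using equal by (simp add: has_field_derivative_iff flat_def[of _ 0])
qed

text \<open>The algebra generated by constants, linear functions and radial functions \<open>flat k (s - \<bar>z - z0\<bar>\<^sup>2)\<close>. It is
closed under directional derivatives, so all of its members are smooth.\<close>

inductive flat_alg :: "('a::euclidean_space \<Rightarrow> real) \<Rightarrow> bool" where
  flat_alg_const: "flat_alg (\<lambda>z. c)"
| flat_alg_inner: "flat_alg (\<lambda>z. z \<bullet> e)"
| flat_alg_flat: "flat_alg (\<lambda>z. flat k (s - (norm (z - z0))\<^sup>2))"
| flat_alg_add: "flat_alg f \<Longrightarrow> flat_alg g \<Longrightarrow> flat_alg (\<lambda>z. f z + g z)"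
| flat_alg_mult: "flat_alg f \<Longrightarrow> flat_alg g \<Longrightarrow> flat_alg (\<lambda>z. f z * g z)"

lemma flat_alg_derivative:
  "flat_alg f \<Longrightarrow> \<exists>f'. (\<forall>z. (f has_derivative f' z) (at z)) \<and> (\<forall>e. flat_alg (\<lambda>z. f' z e))"
proof (induction rule: flat_alg.induct)
  case (flat_alg_const c)
  show ?case by (intro exI[of _ "\<lambda>_ _. 0"]) (auto intro: flat_alg.intros)
next
  case (flat_alg_inner e)
  show ?case
    by (intro exI[of _ "\<lambda>_ h. h \<bullet> e"]) (auto intro!: flat_alg.intros derivative_eq_intros)
next
  case (flat_alg_flat k s z0)
  let ?w = "\<lambda>z. s - (norm (z - z0))\<^sup>2"
  let ?D = "\<lambda>z h. (flat (k + 2) (?w z) + (- real k) * flat (k + 1) (?w z)) * ((- 2) * (z \<bullet> h + (- (z0 \<bullet> h))))"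
  have "((\<lambda>z. flat k (?w z)) has_derivative ?D z) (at z)" for z
  proof -
    have w: "(?w has_derivative (\<lambda>h. - (2 * ((z - z0) \<bullet> h)))) (at z)"
      unfolding power2_norm_eq_inner
      by (rule derivative_eq_intros refl)+ (auto simp: inner_commute fun_eq_iff)
    have "((\<lambda>z. flat k (?w z)) has_derivative
        (\<lambda>h. (flat (k + 2) (?w z) - real k * flat (k + 1) (?w z)) * (- (2 * ((z - z0) \<bullet> h))))) (at z)"
      using has_derivative_compose[OF w has_field_derivative_flat[unfolded has_field_derivative_def, of k "?w z"]]
      by (simp add: mult.commute)
    then show ?thesis by (simp add: inner_diff_left algebra_simps)
  qed
  moreover have "flat_alg (\<lambda>z. ?D z e)" for e
    by (intro flat_alg.intros)
  ultimately show ?case by (intro exI[of _ ?D]) blast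
next
  case (flat_alg_add f g)
  then obtain f' g' where "\<forall>z. (f has_derivative f' z) (at z)" "\<forall>e. flat_alg (\<lambda>z. f' z e)"
    "\<forall>z. (g has_derivative g' z) (at z)" "\<forall>e. flat_alg (\<lambda>z. g' z e)" by blast
  then show ?case
    by (intro exI[of _ "\<lambda>z h. f' z h + g' z h"]) (auto intro!: flat_alg.flat_alg_add has_derivative_add)
next
  case (flat_alg_mult f g)
  then obtain f' g' where *: "\<forall>z. (f has_derivative f' z) (at z)" "\<forall>e. flat_alg (\<lambda>z. f' z e)"
    "\<forall>z. (g has_derivative g' z) (at z)" "\<forall>e. flat_alg (\<lambda>z. g' z e)" by blast
  have "((\<lambda>z. f z * g z) has_derivative (\<lambda>h. f z * g' z h + f' z h * g z)) (at z)" for z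
    using * has_derivative_mult by blast
  moreover have "flat_alg (\<lambda>z. f z * g' z e + f' z e * g z)" for e
    by (intro flat_alg.flat_alg_add flat_alg.flat_alg_mult flat_alg_mult.hyps *(2)[rule_format] *(4)[rule_format])
  ultimately show ?case by (intro exI[of _ "\<lambda>z h. f z * g' z h + f' z h * g z"]) blast
qed

lemma flat_alg_has_derivative:
  "flat_alg f \<Longrightarrow> (f has_derivative frechet_derivative f (at z)) (at z)"
proof -
  assume "flat_alg f"
  then obtain f' where "(f has_derivative f') (at z)" using flat_alg_derivative[of f] by blast
  then have "f differentiable (at z)" by (rule differentiableI)
  then show ?thesis by (simp add: frechet_derivative_works)
qed

lemma flat_alg_frechet_derivative:
  assumes "flat_alg f"
  shows "flat_alg (\<lambda>z. frechet_derivative f (at z) e)"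
proof -
  obtain f' where f': "\<And>z. (f has_derivative f' z) (at z)" "\<And>e. flat_alg (\<lambda>z. f' z e)"
    using flat_alg_derivative[OF assms] by blast
  have "frechet_derivative f (at z) = f' z" for z
    using frechet_derivative_at[OF f'(1)] by simp
  then show ?thesis using f'(2) by simp
qed

lemma flat_alg_continuous: "flat_alg f \<Longrightarrow> continuous_on S f"
  by (rule has_derivative_continuous_on, rule has_derivative_at_withinI, rule flat_alg_has_derivative)

lemma flat_alg_dir_derivs: "flat_alg f \<Longrightarrow> flat_alg (dir_derivs es f)"
  by (induction es arbitrary: f) (auto intro: flat_alg_frechet_derivative)

lemma flat_alg_smooth: "flat_alg f \<Longrightarrow> smooth f"
  unfolding smooth_def
  by (intro allI, rule differentiableI, rule flat_alg_has_derivative, erule flat_alg_dir_derivs)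

lemma dir_derivs_append: "dir_derivs (es @ es') f = dir_derivs es' (dir_derivs es f)"
  by (induction es arbitrary: f) auto

lemma dir_derivs_reflect:
  "flat_alg f \<Longrightarrow> dir_derivs es (\<lambda>y. c * f (z - y)) = (\<lambda>y. (- 1) ^ length es * c * dir_derivs es f (z - y))"
proof (induction es arbitrary: f c)
  case (Cons e es)
  have "frechet_derivative (\<lambda>y. c * f (z - y)) (at y) e = (- c) * frechet_derivative f (at (z - y)) e" for y
  proof -
    have d: "((\<lambda>y. z - y) has_derivative (\<lambda>h. - h)) (at y)" by (auto intro!: derivative_eq_intros)
    have "((\<lambda>y. f (z - y)) has_derivative (\<lambda>h. frechet_derivative f (at (z - y)) (- h))) (at y)"
      by (rule has_derivative_compose[OF d flat_alg_has_derivative[OF Cons.prems]])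
    then have D: "((\<lambda>y. c * f (z - y)) has_derivative (\<lambda>h. c * frechet_derivative f (at (z - y)) (- h))) (at y)"
      by (rule has_derivative_mult_right)
    have "frechet_derivative (\<lambda>y. c * f (z - y)) (at y) e = c * frechet_derivative f (at (z - y)) (- e)"
      by (simp add: frechet_derivative_at[OF D, symmetric])
    also have "frechet_derivative f (at (z - y)) (- e) = - frechet_derivative f (at (z - y)) e"
      using flat_alg_has_derivative[OF Cons.prems, THEN has_derivative_linear] by (rule linear_neg)
    finally show ?thesis by simp
  qed
  then show ?case
    using Cons.IH[OF flat_alg_frechet_derivative[OF Cons.prems], of "- c" e] by simp
qed simp

lemma dir_derivs_zero:
  assumes "open U" "\<And>z. z \<in> U \<Longrightarrow> f z = 0" "z \<in> U"
  shows "dir_derivs es f z = 0"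
  using assms
proof (induction es arbitrary: f z)
  case (Cons e es)
  have "frechet_derivative f (at z) e = 0" if "z \<in> U" for z
  proof -
    have "(f has_derivative (\<lambda>_. 0)) (at z)"
      by (rule has_derivative_transform_within_open[of "\<lambda>_. 0" _ _ _ U]) (use Cons.prems that in auto)
    from frechet_derivative_at[OF this, symmetric] show ?thesis by simp
  qed
  then show ?case using Cons by simp
qed simp

definition radius :: "nat \<Rightarrow> real" where "radius k = 1 / (real k + 1)"

lemma radius_pos: "0 < radius k" by (simp add: radius_def)

definition bump :: "nat \<Rightarrow> 'a::euclidean_space \<Rightarrow> real" where
  "bump k z = flat 0 ((radius k)\<^sup>2 - (norm z)\<^sup>2)"

definition rho :: "nat \<Rightarrow> 'a::euclidean_space \<Rightarrow> real" where
  "rho k z = bump k z * inverse (integral\<^sup>L lborel (bump k :: 'a \<Rightarrow> real))"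

lemma flat_alg_bump: "flat_alg (bump k)"
  using flat_alg_flat[of 0 "(radius k)\<^sup>2" 0] by (simp add: bump_def[abs_def])

lemma flat_alg_rho: "flat_alg (rho k)"
  unfolding rho_def[abs_def] by (intro flat_alg.intros flat_alg_bump)

lemma bump_zero: "radius k \<le> norm z \<Longrightarrow> bump k z = 0"
  using power_mono[of "radius k" "norm z" 2] radius_pos[of k] by (simp add: bump_def flat_def)

lemma integrable_bump: "integrable lborel (bump k)"
proof -
  have "integrable lborel (\<lambda>x. indicator (cball 0 (radius k)) x *\<^sub>R bump k x)"
    by (rule borel_integrable_compact) (auto intro: flat_alg_continuous flat_alg_bump)
  also have "(\<lambda>x. indicator (cball 0 (radius k)) x *\<^sub>R bump k x) = bump k"
    using bump_zero by (force simp: indicator_def)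
  finally show ?thesis .
qed

lemma integral_bump_pos: "0 < integral\<^sup>L lborel (bump k :: 'a::euclidean_space \<Rightarrow> real)"
proof -
  let ?r = "radius k / 2" 
  let ?m = "exp (- 1 / ((radius k)\<^sup>2 / 2))"
  have le: "?m * indicator (ball 0 ?r) z \<le> bump k z" for z :: 'a
  proof (cases "z \<in> ball 0 ?r")
    case True
    then have "(norm z)\<^sup>2 \<le> ?r\<^sup>2" by (intro power_mono) auto
    then have "4 * (norm z)\<^sup>2 \<le> (radius k)\<^sup>2" by (simp add: power_divide)
    then have s: "(radius k)\<^sup>2 / 2 \<le> (radius k)\<^sup>2 - (norm z)\<^sup>2"
      using zero_le_power2[of "norm z"] by linarith
    have p: "0 < (radius k)\<^sup>2 / 2" using radius_pos[of k] by simp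
    then have "?m \<le> exp (- 1 / ((radius k)\<^sup>2 - (norm z)\<^sup>2))"
      using frac_le[OF _ _ p s, of 1 1] by simp
    moreover have "0 < (radius k)\<^sup>2 - (norm z)\<^sup>2" using s p by linarith
    ultimately show ?thesis using True by (simp add: bump_def flat_def)
  qed (simp add: bump_def flat_nonneg)
  have "0 < ?m * measure lborel (ball (0::'a) ?r)"
    using content_ball_pos[of ?r "0::'a"] radius_pos[of k] by simp
  also have "\<dots> = integral\<^sup>L lborel (\<lambda>z. ?m * indicator (ball (0::'a) ?r) z)"
    by simp
  also have "\<dots> \<le> integral\<^sup>L lborel (bump k :: 'a \<Rightarrow> real)"
    by (intro integral_mono integrable_bump le integrable_mult_right integrable_real_indicator)
       (use emeasure_bounded_finite[OF bounded_ball] in auto)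
  finally show ?thesis .
qed

lemma rho_nonneg: "0 \<le> rho k z"
  unfolding rho_def using integral_bump_pos by (auto simp: bump_def flat_nonneg intro!: mult_nonneg_nonneg less_imp_le)

lemma rho_zero: "radius k \<le> norm z \<Longrightarrow> rho k z = 0"
  by (simp add: rho_def bump_zero)

lemma integrable_rho: "integrable lborel (rho k)"
  unfolding rho_def[abs_def] by (intro integrable_mult_left integrable_bump)

lemma integral_rho: "integral\<^sup>L lborel (rho k :: 'a::euclidean_space \<Rightarrow> real) = 1"
  unfolding rho_def[abs_def] using integral_bump_pos[of k, where 'a='a] by simp

lemma continuous_rho: "continuous_on S (rho k)"
  by (intro flat_alg_continuous flat_alg_rho)

lemma measurable_rho [measurable]: "rho k \<in> borel_measurable borel"
  by (intro borel_measurable_continuous_onI continuous_rho)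

lemma rho_bounded: "\<exists>B. \<forall>z. rho k z \<le> B"
proof -
  have "flat 0 s \<le> 1" for s by (simp add: flat_def)
  then have "bump k z \<le> 1" for z :: 'a by (simp add: bump_def)
  then have "rho k (z::'a) \<le> inverse (integral\<^sup>L lborel (bump k :: 'a \<Rightarrow> real))" for z
    unfolding rho_def using integral_bump_pos[of k, where 'a='a]
    by (simp add: mult_le_cancel_right1)
  then show ?thesis by blast
qed

text \<open>The translated and reflected mollifier belongs to \<open>flat_alg\<close> because this class contains the radial
functions about every centre.\<close>

lemma rho_test_function:
  assumes "cball z (radius k) \<subseteq> \<Omega>"
  shows "(\<lambda>y. rho k (z - y)) \<in> test_functions \<Omega>"
proof -
  have "flat_alg (\<lambda>y. flat 0 ((radius k)\<^sup>2 - (norm (y - z))\<^sup>2) * inverse (integral\<^sup>L lborel (bump k :: 'a \<Rightarrow> real)))"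
    by (intro flat_alg.intros)
  then have "flat_alg (\<lambda>y. rho k (z - y))" by (simp add: rho_def bump_def norm_minus_commute)
  then have s: "smooth (\<lambda>y. rho k (z - y))" by (rule flat_alg_smooth)
  have "{y. rho k (z - y) \<noteq> 0} \<subseteq> cball z (radius k)"
    using rho_zero[of k] by (force simp: dist_norm)
  then have sub: "closure {y. rho k (z - y) \<noteq> 0} \<subseteq> cball z (radius k)" by (rule closure_minimal) simp
  then have "compact (closure {y. rho k (z - y) \<noteq> 0})"
    by (meson bounded_cball bounded_subset closed_closure compact_eq_bounded_closed)
  then show ?thesis using s sub assms by (auto simp: test_functions_def)
qed

section \<open>Convergence of mollifications\<close>

lemma lborel_distr_translate: "distr lborel borel (\<lambda>z. z - y) = (lborel :: 'a::euclidean_space measure)"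
proof -
  have "(+) (- y) = (\<lambda>z. z - y)" by auto
  then show ?thesis using lborel_distr_plus[of "- y"] by simp
qed

lemma lborel_distr_reflect: "distr lborel borel (\<lambda>x. z - x) = (lborel :: 'a::euclidean_space measure)"
  by (subst lborel_affine[of "- 1" z]) (auto simp: density_1)

lemma integrable_translate:
  fixes f :: "'a::euclidean_space \<Rightarrow> real"
  assumes "integrable lborel f"
  shows "integrable lborel (\<lambda>z. f (z - y))" "(LINT z|lborel. f (z - y)) = integral\<^sup>L lborel f"
proof -
  have m: "f \<in> borel_measurable borel" using assms by auto
  have "integrable (distr lborel borel (\<lambda>z. z - y)) f" using assms by (simp add: lborel_distr_translate)
  then show "integrable lborel (\<lambda>z. f (z - y))" by (subst (asm) integrable_distr_eq) (use m in auto)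
  have "integral\<^sup>L (distr lborel borel (\<lambda>z. z - y)) f = (LINT z|lborel. f (z - y))"
    by (rule integral_distr) (use m in auto)
  then show "(LINT z|lborel. f (z - y)) = integral\<^sup>L lborel f" by (simp add: lborel_distr_translate)
qed

lemma integrable_reflect:
  fixes f :: "'a::euclidean_space \<Rightarrow> real"
  assumes "f \<in> borel_measurable borel"
  shows "integrable lborel (\<lambda>y. f (z - y)) \<longleftrightarrow> integrable lborel f"
    and "(LINT y|lborel. f (z - y)) = integral\<^sup>L lborel f"
proof -
  have "integrable (distr lborel borel (\<lambda>y. z - y)) f \<longleftrightarrow> integrable lborel (\<lambda>y. f (z - y))"
    by (rule integrable_distr_eq) (use assms in auto)
  then show "integrable lborel (\<lambda>y. f (z - y)) \<longleftrightarrow> integrable lborel f" by (simp add: lborel_distr_reflect)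
  have "integral\<^sup>L (distr lborel borel (\<lambda>y. z - y)) f = (LINT y|lborel. f (z - y))"
    by (rule integral_distr) (use assms in auto)
  then show "(LINT y|lborel. f (z - y)) = integral\<^sup>L lborel f" by (simp add: lborel_distr_reflect)
qed

definition shift_dist :: "('a::euclidean_space \<Rightarrow> real) \<Rightarrow> 'a \<Rightarrow> real" where
  "shift_dist f y = (LINT z|lborel. \<bar>f (z - y) - f z\<bar>)"

text \<open>Enclose \<open>A\<close> between a compact set \<open>K\<close> and an open set \<open>U\<close> whose difference has small measure. A translation by less
than the distance from \<open>K\<close> to the complement of \<open>U\<close> changes the indicator of \<open>A\<close> only where \<open>U - K\<close> or its
translate is met.\<close>

lemma indicator_translation_continuity:
  fixes A :: "'a::euclidean_space set"
  assumes A: "A \<in> sets borel" "emeasure lborel A < \<infinity>" and e: "0 < e"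
  obtains d where "0 < d" "\<And>y. norm y < d \<Longrightarrow> shift_dist (indicator A) y \<le> e"
proof -
  have e8: "0 < e / 8" using e by simp
  obtain U where U: "open U" "A \<subseteq> U" "emeasure lborel (U - A) < ennreal (e / 8)"
    using outer_regular_lborel[OF A(1) e8] .
  have "A \<in> sets lebesgue" using A(1) by simp
  from sets_lebesgue_inner_closed[OF this e8]
  obtain T where T: "closed T" "T \<subseteq> A" "emeasure lebesgue (A - T) < ennreal (e / 8)" .
  have "(\<lambda>n. emeasure lborel (A - cball 0 (real n))) \<longlonglongrightarrow> emeasure lborel (\<Inter>n. A - cball 0 (real n))"
  proof (rule Lim_emeasure_decseq)
    show "decseq (\<lambda>n. A - cball 0 (real n))" by (auto simp: decseq_def)
    show "emeasure lborel (A - cball 0 (real n)) \<noteq> \<infinity>" for n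
      using emeasure_mono[of "A - cball 0 (real n)" A lborel] A by (auto simp: top_unique)
  qed (use A in auto)
  moreover have "(\<Inter>n. A - cball 0 (real n)) = {}"
    using real_arch_simple by (auto simp: not_le)
  ultimately have "(\<lambda>n. emeasure lborel (A - cball 0 (real n))) \<longlonglongrightarrow> 0" by (simp only: emeasure_empty)
  from order_tendstoD(2)[OF this, of "ennreal (e / 8)"] e8
  obtain n where n: "emeasure lborel (A - cball 0 (real n)) < ennreal (e / 8)"
    by (auto dest: eventually_happens)
  define K where "K = T \<inter> cball 0 (real n)"
  have K: "compact K" "K \<subseteq> A" using T by (auto simp: K_def closed_Int_compact)
  have UK: "U - K \<in> sets borel" using U(1) compact_imp_closed[OF K(1)] by auto
  have "emeasure lborel (U - K) \<le> emeasure lborel ((U - A) \<union> ((A - T) \<union> (A - cball 0 (real n))))"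
    using U T A by (intro emeasure_mono) (auto simp: K_def)
  also have "\<dots> \<le> emeasure lborel (U - A) + emeasure lborel ((A - T) \<union> (A - cball 0 (real n)))"
    using U T A by (intro emeasure_subadditive) auto
  also have "\<dots> \<le> emeasure lborel (U - A) + (emeasure lborel (A - T) + emeasure lborel (A - cball 0 (real n)))"
    using U T A by (intro add_left_mono emeasure_subadditive) auto
  also have "\<dots> \<le> ennreal (e / 8) + (ennreal (e / 8) + ennreal (e / 8))"
    using U(3) T(1,3) n A(1) by (intro add_mono) auto
  also have "\<dots> \<le> ennreal (e / 2)" using e by (simp flip: ennreal_plus)
  finally have le: "emeasure lborel (U - K) \<le> ennreal (e / 2)" .
  then have fin: "emeasure lborel (U - K) < \<infinity>" by (simp add: le_less_trans)
  have mle: "measure lborel (U - K) \<le> e / 2"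
    using le e by (simp add: emeasure_eq_ennreal_measure[OF fin[unfolded less_top[symmetric] infinity_ennreal_def]])
  obtain d where d: "d > 0" "\<forall>x\<in>K. \<forall>y\<in>- U. d \<le> dist x y"
    using separate_compact_closed[OF K(1), of "- U"] U K by auto
  have "shift_dist (indicator A) y \<le> e" if y: "norm y < d" for y
  proof -
    have inU: "z + y \<in> U" "z - y \<in> U" if "z \<in> K" for z
      using d(2)[rule_format, OF that, of "z + y"] d(2)[rule_format, OF that, of "z - y"] y by (auto simp: dist_norm)
    have i: "integrable lborel (indicator (U - K) :: 'a \<Rightarrow> real)" using fin UK by auto
    have iA: "integrable lborel (indicator A :: 'a \<Rightarrow> real)" using A by auto
    have pt: "\<bar>indicator A (z - y) - indicator A z :: real\<bar> \<le> indicator (U - K) (z - y) + indicator (U - K) z" for z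
    proof -
      have "z - y \<in> U" if "z \<in> K" using inU(2)[OF that] .
      moreover have "z \<in> U" if "z - y \<in> K" using inU(1)[OF that] by simp
      ultimately show ?thesis using U(2) K(2) by (auto simp: indicator_def)
    qed
    have "shift_dist (indicator A) y \<le> (LINT z|lborel. indicator (U - K) (z - y) + indicator (U - K) z)"
      unfolding shift_dist_def
      by (intro integral_mono integrable_abs Bochner_Integration.integrable_diff Bochner_Integration.integrable_add
          integrable_translate(1)[OF i] integrable_translate(1)[OF iA] i iA pt)
    also have "\<dots> = (LINT z|lborel. indicator (U - K) (z - y)) + (LINT z|lborel. indicator (U - K) z)"
      by (intro Bochner_Integration.integral_add integrable_translate(1)[OF i] i)
    also have "\<dots> = 2 * measure lborel (U - K)"
      using UK by (simp add: integrable_translate(2)[OF i])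
    finally show ?thesis using mle by simp
  qed
  then show ?thesis using that d(1) by blast
qed

text \<open>Linear combinations and limits in the mean inherit the continuity from indicators, because the distance of two
translates equals the distance of the functions themselves.\<close>

lemma translation_continuity:
  fixes f :: "'a::euclidean_space \<Rightarrow> real"
  assumes "integrable lborel f"
  shows "\<forall>e>0. \<exists>d>0. \<forall>y. norm y < d \<longrightarrow> shift_dist f y \<le> e"
  using assms
proof (induction rule: integrable_induct)
  case (base A c)
  show ?case
  proof (intro allI impI)
    fix e :: real assume "0 < e"
    then have "0 < e / (\<bar>c\<bar> + 1)" by simp
    then obtain d where d: "0 < d" "\<And>y. norm y < d \<Longrightarrow> shift_dist (indicator A) y \<le> e / (\<bar>c\<bar> + 1)"
      using indicator_translation_continuity[of A] base by (metis sets_lborel)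
    have "shift_dist (\<lambda>x. indicator A x *\<^sub>R c) y \<le> e" if "norm y < d" for y
    proof -
      have "shift_dist (\<lambda>x. indicator A x *\<^sub>R c) y = shift_dist (indicator A) y * \<bar>c\<bar>"
        unfolding shift_dist_def by (simp add: abs_mult flip: left_diff_distrib)
      also have "\<dots> \<le> e / (\<bar>c\<bar> + 1) * \<bar>c\<bar>" by (intro mult_right_mono d(2) that) auto
      also have "\<dots> \<le> e" using \<open>0 < e\<close> by (simp add: field_simps)
      finally show ?thesis .
    qed
    then show "\<exists>d>0. \<forall>y. norm y < d \<longrightarrow> shift_dist (\<lambda>x. indicator A x *\<^sub>R c) y \<le> e"
      using d(1) by blast
  qed
next
  case (add f g)
  have le: "shift_dist (\<lambda>x. f x + g x) y \<le> shift_dist f y + shift_dist g y" for y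
  proof -
    have "shift_dist (\<lambda>x. f x + g x) y \<le> (LINT z|lborel. \<bar>f (z - y) - f z\<bar> + \<bar>g (z - y) - g z\<bar>)"
      unfolding shift_dist_def
      by (intro integral_mono integrable_abs Bochner_Integration.integrable_diff Bochner_Integration.integrable_add
          integrable_translate(1) add.hyps) auto
    also have "\<dots> = shift_dist f y + shift_dist g y"
      unfolding shift_dist_def
      by (intro Bochner_Integration.integral_add integrable_abs Bochner_Integration.integrable_diff
          integrable_translate(1) add.hyps)
    finally show ?thesis .
  qed
  show ?case
  proof (intro allI impI)
    fix e :: real assume "0 < e"
    then have e2: "0 < e / 2" by simp
    obtain d1 where d1: "d1 > 0" "\<And>y. norm y < d1 \<Longrightarrow> shift_dist f y \<le> e / 2"
      using add.IH(1)[rule_format, OF e2] by auto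
    obtain d2 where d2: "d2 > 0" "\<And>y. norm y < d2 \<Longrightarrow> shift_dist g y \<le> e / 2"
      using add.IH(2)[rule_format, OF e2] by auto
    have "shift_dist (\<lambda>x. f x + g x) y \<le> e" if "norm y < min d1 d2" for y
      using le[of y] d1(2)[of y] d2(2)[of y] that by simp
    then show "\<exists>d>0. \<forall>y. norm y < d \<longrightarrow> shift_dist (\<lambda>x. f x + g x) y \<le> e"
      using d1(1) d2(1) by (intro exI[of _ "min d1 d2"]) auto
  qed
next
  case (lim f s)
  have conv: "(\<lambda>i. LINT z|lborel. \<bar>s i z - f z\<bar>) \<longlonglongrightarrow> (LINT (z::'a)|lborel. (0::real))"
  proof (rule integral_dominated_convergence[where w="\<lambda>z. 3 * \<bar>f z\<bar>"])
    show "AE z in lborel. (\<lambda>i. \<bar>s i z - f z\<bar>) \<longlonglongrightarrow> 0"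
      using lim.hyps(2) by (auto intro!: tendsto_rabs_zero simp: LIM_zero_iff)
    show "AE z in lborel. norm \<bar>s i z - f z\<bar> \<le> 3 * \<bar>f z\<bar>" for i
    proof (rule AE_I2)
      fix z assume "z \<in> space (lborel :: 'a measure)"
      from lim.hyps(3)[OF this, of i] show "norm \<bar>s i z - f z\<bar> \<le> 3 * \<bar>f z\<bar>" by simp
    qed
  qed (use lim in auto)
  show ?case
  proof (intro allI impI)
    fix e :: real assume "0 < e"
    then have "eventually (\<lambda>i. (LINT z|lborel. \<bar>s i z - f z\<bar>) < e / 3) sequentially"
      using order_tendstoD(2)[OF conv, of "e / 3"] by simp
    then obtain i where i: "(LINT z|lborel. \<bar>s i z - f z\<bar>) < e / 3" by (auto dest: eventually_happens)
    have e3: "0 < e / 3" using \<open>0 < e\<close> by simp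
    obtain d where d: "d > 0" "\<forall>y. norm y < d \<longrightarrow> shift_dist (s i) y \<le> e / 3"
      using lim.IH[of i, rule_format, OF e3] by auto
    have "shift_dist f y \<le> e" if "norm y < d" for y
    proof -
      let ?h = "\<lambda>z. \<bar>s i z - f z\<bar>"
      have h: "integrable lborel ?h" using lim by auto
      have "shift_dist f y \<le> (LINT z|lborel. ?h (z - y) + \<bar>s i (z - y) - s i z\<bar> + ?h z)"
        unfolding shift_dist_def using lim h
        by (intro integral_mono Bochner_Integration.integrable_add integrable_translate(1) integrable_abs
            Bochner_Integration.integrable_diff) auto
      also have "\<dots> = (LINT z|lborel. ?h (z - y)) + shift_dist (s i) y + (LINT z|lborel. ?h z)"
      proof -
        have a: "integrable lborel (\<lambda>z. ?h (z - y))" by (rule integrable_translate(1)[OF h])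
        have b: "integrable lborel (\<lambda>z. \<bar>s i (z - y) - s i z\<bar>)"
          by (intro integrable_abs Bochner_Integration.integrable_diff integrable_translate(1) lim.hyps)
        show ?thesis unfolding shift_dist_def
          using Bochner_Integration.integral_add[OF Bochner_Integration.integrable_add[OF a b] h]
            Bochner_Integration.integral_add[OF a b] by simp
      qed
      also have "(LINT z|lborel. ?h (z - y)) = (LINT z|lborel. ?h z)" by (rule integrable_translate(2)[OF h])
      finally show ?thesis using i d that by fastforce
    qed
    then show "\<exists>d>0. \<forall>y. norm y < d \<longrightarrow> shift_dist f y \<le> e" using d by blast
  qed
qed

text \<open>The integral is taken with respect to Lebesgue rather than Borel measure, since weak derivatives are only
Lebesgue measurable.\<close>

definition mollify :: "nat \<Rightarrow> ('a::euclidean_space \<Rightarrow> real) \<Rightarrow> 'a \<Rightarrow> real" where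
  "mollify k f z = (LINT y|lebesgue. f y * rho k (z - y))"

lemma integrable_mult_rho:
  fixes f :: "'a::euclidean_space \<Rightarrow> real"
  assumes "integrable lebesgue f"
  shows "integrable lebesgue (\<lambda>y. f y * rho k (z - y))"
proof -
  obtain B where B: "\<And>w::'a. rho k w \<le> B" using rho_bounded by blast
  show ?thesis
  proof (rule Bochner_Integration.integrable_bound[of _ "\<lambda>y. B * f y"])
    show "AE y in lebesgue. norm (f y * rho k (z - y)) \<le> norm (B * f y)"
    proof (rule AE_I2)
      fix y
      have "\<bar>f y\<bar> * rho k (z - y) \<le> \<bar>f y\<bar> * B" by (intro mult_left_mono B) auto
      then show "norm (f y * rho k (z - y)) \<le> norm (B * f y)"
        using rho_nonneg[of k "z - y"] B[of "z - y"] by (simp add: abs_mult mult.commute)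
    qed
    have "(\<lambda>y. rho k (z - y)) \<in> borel_measurable lebesgue"
      by (intro measurable_completion) measurable
    then show "(\<lambda>y. f y * rho k (z - y)) \<in> borel_measurable lebesgue"
      using assms by (intro borel_measurable_times) auto
  qed (use assms in auto)
qed

lemma mollify_lborel:
  fixes f :: "'a::euclidean_space \<Rightarrow> real"
  assumes "integrable lborel f"
  shows "mollify k f z = (LINT y|lborel. f (z - y) * rho k y)"
proof -
  have [measurable]: "f \<in> borel_measurable borel" using assms by auto
  have "mollify k f z = (LINT y|lborel. f y * rho k (z - y))"
    unfolding mollify_def by (rule integral_completion) measurable
  also have "\<dots> = (LINT y|lborel. (\<lambda>w. f (z - w) * rho k w) (z - y))" by simp
  also have "\<dots> = (LINT y|lborel. f (z - y) * rho k y)" by (rule integrable_reflect(2)) measurable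
  finally show ?thesis .
qed

lemma mollify_measurable:
  fixes f :: "'a::euclidean_space \<Rightarrow> real"
  assumes "integrable lborel f"
  shows "mollify k f \<in> borel_measurable borel"
proof -
  have [measurable]: "f \<in> borel_measurable borel" using assms by auto
  have "(\<lambda>z. LINT y|lborel. f (z - y) * rho k y) \<in> borel_measurable borel"
    by (rule lborel.borel_measurable_lebesgue_integral) measurable
  then show ?thesis using mollify_lborel[OF assms] by (simp cong: measurable_cong)
qed

text \<open>By Fubini's theorem, the error of a mollification is an average of \<open>shift_dist f y\<close> over
\<open>\<bar>y\<bar> < radius k\<close>.\<close>

lemma mollify_L1_bound:
  fixes f :: "'a::euclidean_space \<Rightarrow> real"
  assumes f: "integrable lborel f" and e: "\<And>y. norm y < radius k \<Longrightarrow> shift_dist f y \<le> e"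
  shows "(\<integral>\<^sup>+z. ennreal \<bar>mollify k f z - f z\<bar> \<partial>lborel) \<le> ennreal e"
proof -
  have [measurable]: "f \<in> borel_measurable borel" using f by auto
  have fr: "integrable lborel (\<lambda>y. f (z - y) * rho k y)" for z
  proof -
    have "integrable lborel (\<lambda>y. f y * rho k (z - y))"
      using integrable_mult_rho[of f k z] f by (simp add: integrable_completion)
    then show ?thesis using integrable_reflect(1)[of "\<lambda>y. f y * rho k (z - y)" z] by simp
  qed
  have "ennreal \<bar>mollify k f z - f z\<bar> \<le> (\<integral>\<^sup>+y. ennreal (\<bar>f (z - y) - f z\<bar> * rho k y) \<partial>lborel)" for z
  proof -
    have "mollify k f z - f z = (LINT y|lborel. f (z - y) * rho k y) - (LINT (y::'a)|lborel. f z * rho k y)"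
      by (simp add: mollify_lborel[OF f] integral_rho)
    also have "\<dots> = (LINT (y::'a)|lborel. f (z - y) * rho k y - f z * rho k y)"
      by (intro Bochner_Integration.integral_diff[symmetric] fr integrable_mult_right integrable_rho)
    finally have eq: "mollify k f z - f z = (LINT y|lborel. (f (z - y) - f z) * rho k y)"
      by (simp add: left_diff_distrib)
    have "integrable lborel (\<lambda>y. f (z - y) * rho k y - f z * rho k y)"
      by (intro Bochner_Integration.integrable_diff fr integrable_mult_right integrable_rho)
    then have "ennreal (norm (LINT y|lborel. (f (z - y) - f z) * rho k y))
       \<le> (\<integral>\<^sup>+y. norm ((f (z - y) - f z) * rho k y) \<partial>lborel)"
      by (intro integral_norm_bound_ennreal) (simp add: left_diff_distrib)
    then show ?thesis by (simp add: eq abs_mult rho_nonneg)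
  qed
  then have "(\<integral>\<^sup>+z. ennreal \<bar>mollify k f z - f z\<bar> \<partial>lborel)
      \<le> (\<integral>\<^sup>+z. \<integral>\<^sup>+y. ennreal (\<bar>f (z - y) - f z\<bar> * rho k y) \<partial>lborel \<partial>lborel)"
    by (rule nn_integral_mono)
  also have "\<dots> = (\<integral>\<^sup>+y. \<integral>\<^sup>+z. ennreal (\<bar>f (z - y) - f z\<bar> * rho k y) \<partial>lborel \<partial>lborel)"
    by (rule lborel_pair.Fubini') measurable
  also have "\<dots> \<le> (\<integral>\<^sup>+(y::'a). ennreal e * ennreal (rho k y) \<partial>lborel)"
  proof (rule nn_integral_mono)
    fix y :: 'a
    have i: "integrable lborel (\<lambda>z. \<bar>f (z - y) - f z\<bar> * rho k y)"
      using f by (intro integrable_mult_left integrable_abs Bochner_Integration.integrable_diff integrable_translate(1))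
    have "(\<integral>\<^sup>+z. ennreal (\<bar>f (z - y) - f z\<bar> * rho k y) \<partial>lborel) = ennreal (shift_dist f y * rho k y)"
      using nn_integral_eq_integral[OF i] by (simp add: shift_dist_def rho_nonneg)
    also have "\<dots> \<le> ennreal (e * rho k y)"
      using rho_zero[of k y] e[of y] rho_nonneg[of k y]
      by (intro ennreal_leI) (cases "norm y < radius k", auto intro: mult_right_mono)
    also have "\<dots> = ennreal e * ennreal (rho k y)" by (rule ennreal_mult'') (rule rho_nonneg)
    finally show "(\<integral>\<^sup>+z. ennreal (\<bar>f (z - y) - f z\<bar> * rho k y) \<partial>lborel) \<le> ennreal e * ennreal (rho k y)" .
  qed
  also have "\<dots> = ennreal e * (\<integral>\<^sup>+y. ennreal (rho k y) \<partial>(lborel :: 'a measure))" by (rule nn_integral_cmult) measurable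
  also have "\<dots> = ennreal e"
    using nn_integral_eq_integral[OF integrable_rho[of k, where 'a='a]] by (simp add: rho_nonneg integral_rho)
  finally show ?thesis .
qed

lemma lebesgue_integrable_borel_version:
  fixes f :: "'a::euclidean_space \<Rightarrow> real"
  assumes "integrable lebesgue f"
  obtains g where "integrable lborel g" "AE z in lebesgue. f z = g z" "\<And>k. mollify k f = mollify k g"
proof -
  obtain g where g: "g \<in> borel_measurable lborel" "AE z in lborel. f z = g z"
    using completion_ex_borel_measurable_real[of f lborel] assms by auto
  have ae: "AE z in lebesgue. f z = g z" using g(2) by (rule AE_completion)
  have gl: "g \<in> borel_measurable lebesgue" using g(1) by (rule measurable_completion)
  have "integrable lebesgue g" using assms ae gl by (subst integrable_cong_AE[symmetric, of f]) auto
  then have "integrable lborel g" using g(1) by (simp add: integrable_completion)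
  moreover have "mollify k f = mollify k g" for k
  proof
    fix z :: 'a
    have "(\<lambda>y. rho k (z - y)) \<in> borel_measurable lebesgue"
      by (intro measurable_completion) measurable
    then show "mollify k f z = mollify k g z"
      unfolding mollify_def using ae gl assms
      by (intro integral_cong_AE borel_measurable_times) auto
  qed
  ultimately show ?thesis using that ae by blast
qed

lemma mollify_L1_tendsto:
  fixes f :: "'a::euclidean_space \<Rightarrow> real"
  assumes "integrable lebesgue f"
  shows "\<And>k. integrable lebesgue (mollify k f)" and "(\<lambda>k. LINT z|lebesgue. \<bar>mollify k f z - f z\<bar>) \<longlonglongrightarrow> 0"
    and "\<And>k. mollify k f \<in> borel_measurable borel"
proof -
  obtain g where g: "integrable lborel g" "AE z in lebesgue. f z = g z" "\<And>k. mollify k f = mollify k g"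
    using lebesgue_integrable_borel_version[OF assms] by blast
  have [measurable]: "mollify k g \<in> borel_measurable borel" for k by (rule mollify_measurable[OF g(1)])
  have [measurable]: "g \<in> borel_measurable borel" using g(1) by auto
  show "mollify k f \<in> borel_measurable borel" for k by (simp add: g(3))
  have tc: "\<exists>d>0. \<forall>y. norm y < d \<longrightarrow> shift_dist g y \<le> e" if "0 < e" for e
    using translation_continuity[OF g(1)] that by blast
  have fin: "integrable lborel (\<lambda>z. mollify k g z - g z)" for k
  proof -
    have "shift_dist g y \<le> 2 * (LINT z|lborel. \<bar>g z\<bar>)" for y
    proof -
      have "shift_dist g y \<le> (LINT z|lborel. \<bar>g (z - y)\<bar> + \<bar>g z\<bar>)"
        unfolding shift_dist_def
        by (intro integral_mono integrable_abs Bochner_Integration.integrable_diff Bochner_Integration.integrable_add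
          integrable_translate(1) g(1)) auto
      also have "\<dots> = (LINT z|lborel. \<bar>g (z - y)\<bar>) + (LINT z|lborel. \<bar>g z\<bar>)"
        by (intro Bochner_Integration.integral_add integrable_abs integrable_translate(1) g(1))
      also have "(LINT z|lborel. \<bar>g (z - y)\<bar>) = (LINT z|lborel. \<bar>g z\<bar>)"
        by (rule integrable_translate(2)[of "\<lambda>z. \<bar>g z\<bar>"]) (use g(1) in auto)
      finally show ?thesis by simp
    qed
    then have "(\<integral>\<^sup>+z. ennreal \<bar>mollify k g z - g z\<bar> \<partial>lborel) \<le> ennreal (2 * (LINT z|lborel. \<bar>g z\<bar>))"
      by (intro mollify_L1_bound g(1))
    then show ?thesis by (intro integrableI_bounded) (auto simp: le_less_trans)
  qed
  have mi: "integrable lborel (mollify k g)" for k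
    using Bochner_Integration.integrable_add[OF fin[of k] g(1)] by simp
  then show "integrable lebesgue (mollify k f)" for k by (simp add: g(3) integrable_completion)
  have "(\<lambda>k. LINT z|lborel. \<bar>mollify k g z - g z\<bar>) \<longlonglongrightarrow> 0"
  proof (rule LIMSEQ_I)
    fix e :: real assume "0 < e"
    then obtain d where d: "d > 0" "\<forall>y. norm y < d \<longrightarrow> shift_dist g y \<le> e / 2" using tc[of "e / 2"] by auto
    obtain k0 :: nat where k0: "1 / d < real k0" using reals_Archimedean2 by blast
    have "norm ((LINT z|lborel. \<bar>mollify k g z - g z\<bar>) - 0) < e" if "k0 \<le> k" for k
    proof -
      have "1 / d < real k + 1" using k0 that by linarith
      then have "radius k < d" using d(1) by (simp add: radius_def field_simps)
      then have "(\<integral>\<^sup>+z. ennreal \<bar>mollify k g z - g z\<bar> \<partial>lborel) \<le> ennreal (e / 2)"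
        using d by (intro mollify_L1_bound g(1)) auto
      moreover have "(\<integral>\<^sup>+z. ennreal \<bar>mollify k g z - g z\<bar> \<partial>lborel) = ennreal (LINT z|lborel. \<bar>mollify k g z - g z\<bar>)"
        by (rule nn_integral_eq_integral) (use fin[of k] in auto)
      ultimately have "(LINT z|lborel. \<bar>mollify k g z - g z\<bar>) \<le> e / 2" using \<open>0 < e\<close> by simp
      then show ?thesis using \<open>0 < e\<close> by (simp add: integral_nonneg_AE)
    qed
    then show "\<exists>k0. \<forall>k\<ge>k0. norm ((LINT z|lborel. \<bar>mollify k g z - g z\<bar>) - 0) < e" by blast
  qed
  moreover have "(LINT z|lebesgue. \<bar>mollify k f z - f z\<bar>) = (LINT z|lborel. \<bar>mollify k g z - g z\<bar>)" for k
  proof -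
    have "(LINT z|lebesgue. \<bar>mollify k f z - f z\<bar>) = (LINT z|lebesgue. \<bar>mollify k g z - g z\<bar>)"
      unfolding g(3)
    proof (rule integral_cong_AE)
      show "AE z in lebesgue. \<bar>mollify k g z - f z\<bar> = \<bar>mollify k g z - g z\<bar>" using g(2) by auto
      show "(\<lambda>z. \<bar>mollify k g z - f z\<bar>) \<in> borel_measurable lebesgue"
        using assms by (intro borel_measurable_abs borel_measurable_diff) (auto intro!: measurable_completion)
      show "(\<lambda>z. \<bar>mollify k g z - g z\<bar>) \<in> borel_measurable lebesgue" by (rule measurable_completion) measurable
    qed
    also have "\<dots> = (LINT z|lborel. \<bar>mollify k g z - g z\<bar>)" by (rule integral_completion) measurable
    finally show ?thesis .
  qed
  ultimately show "(\<lambda>k. LINT z|lebesgue. \<bar>mollify k f z - f z\<bar>) \<longlonglongrightarrow> 0" by simp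
qed

text \<open>Convergence in the mean, applied to the sum of finitely many errors, yields one subsequence
that works for all functions of the family.\<close>

lemma mollify_AE_tendsto:
  fixes f :: "'i \<Rightarrow> 'a::euclidean_space \<Rightarrow> real"
  assumes fin: "finite I" and f: "\<And>i. i \<in> I \<Longrightarrow> integrable lebesgue (f i)"
  obtains r :: "nat \<Rightarrow> nat" where "strict_mono r"
    "AE z in lebesgue. \<forall>i\<in>I. (\<lambda>k. mollify (r k) (f i) z) \<longlonglongrightarrow> f i z"
proof -
  let ?h = "\<lambda>k z. \<Sum>i\<in>I. \<bar>mollify k (f i) z - f i z\<bar>"
  have int: "integrable lebesgue (\<lambda>z. \<bar>mollify k (f i) z - f i z\<bar>)" if "i \<in> I" for i k
    using mollify_L1_tendsto(1)[OF f[OF that]] f[OF that] by (intro integrable_abs Bochner_Integration.integrable_diff)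
  have "(\<lambda>k. \<Sum>i\<in>I. LINT z|lebesgue. \<bar>mollify k (f i) z - f i z\<bar>) \<longlonglongrightarrow> (\<Sum>i\<in>I. 0)"
    by (intro tendsto_sum mollify_L1_tendsto(2) f)
  moreover have "(LINT z|lebesgue. norm (?h k z)) = (\<Sum>i\<in>I. LINT z|lebesgue. \<bar>mollify k (f i) z - f i z\<bar>)" for k
  proof -
    have "(LINT z|lebesgue. norm (?h k z)) = (LINT z|lebesgue. ?h k z)"
      by (simp add: sum_nonneg)
    then show ?thesis using int by (simp add: Bochner_Integration.integral_sum)
  qed
  ultimately have "(\<lambda>k. LINT z|lebesgue. norm (?h k z)) \<longlonglongrightarrow> 0" by simp
  moreover have "integrable lebesgue (?h k)" for k by (intro Bochner_Integration.integrable_sum int)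
  ultimately obtain r :: "nat \<Rightarrow> nat" where r: "strict_mono r" "AE z in lebesgue. (\<lambda>k. ?h (r k) z) \<longlonglongrightarrow> 0"
    using tendsto_L1_AE_subseq[of lebesgue ?h] by blast
  have "AE z in lebesgue. \<forall>i\<in>I. (\<lambda>k. mollify (r k) (f i) z) \<longlonglongrightarrow> f i z"
    using r(2)
  proof (rule AE_mp, intro AE_I2 impI ballI)
    fix z i assume z: "(\<lambda>k. ?h (r k) z) \<longlonglongrightarrow> 0" and i: "i \<in> I"
    have "(\<lambda>k. mollify (r k) (f i) z - f i z) \<longlonglongrightarrow> 0"
    proof (rule Lim_null_comparison[OF _ z], rule always_eventually, rule allI)
      fix k
      show "norm (mollify (r k) (f i) z - f i z) \<le> ?h (r k) z"
        unfolding real_norm_def by (rule member_le_sum[OF i _ fin, of "\<lambda>i. \<bar>mollify (r k) (f i) z - f i z\<bar>"]) simp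
    qed
    then show "(\<lambda>k. mollify (r k) (f i) z) \<longlonglongrightarrow> f i z" by (simp add: LIM_zero_iff)
  qed
  then show ?thesis using that r(1) by blast
qed

text \<open>The tangent of \<open>x\<^sup>p\<close> at \<open>m\<close>, obtained from Bernoulli's inequality by scaling.\<close>

lemma power_ge_tangent:
  fixes a m :: real
  assumes "0 \<le> a" "0 \<le> m"
  shows "m ^ p + real p * m ^ (p - 1) * (a - m) \<le> a ^ p"
proof (cases "m = 0")
  case True
  then show ?thesis using assms by (cases p; cases "p - 1") auto
next
  case False
  then have m: "m > 0" using assms by simp
  have "1 + real p * (a / m - 1) \<le> (1 + (a / m - 1)) ^ p"
    by (rule Bernoulli_inequality) (use assms m in auto)
  then have "m ^ p * (1 + real p * (a / m - 1)) \<le> m ^ p * (a / m) ^ p"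
    using m by (intro mult_left_mono) auto
  also have "\<dots> = a ^ p" using m by (simp add: power_divide)
  finally have "m ^ p * (1 + real p * (a / m - 1)) \<le> a ^ p" .
  moreover have "m ^ p * (1 + real p * (a / m - 1)) = m ^ p + real p * m ^ (p - 1) * (a - m)"
    using m by (cases p) (auto simp: field_simps)
  ultimately show ?thesis by simp
qed

text \<open>Jensen's inequality for the probability density \<open>rho k (z - y)\<close>: integrate the tangent inequality
at the mean value.\<close>

lemma mollify_power_le:
  fixes f :: "'a::euclidean_space \<Rightarrow> real"
  assumes f: "integrable lebesgue f" and fp: "integrable lebesgue (\<lambda>y. \<bar>f y\<bar> ^ p)"
  shows "\<bar>mollify k f z\<bar> ^ p \<le> mollify k (\<lambda>y. \<bar>f y\<bar> ^ p) z"
proof -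
  define m where "m = mollify k (\<lambda>y. \<bar>f y\<bar>) z"
  have fa: "integrable lebesgue (\<lambda>y. \<bar>f y\<bar>)" using f by simp
  have rl: "integrable lebesgue (\<lambda>y. rho k (z - y))" "(LINT y|lebesgue. rho k (z - y)) = 1"
  proof -
    have "integrable lborel (\<lambda>y. rho k (z - y))"
      using integrable_reflect(1)[of "rho k" z] integrable_rho by simp
    then show "integrable lebesgue (\<lambda>y. rho k (z - y))" by (subst integrable_completion) auto
    have "(LINT y|lebesgue. rho k (z - y)) = (LINT y|lborel. rho k (z - y))" by (rule integral_completion) measurable
    then show "(LINT y|lebesgue. rho k (z - y)) = 1"
      using integrable_reflect(2)[of "rho k" z] integral_rho by simp
  qed
  have m0: "0 \<le> m" unfolding m_def mollify_def by (intro integral_nonneg_AE AE_I2) (simp add: rho_nonneg)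
  have "\<bar>mollify k f z\<bar> \<le> m"
  proof -
    have "\<bar>mollify k f z\<bar> \<le> (LINT y|lebesgue. \<bar>f y * rho k (z - y)\<bar>)"
      unfolding mollify_def using integral_norm_bound[of lebesgue "\<lambda>y. f y * rho k (z - y)"] by simp
    then show ?thesis by (simp add: m_def mollify_def abs_mult rho_nonneg)
  qed
  then have "\<bar>mollify k f z\<bar> ^ p \<le> m ^ p" by (intro power_mono) auto
  also have "m ^ p = (LINT y|lebesgue. (m ^ p - real p * m ^ (p - 1) * m) * rho k (z - y) + real p * m ^ (p - 1) * (\<bar>f y\<bar> * rho k (z - y)))"
  proof -
    have "(LINT y|lebesgue. (m ^ p - real p * m ^ (p - 1) * m) * rho k (z - y) + real p * m ^ (p - 1) * (\<bar>f y\<bar> * rho k (z - y)))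
      = (LINT y|lebesgue. (m ^ p - real p * m ^ (p - 1) * m) * rho k (z - y)) + (LINT y|lebesgue. real p * m ^ (p - 1) * (\<bar>f y\<bar> * rho k (z - y)))"
      by (intro Bochner_Integration.integral_add integrable_mult_right rl integrable_mult_rho fa)
    also have "\<dots> = m ^ p"
      using rl(2) by (simp add: m_def mollify_def)
    finally show ?thesis by simp
  qed
  also have "\<dots> \<le> (LINT y|lebesgue. \<bar>f y\<bar> ^ p * rho k (z - y))"
  proof (rule integral_mono)
    fix y
    have "(m ^ p + real p * m ^ (p - 1) * (\<bar>f y\<bar> - m)) * rho k (z - y) \<le> \<bar>f y\<bar> ^ p * rho k (z - y)"
      by (intro mult_right_mono power_ge_tangent rho_nonneg) (use m0 in auto)
    then show "(m ^ p - real p * m ^ (p - 1) * m) * rho k (z - y) + real p * m ^ (p - 1) * (\<bar>f y\<bar> * rho k (z - y))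
        \<le> \<bar>f y\<bar> ^ p * rho k (z - y)" by (simp add: algebra_simps)
  qed (intro Bochner_Integration.integrable_add integrable_mult_right rl integrable_mult_rho fa fp)+
  finally show ?thesis by (simp add: mollify_def)
qed

section \<open>Mollification and generalized derivatives\<close>

abbreviation fd :: "('a::euclidean_space \<Rightarrow> real) \<Rightarrow> 'a \<Rightarrow> 'a \<Rightarrow> real" where
  "fd f e z \<equiv> frechet_derivative f (at z) e"

lemma fd_eqI: "(f has_derivative f') (at z) \<Longrightarrow> fd f e z = f' e"
  using frechet_derivative_at by metis

lemma fd_add: "flat_alg f \<Longrightarrow> flat_alg g \<Longrightarrow> fd (\<lambda>z. f z + g z) e z = fd f e z + fd g e z"
  by (rule fd_eqI[OF has_derivative_add]) (rule flat_alg_has_derivative, assumption)+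

lemma fd_mult: "flat_alg f \<Longrightarrow> flat_alg g \<Longrightarrow> fd (\<lambda>z. f z * g z) e z = f z * fd g e z + fd f e z * g z"
  by (rule fd_eqI[OF has_derivative_mult]) (rule flat_alg_has_derivative, assumption)+

lemma fd_const: "fd (\<lambda>z. c) e z = 0"
  by (rule fd_eqI[OF has_derivative_const])

lemma fd_inner: "fd (\<lambda>z. z \<bullet> a) e z = e \<bullet> a"
  by (rule fd_eqI[where f'="\<lambda>h. h \<bullet> a"]) (auto intro!: derivative_eq_intros)

lemma fd_flat:
  "fd (\<lambda>z. flat k (s - (norm (z - z0))\<^sup>2)) e z =
    (flat (k + 2) (s - (norm (z - z0))\<^sup>2) + (- real k) * flat (k + 1) (s - (norm (z - z0))\<^sup>2)) * ((- 2) * (z \<bullet> e + (- (z0 \<bullet> e))))"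
proof -
  let ?w = "\<lambda>z. s - (norm (z - z0))\<^sup>2"
  have w: "(?w has_derivative (\<lambda>h. - (2 * ((z - z0) \<bullet> h)))) (at z)"
    unfolding power2_norm_eq_inner
    by (rule derivative_eq_intros refl)+ (auto simp: inner_commute fun_eq_iff)
  have "((\<lambda>z. flat k (?w z)) has_derivative
      (\<lambda>h. (flat (k + 2) (?w z) - real k * flat (k + 1) (?w z)) * (- (2 * ((z - z0) \<bullet> h))))) (at z)"
    using has_derivative_compose[OF w has_field_derivative_flat[unfolded has_field_derivative_def, of k "?w z"]]
    by (simp add: mult.commute)
  from fd_eqI[OF this, of e] show ?thesis by (simp add: inner_diff_left algebra_simps)
qed

text \<open>Induction over the generation of the algebra; only the radial generators require a computation, whose
result is symmetric in \<open>e1\<close> and \<open>e2\<close>.\<close>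

lemma fd_fd_commute: "flat_alg f \<Longrightarrow> fd (fd f e1) e2 z = fd (fd f e2) e1 z"
proof (induction arbitrary: e1 e2 z rule: flat_alg.induct)
  case (flat_alg_const c)
  then show ?case by (simp add: fd_const[abs_def])
next
  case (flat_alg_inner e)
  then show ?case by (simp add: fd_inner[abs_def] fd_const)
next
  case (flat_alg_flat k s z0)
  let ?f = "\<lambda>k z. flat k (s - (norm (z - z0))\<^sup>2)"
  have a: "flat_alg (\<lambda>z. ?f (k + 2) z + (- real k) * ?f (k + 1) z)" for k
    by (intro flat_alg.intros)
  have b: "flat_alg (\<lambda>z. (- 2) * (z \<bullet> e + (- (z0 \<bullet> e))))" for e
    by (intro flat_alg.intros)
  have c: "fd (\<lambda>z. (- 2) * (z \<bullet> e + (- (z0 \<bullet> e)))) e' z = (- 2) * (e' \<bullet> e)" for e e' z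
  proof -
    have 1: "flat_alg (\<lambda>z. - 2)" "flat_alg (\<lambda>z. z \<bullet> e)" "flat_alg (\<lambda>z. - (z0 \<bullet> e))" "flat_alg (\<lambda>z. z \<bullet> e + - (z0 \<bullet> e))"
      by (intro flat_alg.intros)+
    show ?thesis by (simp only: fd_mult[OF 1(1) 1(4)] fd_add[OF 1(2,3)] fd_const fd_inner) simp
  qed
  have d: "fd (\<lambda>z. ?f (k + 2) z + (- real k) * ?f (k + 1) z) e z =
     ((?f (k + 4) z - real (k + 2) * ?f (k + 3) z) - real k * (?f (k + 3) z - real (k + 1) * ?f (k + 2) z))
     * ((- 2) * (z \<bullet> e + (- (z0 \<bullet> e))))" for e z
  proof -
    have "fd (\<lambda>z. ?f (k + 2) z + (- real k) * ?f (k + 1) z) e z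
       = fd (?f (k + 2)) e z + ((- real k) * fd (?f (k + 1)) e z + 0 * ?f (k + 1) z)"
    proof -
      have 1: "flat_alg (?f (k + 2))" "flat_alg (\<lambda>z. (- real k))" "flat_alg (?f (k + 1))" "flat_alg (\<lambda>z. (- real k) * ?f (k + 1) z)"
        by (intro flat_alg.intros)+
      show ?thesis by (simp only: fd_mult[OF 1(2,3)] fd_add[OF 1(1,4)] fd_const)
    qed
    then show ?thesis unfolding fd_flat by (simp add: algebra_simps numeral_eq_Suc)
  qed
  have "fd (fd (?f k) e1) e2 z =
      fd (\<lambda>z. (?f (k + 2) z + (- real k) * ?f (k + 1) z) * ((- 2) * (z \<bullet> e1 + (- (z0 \<bullet> e1))))) e2 z" for e1 e2
    by (simp only: fd_flat)
  then show ?case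
    by (simp only: fd_mult[OF a b] c d) (simp add: inner_commute[of e1 e2] algebra_simps)
next
  case (flat_alg_add f g)
  have "fd (fd (\<lambda>z. f z + g z) e1) e2 z = fd (fd f e1) e2 z + fd (fd g e1) e2 z" for e1 e2
    by (simp only: fd_add[OF flat_alg_add.hyps]
        fd_add[OF flat_alg_frechet_derivative flat_alg_frechet_derivative, OF flat_alg_add.hyps])
  then show ?case using flat_alg_add.IH by simp
next
  case (flat_alg_mult f g)
  note h = flat_alg_mult.hyps and h' = flat_alg_mult.hyps[THEN flat_alg_frechet_derivative]
  have "fd (fd (\<lambda>z. f z * g z) e1) e2 z
     = (f z * fd (fd g e1) e2 z + fd f e2 z * fd g e1 z) + (fd f e1 z * fd g e2 z + fd (fd f e1) e2 z * g z)" for e1 e2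
  proof -
    have "fd (fd (\<lambda>z. f z * g z) e1) e2 z = fd (\<lambda>z. f z * fd g e1 z + fd f e1 z * g z) e2 z"
      by (simp only: fd_mult[OF h])
    also have "\<dots> = fd (\<lambda>z. f z * fd g e1 z) e2 z + fd (\<lambda>z. fd f e1 z * g z) e2 z"
      by (intro fd_add flat_alg.flat_alg_mult h h')
    finally show ?thesis by (simp add: fd_mult[OF h(1) h'(2)] fd_mult[OF h'(1) h(2)])
  qed
  then show ?case using flat_alg_mult.IH by simp
qed

lemma fd_Basis:
  assumes "flat_alg f"
  shows "fd f h z = (\<Sum>b\<in>Basis. (h \<bullet> b) * fd f b z)"
proof -
  have l: "linear (frechet_derivative f (at z))"
    using flat_alg_has_derivative[OF assms] has_derivative_linear by blast
  have "fd f h z = frechet_derivative f (at z) (\<Sum>b\<in>Basis. (h \<bullet> b) *\<^sub>R b)" by (simp add: euclidean_representation)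
  also have "\<dots> = (\<Sum>b\<in>Basis. (h \<bullet> b) * fd f b z)" by (simp add: linear_sum[OF l] linear_scale[OF l])
  finally show ?thesis .
qed

lemma has_derivative_convolution:
  fixes u G :: "'a::euclidean_space \<Rightarrow> real"
  assumes u: "continuous_on (cbox A B) u" and G: "flat_alg G"
  shows "((\<lambda>z. integral (cbox A B) (\<lambda>y. u y * G (z - y))) has_derivative
    (\<lambda>h. \<Sum>b\<in>Basis. (h \<bullet> b) * integral (cbox A B) (\<lambda>y. u y * fd G b (z - y)))) (at z)"
proof -
  define fx where "fx z y = (\<Sum>b\<in>Basis. (u y * fd G b (z - y)) *\<^sub>R blinfun_inner_left b)" for z y
  have contG: "continuous_on UNIV (fd G b)" for b
    by (rule flat_alg_continuous[OF flat_alg_frechet_derivative[OF G]])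
  have c1: "continuous_on (UNIV \<times> cbox A B) (\<lambda>(z, y). fx z y)"
    unfolding fx_def case_prod_beta
    by (intro continuous_intros continuous_on_compose2[OF u] continuous_on_compose2[OF contG]) auto
  have c2: "continuous_on (cbox A B) (\<lambda>y. u y * fd G b (z - y))" for b z
    by (intro continuous_intros u continuous_on_compose2[OF contG]) auto
  have c3: "continuous_on (cbox A B) (\<lambda>y. u y * G (z - y))" for z
    by (intro continuous_intros u continuous_on_compose2[OF flat_alg_continuous[OF G, of UNIV]]) auto
  have c4: "continuous_on (cbox A B) (fx z)" for z
    unfolding fx_def by (intro continuous_intros c2)
  have ap: "blinfun_apply (fx z y) h = (\<Sum>b\<in>Basis. (h \<bullet> b) * (u y * fd G b (z - y)))" for z y h
    unfolding fx_def by (simp add: blinfun.sum_left blinfun.scaleR_left mult.commute)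
  have "((\<lambda>z. integral (cbox A B) (\<lambda>y. u y * G (z - y))) has_derivative integral (cbox A B) (fx z)) (at z within UNIV)"
  proof (rule leibniz_rule[OF _ _ c1])
    fix z y :: 'a
    have d: "((\<lambda>z. z - y) has_derivative (\<lambda>h. h)) (at z)" by (auto intro!: derivative_eq_intros)
    have "((\<lambda>z. G (z - y)) has_derivative (\<lambda>h. fd G h (z - y))) (at z)"
      by (rule has_derivative_compose[OF d flat_alg_has_derivative[OF G]])
    then have "((\<lambda>z. u y * G (z - y)) has_derivative (\<lambda>h. u y * fd G h (z - y))) (at z)"
      by (rule has_derivative_mult_right)
    also have "(\<lambda>h. u y * fd G h (z - y)) = blinfun_apply (fx z y)"
      by (rule ext, subst fd_Basis[OF G]) (simp add: ap sum_distrib_left ac_simps)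
    finally show "((\<lambda>z. u y * G (z - y)) has_derivative blinfun_apply (fx z y)) (at z within UNIV)" by simp
  qed (use c3 in \<open>auto intro: integrable_continuous\<close>)
  moreover have "blinfun_apply (integral (cbox A B) (fx z)) h
      = (\<Sum>b\<in>Basis. (h \<bullet> b) * integral (cbox A B) (\<lambda>y. u y * fd G b (z - y)))" for h
  proof -
    have "blinfun_apply (integral (cbox A B) (fx z)) h = integral (cbox A B) (\<lambda>y. blinfun_apply (fx z y) h)"
      by (rule blinfun_apply_integral[OF integrable_continuous[OF c4]])
    also have "\<dots> = (\<Sum>b\<in>Basis. integral (cbox A B) (\<lambda>y. (h \<bullet> b) * (u y * fd G b (z - y))))"
      unfolding ap by (rule integral_sum) (auto intro!: integrable_continuous continuous_intros c2)
    finally show ?thesis by simp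
  qed
  then have "blinfun_apply (integral (cbox A B) (fx z))
      = (\<lambda>h. \<Sum>b\<in>Basis. (h \<bullet> b) * integral (cbox A B) (\<lambda>y. u y * fd G b (z - y)))" by (rule ext)
  ultimately show ?thesis by simp
qed

text \<open>For a continuous function on a box, the derivative of its mollification along the directions in \<open>es\<close>,
with all derivatives moved to the mollifier. In this form it exists and is continuous everywhere, also
near and outside the boundary of the box.\<close>

definition mder :: "'a::euclidean_space \<Rightarrow> 'a \<Rightarrow> ('a \<Rightarrow> real) \<Rightarrow> nat \<Rightarrow> 'a list \<Rightarrow> 'a \<Rightarrow> real" where
  "mder A B u k es z = integral (cbox A B) (\<lambda>y. u y * dir_derivs es (rho k) (z - y))"

lemma mder_has_derivative:
  assumes "continuous_on (cbox A B) u"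
  shows "(mder A B u k es has_derivative (\<lambda>h. \<Sum>b\<in>Basis. (h \<bullet> b) * mder A B u k (es @ [b]) z)) (at z)"
  using has_derivative_convolution[OF assms flat_alg_dir_derivs[OF flat_alg_rho[of k], of es], of z]
  by (simp add: mder_def[abs_def] dir_derivs_append)

lemma mder_continuous:
  assumes "continuous_on (cbox A B) u"
  shows "continuous_on S (mder A B u k es)"
  by (rule has_derivative_continuous_on, rule has_derivative_at_withinI, rule mder_has_derivative[OF assms])

lemma mder_commute: "mder A B u k [e1, e2] = mder A B u k [e2, e1]"
  by (simp add: mder_def[abs_def] fd_fd_commute[OF flat_alg_rho])

lemma mder_uniform_limit:
  fixes u :: "'a::euclidean_space \<Rightarrow> real"
  assumes u: "continuous_on (cbox A B) u" and e: "0 < e"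
  shows "\<exists>k0. \<forall>k\<ge>k0. \<forall>z. cball z (radius k) \<subseteq> cbox A B \<longrightarrow> \<bar>mder A B u k [] z - u z\<bar> \<le> e"
proof -
  have "uniformly_continuous_on (cbox A B) u" by (rule compact_uniformly_continuous[OF u]) simp
  from uniformly_continuous_onE[OF this e]
  obtain d where d: "0 < d" "\<And>x y. x \<in> cbox A B \<Longrightarrow> y \<in> cbox A B \<Longrightarrow> dist y x < d \<Longrightarrow> dist (u y) (u x) < e"
    by metis
  obtain k0 :: nat where k0: "1 / d < real k0" using reals_Archimedean2 by blast
  have "\<bar>mder A B u k [] z - u z\<bar> \<le> e" if k: "k0 \<le> k" and z: "cball z (radius k) \<subseteq> cbox A B" for k z
  proof -
    have "1 / d < real k + 1" using k0 k by linarith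
    then have rd: "radius k < d" using d(1) by (simp add: radius_def field_simps)
    have zc: "z \<in> cbox A B" using z radius_pos[of k] by (simp add: subset_iff)
    have i: "integrable lborel (\<lambda>y. rho k (z - y))"
      using integrable_reflect(1)[of "rho k" z] integrable_rho by simp
    have out: "rho k (z - y) = 0" if "y \<notin> cbox A B" for y
      using z that rho_zero[of k "z - y"] by (force simp: dist_norm)
    have "integral (cbox A B) (\<lambda>y. rho k (z - y)) = integral UNIV (\<lambda>y. if y \<in> cbox A B then rho k (z - y) else 0)"
      by (simp only: integral_restrict_UNIV)
    also have "(\<lambda>y. if y \<in> cbox A B then rho k (z - y) else 0) = (\<lambda>y. rho k (z - y))" using out by auto
    also have "integral UNIV (\<lambda>y. rho k (z - y)) = 1"
      using integral_lborel[OF i] integrable_reflect(2)[of "rho k" z] integral_rho[where 'a='a, of k] by simp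
    finally have one: "integral (cbox A B) (\<lambda>y. rho k (z - y)) = 1" .
    have cr: "continuous_on (cbox A B) (\<lambda>y. rho k (z - y))"
      by (intro continuous_on_compose2[OF continuous_rho[of UNIV]] continuous_intros) auto
    have "mder A B u k [] z - u z = integral (cbox A B) (\<lambda>y. u y * rho k (z - y)) - integral (cbox A B) (\<lambda>y. u z * rho k (z - y))"
      by (simp add: mder_def one)
    also have "\<dots> = integral (cbox A B) (\<lambda>y. u y * rho k (z - y) - u z * rho k (z - y))"
      by (intro integral_diff[symmetric] integrable_continuous continuous_intros u cr)
    finally have eq: "mder A B u k [] z - u z = integral (cbox A B) (\<lambda>y. u y * rho k (z - y) - u z * rho k (z - y))" .
    have "norm (integral (cbox A B) (\<lambda>y. u y * rho k (z - y) - u z * rho k (z - y))) \<le> integral (cbox A B) (\<lambda>y. e * rho k (z - y))"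
    proof (rule integral_norm_bound_integral)
      show "(\<lambda>y. u y * rho k (z - y) - u z * rho k (z - y)) integrable_on cbox A B"
        by (intro integrable_continuous continuous_intros u cr)
      show "(\<lambda>y. e * rho k (z - y)) integrable_on cbox A B"
        by (intro integrable_continuous continuous_intros cr)
      fix y assume y: "y \<in> cbox A B"
      have "\<bar>u y - u z\<bar> * rho k (z - y) \<le> e * rho k (z - y)"
      proof (cases "norm (z - y) < radius k")
        case True
        then have "dist y z < d" using rd by (simp add: dist_norm norm_minus_commute)
        from d(2)[OF zc y this] show ?thesis by (intro mult_right_mono rho_nonneg) (simp add: dist_real_def)
      qed (simp add: rho_zero)
      then show "norm (u y * rho k (z - y) - u z * rho k (z - y)) \<le> e * rho k (z - y)"
        by (simp add: rho_nonneg abs_mult flip: left_diff_distrib)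
    qed
    also have "\<dots> = e" by (simp add: one)
    finally show ?thesis by (simp add: eq)
  qed
  then show ?thesis by blast
qed

lemma set_integral_rho_eq_mollify:
  assumes "cball z (radius k) \<subseteq> R" "R \<subseteq> \<Omega>"
  shows "(LINT y:\<Omega>|lebesgue. v y * rho k (z - y)) = mollify k (\<lambda>y. indicator R y * v y) z"
proof -
  have eq: "indicator \<Omega> y *\<^sub>R (v y * rho k (z - y)) = indicator R y * v y * rho k (z - y)" for y
  proof (cases "y \<in> R")
    case False
    then have "rho k (z - y) = 0" using assms rho_zero[of k "z - y"] by (force simp: dist_norm)
    then show ?thesis by simp
  qed (use assms in auto)
  show ?thesis unfolding set_lebesgue_integral_def mollify_def by (simp only: eq)
qed

text \<open>As long as the support of the mollifier stays in \<open>\<Omega>\<close>, the reflected mollifier is an admissible test function; the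
sign in the definition of the weak derivative cancels the one from the reflection. The indicator of \<open>R\<close> makes the mollified
function globally integrable.\<close>

lemma mder_eq_mollify:
  fixes u v :: "'a::euclidean_space \<Rightarrow> real"
  assumes om: "\<Omega> \<subseteq> cbox A B" and u: "continuous_on (cbox A B) u"
    and w: "weak_deriv \<Omega> es u v" and z: "cball z (radius k) \<subseteq> R" "R \<subseteq> \<Omega>"
  shows "mder A B u k es z = mollify k (\<lambda>y. indicator R y * v y) z"
proof -
  let ?D = "dir_derivs es (rho k)"
  have zo: "cball z (radius k) \<subseteq> \<Omega>" using z by auto
  have tf: "(\<lambda>y. rho k (z - y)) \<in> test_functions \<Omega>" by (rule rho_test_function[OF zo])
  have D0: "?D (z - y) = 0" if "y \<notin> \<Omega>" for y
  proof (rule dir_derivs_zero)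
    show "open (- cball (0::'a) (radius k))" by (simp add: open_Compl)
    show "rho k w = 0" if "w \<in> - cball 0 (radius k)" for w :: 'a using that by (intro rho_zero) auto
    show "z - y \<in> - cball 0 (radius k)" using that zo by (auto simp: dist_norm norm_minus_commute subset_iff)
  qed
  have refl: "dir_derivs es (\<lambda>y. rho k (z - y)) = (\<lambda>y. (- 1) ^ length es * ?D (z - y))"
    using dir_derivs_reflect[OF flat_alg_rho[of k], of es 1 z] by simp
  have cD: "continuous_on (cbox A B) (\<lambda>y. u y * ?D (z - y))"
    by (intro continuous_intros u continuous_on_compose2[OF flat_alg_continuous[OF flat_alg_dir_derivs[OF flat_alg_rho[of k]], of UNIV]]) auto
  have "(- 1) ^ length es * (LINT y:\<Omega>|lebesgue. v y * rho k (z - y))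
      = (LINT y:\<Omega>|lebesgue. u y * dir_derivs es (\<lambda>y. rho k (z - y)) y)"
    using w tf unfolding weak_deriv_def by auto
  also have "\<dots> = (- 1) ^ length es * (LINT y:\<Omega>|lebesgue. u y * ?D (z - y))"
    unfolding refl by (subst set_integral_mult_right[symmetric]) (simp add: ac_simps)
  finally have "(LINT y:\<Omega>|lebesgue. v y * rho k (z - y)) = (LINT y:\<Omega>|lebesgue. u y * ?D (z - y))" by simp
  also have "\<dots> = (LINT y:cbox A B|lebesgue. u y * ?D (z - y))"
  proof -
    have eq: "indicator \<Omega> y *\<^sub>R (u y * ?D (z - y)) = indicator (cbox A B) y *\<^sub>R (u y * ?D (z - y))" for y
      using om D0[of y] by (cases "y \<in> \<Omega>") auto
    show ?thesis unfolding set_lebesgue_integral_def by (simp only: eq)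
  qed
  also have "\<dots> = mder A B u k es z"
    unfolding mder_def by (rule set_lebesgue_integral_eq_integral(2)[OF absolutely_integrable_continuous[OF cD]])
  finally show ?thesis using set_integral_rho_eq_mollify[OF z, of v] by simp
qed

lemma eventually_cball_radius_subset:
  assumes "z \<in> interior R"
  shows "eventually (\<lambda>k. cball z (radius k) \<subseteq> R) sequentially"
proof -
  obtain d where d: "d > 0" "cball z d \<subseteq> R"
    using assms mem_interior_cball by blast
  obtain k0 :: nat where k0: "1 / d < real k0" using reals_Archimedean2 by blast
  have "cball z (radius k) \<subseteq> R" if "k0 \<le> k" for k
  proof -
    have "1 / d < real k + 1" using k0 that by linarith
    then have "radius k \<le> d" using d(1) by (simp add: radius_def field_simps)
    then show ?thesis using d(2) by (meson order_trans subset_cball)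
  qed
  then show ?thesis unfolding eventually_sequentially by blast
qed

text \<open>Two versions have the same mollifications near the point, and these converge
almost everywhere to either version.\<close>

lemma weak_deriv_unique_AE:
  assumes w: "weak_deriv \<Omega> es u v1" "weak_deriv \<Omega> es u v2" and R: "compact R" "R \<subseteq> \<Omega>"
  shows "AE z in lebesgue. z \<in> interior R \<longrightarrow> v1 z = v2 z"
proof -
  let ?f = "\<lambda>b y. indicator R y * (if b then v1 y else v2 y)"
  have f: "integrable lebesgue (?f b)" for b
    using w R unfolding weak_deriv_def locally_integrable_def set_integrable_def by (cases b) auto
  obtain r :: "nat \<Rightarrow> nat" where r: "strict_mono r" "AE z in lebesgue. \<forall>b\<in>UNIV. (\<lambda>k. mollify (r k) (?f b) z) \<longlonglongrightarrow> ?f b z"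
    using mollify_AE_tendsto[of "UNIV :: bool set" ?f] f by auto
  show ?thesis using r(2)
  proof (rule AE_mp, intro AE_I2 impI)
    fix z assume lim: "\<forall>b\<in>UNIV. (\<lambda>k. mollify (r k) (?f b) z) \<longlonglongrightarrow> ?f b z" and z: "z \<in> interior R"
    have ev: "eventually (\<lambda>k. cball z (radius (r k)) \<subseteq> R) sequentially"
      using eventually_subseq[OF r(1) eventually_cball_radius_subset[OF z]] .
    have eq: "eventually (\<lambda>k. mollify (r k) (?f True) z = mollify (r k) (?f False) z) sequentially"
      using ev
    proof eventually_elim
      case (elim k)
      have "(\<lambda>y. rho (r k) (z - y)) \<in> test_functions \<Omega>" using elim R by (intro rho_test_function) auto
      then have "(- 1) ^ length es * (LINT y:\<Omega>|lebesgue. v1 y * rho (r k) (z - y)) = (- 1) ^ length es * (LINT y:\<Omega>|lebesgue. v2 y * rho (r k) (z - y))"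
        using w unfolding weak_deriv_def by metis
      then have "(LINT y:\<Omega>|lebesgue. v1 y * rho (r k) (z - y)) = (LINT y:\<Omega>|lebesgue. v2 y * rho (r k) (z - y))" by simp
      then show ?case using set_integral_rho_eq_mollify[OF elim R(2)] by simp
    qed
    have "(\<lambda>k. mollify (r k) (?f False) z) \<longlonglongrightarrow> ?f False z" using lim by blast
    then have "(\<lambda>k. mollify (r k) (?f True) z) \<longlonglongrightarrow> ?f False z" using tendsto_cong[OF eq] by blast
    moreover have "(\<lambda>k. mollify (r k) (?f True) z) \<longlonglongrightarrow> ?f True z" using lim by blast
    ultimately have "?f True z = ?f False z" using LIMSEQ_unique by blast
    moreover have "z \<in> R" using z interior_subset by blast
    ultimately show "v1 z = v2 z" by simp
  qed
qed

lemma sum_power_le: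
  fixes x :: "'i \<Rightarrow> real"
  assumes "finite I" "\<And>i. i \<in> I \<Longrightarrow> 0 \<le> x i" and "0 < p"
  shows "(\<Sum>i\<in>I. x i) ^ p \<le> real (card I) ^ p * (\<Sum>i\<in>I. x i ^ p)"
proof (cases "I = {}")
  case True
  then show ?thesis using assms(3) by (simp add: zero_power)
next
  case False
  define m where "m = Max (x ` I)"
  have "m \<in> x ` I" unfolding m_def using assms False by (intro Max_in) auto
  then obtain j where j: "j \<in> I" "m = x j" by auto
  have "(\<Sum>i\<in>I. x i) \<le> (\<Sum>i\<in>I. m)" unfolding m_def using assms by (intro sum_mono) auto
  then have "(\<Sum>i\<in>I. x i) ^ p \<le> (real (card I) * m) ^ p" using assms by (intro power_mono) (auto intro: sum_nonneg)
  also have "\<dots> = real (card I) ^ p * x j ^ p" by (simp add: power_mult_distrib j)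
  also have "\<dots> \<le> real (card I) ^ p * (\<Sum>i\<in>I. x i ^ p)"
    using assms j by (intro mult_left_mono member_le_sum) auto
  finally show ?thesis .
qed

text \<open>Fatou's lemma points in the opposite direction, so a dominating sequence is needed. It need not be constant:
where \<open>Jk\<close> exceeds \<open>J\<close>, the excess is at most the part of it below \<open>\<bar>H\<bar>\<close>, which tends to \<open>0\<close> by dominated convergence,
plus \<open>\<bar>Hk - H\<bar>\<close>, which tends to \<open>0\<close> in the mean.\<close>

lemma nn_integral_limit_lower_bound:
  fixes H :: "'a \<Rightarrow> real" and Hk Jk :: "nat \<Rightarrow> 'a \<Rightarrow> real" and J :: "'a \<Rightarrow> real"
  assumes Hk: "\<And>k. integrable M (Hk k)" and H: "integrable M H"
    and HL: "(\<lambda>k. LINT z|M. \<bar>Hk k z - H z\<bar>) \<longlonglongrightarrow> 0"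
    and Jk: "\<And>k. Jk k \<in> borel_measurable M" and J: "J \<in> borel_measurable M"
    and bd: "\<And>k. AE z in M. Jk k z \<le> Hk k z"
    and nn: "\<And>k z. 0 \<le> Jk k z" "\<And>z. 0 \<le> J z"
    and lim: "AE z in M. \<forall>e>0. eventually (\<lambda>k. Jk k z \<le> J z + e) sequentially"
    and c: "\<And>k. c \<le> (\<integral>\<^sup>+z. ennreal (Jk k z) \<partial>M)"
  shows "c \<le> (\<integral>\<^sup>+z. ennreal (J z) \<partial>M)"
proof -
  define D where "D k z = max 0 (Jk k z - J z)" for k z
  have Dm: "D k \<in> borel_measurable M" for k unfolding D_def using J Jk[of k] by measurable
  have D0: "0 \<le> D k z" for k z by (simp add: D_def)
  have mn: "norm (min (D k z) \<bar>H z\<bar>) \<le> \<bar>H z\<bar>" for k z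
    using D0[of k z] by (simp add: min_def)
  have m1: "(\<lambda>k. LINT z|M. min (D k z) \<bar>H z\<bar>) \<longlonglongrightarrow> (LINT z|M. 0)"
  proof (rule integral_dominated_convergence[where w="\<lambda>z. \<bar>H z\<bar>"])
    show "AE z in M. (\<lambda>k. min (D k z) \<bar>H z\<bar>) \<longlonglongrightarrow> 0"
      using lim
    proof (rule AE_mp, intro AE_I2 impI)
      fix z assume ev: "\<forall>e>0. eventually (\<lambda>k. Jk k z \<le> J z + e) sequentially"
      have "(\<lambda>k. D k z) \<longlonglongrightarrow> 0"
      proof (rule tendstoI)
        fix e :: real assume "0 < e"
        then have "eventually (\<lambda>k. Jk k z \<le> J z + e / 2) sequentially" using ev by simp
        then show "eventually (\<lambda>k. dist (D k z) 0 < e) sequentially"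
          by eventually_elim (use \<open>0 < e\<close> in \<open>auto simp: D_def\<close>)
      qed
      then have "(\<lambda>k. min (D k z) \<bar>H z\<bar>) \<longlonglongrightarrow> min 0 \<bar>H z\<bar>" by (intro tendsto_intros)
      then show "(\<lambda>k. min (D k z) \<bar>H z\<bar>) \<longlonglongrightarrow> 0" by simp
    qed
    show "AE z in M. norm (min (D k z) \<bar>H z\<bar>) \<le> \<bar>H z\<bar>" for k
      by (rule AE_I2) (rule mn)
  qed (use H Dm in \<open>auto intro!: borel_measurable_min\<close>)
  let ?e = "\<lambda>k. (LINT z|M. min (D k z) \<bar>H z\<bar>) + (LINT z|M. \<bar>Hk k z - H z\<bar>)"
  have e0: "?e \<longlonglongrightarrow> 0" using tendsto_add[OF m1 HL] by simp
  have le: "c \<le> (\<integral>\<^sup>+z. ennreal (J z) \<partial>M) + ennreal (?e k)" for k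
  proof -
    have i1: "integrable M (\<lambda>z. min (D k z) \<bar>H z\<bar>)"
    proof (rule Bochner_Integration.integrable_bound[OF integrable_abs[OF H]])
      show "AE z in M. norm (min (D k z) \<bar>H z\<bar>) \<le> norm \<bar>H z\<bar>"
        by (rule AE_I2) (use mn[of k] in simp)
    qed (use H Dm in \<open>auto intro!: borel_measurable_min\<close>)
    have i2: "integrable M (\<lambda>z. \<bar>Hk k z - H z\<bar>)" using Hk H by auto
    have i3: "integrable M (\<lambda>z. min (D k z) \<bar>H z\<bar> + \<bar>Hk k z - H z\<bar>)" using i1 i2 by (rule Bochner_Integration.integrable_add)
    have "c \<le> (\<integral>\<^sup>+z. ennreal (Jk k z) \<partial>M)" by (rule c)
    also have "\<dots> \<le> (\<integral>\<^sup>+z. ennreal (J z) + ennreal (min (D k z) \<bar>H z\<bar> + \<bar>Hk k z - H z\<bar>) \<partial>M)"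
    proof (rule nn_integral_mono_AE)
      show "AE z in M. ennreal (Jk k z) \<le> ennreal (J z) + ennreal (min (D k z) \<bar>H z\<bar> + \<bar>Hk k z - H z\<bar>)"
        using bd[of k]
      proof (rule AE_mp, intro AE_I2 impI)
        fix z assume "Jk k z \<le> Hk k z"
        then have "Jk k z \<le> J z + (min (D k z) \<bar>H z\<bar> + \<bar>Hk k z - H z\<bar>)"
          using nn(1)[of k z] nn(2)[of z] unfolding D_def by (auto simp: min_def max_def abs_if split: if_splits)
        then have "ennreal (Jk k z) \<le> ennreal (J z + (min (D k z) \<bar>H z\<bar> + \<bar>Hk k z - H z\<bar>))"
          by (rule ennreal_leI)
        also have "\<dots> = ennreal (J z) + ennreal (min (D k z) \<bar>H z\<bar> + \<bar>Hk k z - H z\<bar>)"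
          using nn(2)[of z] D0[of k z] by (intro ennreal_plus) auto
        finally show "ennreal (Jk k z) \<le> ennreal (J z) + ennreal (min (D k z) \<bar>H z\<bar> + \<bar>Hk k z - H z\<bar>)" .
      qed
    qed
    also have "\<dots> = (\<integral>\<^sup>+z. ennreal (J z) \<partial>M) + (\<integral>\<^sup>+z. ennreal (min (D k z) \<bar>H z\<bar> + \<bar>Hk k z - H z\<bar>) \<partial>M)"
      using J i3 by (intro nn_integral_add) auto
    also have "(\<integral>\<^sup>+z. ennreal (min (D k z) \<bar>H z\<bar> + \<bar>Hk k z - H z\<bar>) \<partial>M) = ennreal (?e k)"
      using nn_integral_eq_integral[OF i3] D0[of k] Bochner_Integration.integral_add[OF i1 i2] by simp
    finally show ?thesis .
  qed
  have "(\<lambda>k. (\<integral>\<^sup>+z. ennreal (J z) \<partial>M) + ennreal (?e k)) \<longlonglongrightarrow> (\<integral>\<^sup>+z. ennreal (J z) \<partial>M) + ennreal 0"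
    by (intro tendsto_add tendsto_const tendsto_ennrealI e0)
  then have "c \<le> (\<integral>\<^sup>+z. ennreal (J z) \<partial>M) + ennreal 0"
    by (rule LIMSEQ_le_const) (use le in auto)
  then show ?thesis by simp
qed

section \<open>The barrier profile\<close>

text \<open>The profile \<open>g\<close> with its derivatives \<open>g1\<close> and \<open>g2\<close>. The exponent \<open>\<beta>\<close> fixes the decay at the boundary,
and \<open>\<kappa>\<close> the strength of the concavity in the interior, which has to beat the drift.\<close>

locale barrier =
  fixes \<kappa> \<beta> :: real
  assumes \<kappa>: "0 < \<kappa>" and \<beta>: "0 < \<beta>" "\<beta> \<le> 1/2"
begin

definition g :: "real \<Rightarrow> real" where "g s = 1 - exp (- \<kappa> * s powr \<beta>)"
definition g1 :: "real \<Rightarrow> real" where "g1 s = \<kappa> * \<beta> * s powr (\<beta> - 1) * exp (- \<kappa> * s powr \<beta>)"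
definition g2 :: "real \<Rightarrow> real" where "g2 s = g1 s * ((\<beta> - 1) / s - \<kappa> * \<beta> * s powr (\<beta> - 1))"

lemma g_deriv: "0 < s \<Longrightarrow> (g has_real_derivative g1 s) (at s)"
  unfolding g_def[abs_def] g1_def
  by (rule derivative_eq_intros refl | simp)+

lemma g1_deriv: 
  assumes "0 < s" shows "(g1 has_real_derivative g2 s) (at s)"
proof -
  have "s powr (\<beta> - 1 - 1) = s powr (\<beta> - 1) / s" using assms by (simp add: powr_diff power2_eq_square)
  then show ?thesis
    unfolding g1_def[abs_def] g2_def using assms
    by (auto intro!: derivative_eq_intros simp: g1_def algebra_simps)
qed

lemma g1_pos: "0 < s \<Longrightarrow> 0 < g1 s"
  using \<kappa> \<beta> by (simp add: g1_def)

lemma g1_continuous: "continuous_on {0<..} g1"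
  unfolding g1_def[abs_def] by (intro continuous_intros) auto

lemma g2_continuous: "continuous_on {0<..} g2"
  unfolding g2_def[abs_def] by (intro continuous_intros g1_continuous) auto

lemma g_nonneg: "0 \<le> g s"
  using \<kappa> by (simp add: g_def)

lemma g_pos: "0 < s \<Longrightarrow> 0 < g s"
  using \<kappa> by (simp add: g_def)

lemma g_le: "g s \<le> \<kappa> * s powr \<beta>"
  using exp_ge_add_one_self[of "- \<kappa> * s powr \<beta>"] by (simp add: g_def)

lemma g1_scaling:
  assumes "0 < s" "s \<le> \<delta>"
  shows "g1 \<delta> \<le> (s / \<delta>) powr (1 - \<beta>) * g1 s"
proof -
  have \<delta>: "0 < \<delta>" using assms by simp
  have "\<delta> powr (\<beta> - 1) = (s / \<delta>) powr (1 - \<beta>) * s powr (\<beta> - 1)"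
    using assms \<delta> by (simp add: powr_divide powr_diff)
  moreover have "exp (- \<kappa> * \<delta> powr \<beta>) \<le> exp (- \<kappa> * s powr \<beta>)"
    using assms \<kappa> \<beta> by (simp add: powr_mono2)
  ultimately have "\<delta> powr (\<beta> - 1) * exp (- \<kappa> * \<delta> powr \<beta>) \<le> (s / \<delta>) powr (1 - \<beta>) * s powr (\<beta> - 1) * exp (- \<kappa> * s powr \<beta>)"
    by (simp add: mult_left_mono)
  then have "\<kappa> * \<beta> * (\<delta> powr (\<beta> - 1) * exp (- \<kappa> * \<delta> powr \<beta>)) \<le> \<kappa> * \<beta> * ((s / \<delta>) powr (1 - \<beta>) * s powr (\<beta> - 1) * exp (- \<kappa> * s powr \<beta>))"
    using \<kappa> \<beta> by (intro mult_left_mono) auto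
  then show ?thesis by (simp add: g1_def ac_simps)
qed

lemma g1_antimono:
  assumes "0 < s" "s \<le> \<delta>" shows "g1 \<delta> \<le> g1 s"
proof -
  have "(s / \<delta>) powr (1 - \<beta>) \<le> 1" using assms \<beta> by (intro powr_le1) auto
  then have "(s / \<delta>) powr (1 - \<beta>) * g1 s \<le> 1 * g1 s"
    using g1_pos[OF assms(1)] by (intro mult_right_mono) auto
  then show ?thesis using g1_scaling[OF assms] by simp
qed

text \<open>Quantitative concavity. As \<open>1 - \<beta> \<ge> 1/2\<close>, doubling the argument reduces the derivative at least by the
factor \<open>sqrt (1/2) < 3/4\<close>.\<close>

lemma g1_half:
  assumes "0 < s" "s \<le> \<delta> / 2" shows "g1 \<delta> \<le> 3/4 * g1 s"
proof -
  have \<delta>: "0 < \<delta>" using assms by simp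
  have "(s / \<delta>) powr (1 - \<beta>) \<le> (1/2) powr (1 - \<beta>)"
    using assms \<delta> \<beta> by (intro powr_mono2) (auto simp: field_simps)
  also have "\<dots> \<le> (1/2) powr (1/2)" using \<beta> by (intro powr_mono') auto
  also have "\<dots> = sqrt (1/2)" by (simp add: powr_half_sqrt)
  also have "\<dots> \<le> 3/4" by (rule real_le_lsqrt) (auto simp: power2_eq_square)
  finally have "(s / \<delta>) powr (1 - \<beta>) * g1 s \<le> 3/4 * g1 s"
    using g1_pos[OF assms(1)] by (intro mult_right_mono) auto
  then show ?thesis using g1_scaling[of s \<delta>] assms \<delta> by simp
qed

lemma g_mvt:
  assumes "0 < a" "a < b"
  obtains \<xi> where "a < \<xi>" "\<xi> < b" "g b - g a = (b - a) * g1 \<xi>"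
  using MVT2[OF assms(2), of g g1] g_deriv assms by (metis less_le_trans order_less_le_trans)

lemma g_le_tangent:
  assumes "0 < s" "0 < \<delta>" shows "g s \<le> g \<delta> + g1 \<delta> * (s - \<delta>)"
proof (cases s \<delta> rule: linorder_cases)
  case less
  obtain \<xi> where x: "s < \<xi>" "\<xi> < \<delta>" "g \<delta> - g s = (\<delta> - s) * g1 \<xi>" using g_mvt[OF assms(1) less] .
  have "(\<delta> - s) * g1 \<delta> \<le> (\<delta> - s) * g1 \<xi>" using x assms less by (intro mult_left_mono g1_antimono) auto
  then show ?thesis using x(3) by (simp add: algebra_simps)
next
  case greater
  obtain \<xi> where x: "\<delta> < \<xi>" "\<xi> < s" "g s - g \<delta> = (s - \<delta>) * g1 \<xi>" using g_mvt[OF assms(2) greater] .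
  have "(s - \<delta>) * g1 \<xi> \<le> (s - \<delta>) * g1 \<delta>" using x assms greater by (intro mult_left_mono g1_antimono) auto
  then show ?thesis using x(3) by (simp add: algebra_simps)
qed simp

text \<open>On \<open>(s, \<delta>/2)\<close> the slope of \<open>g\<close> is at least \<open>4/3\<close> of the slope of the tangent, so \<open>g\<close> falls
below the tangent by a fixed fraction of \<open>\<delta> g'(\<delta>)\<close>. This gap and the next one confine the contact points.\<close>

lemma tangent_gap_small:
  assumes "0 < s" "s < \<delta> / 4"
  shows "g1 \<delta> * \<delta> / 16 \<le> g \<delta> + g1 \<delta> * (s - \<delta>) - g s"
proof -
  have \<delta>: "0 < \<delta>" using assms by simp
  have "s < \<delta> / 2" using assms by simp
  obtain \<xi> where x: "s < \<xi>" "\<xi> < \<delta> / 2" "g (\<delta> / 2) - g s = (\<delta> / 2 - s) * g1 \<xi>" using g_mvt[OF assms(1) \<open>s < \<delta> / 2\<close>] .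
  define D where "D = \<delta> * g1 \<delta>"
  define S where "S = s * g1 \<delta>"
  have "g (\<delta> / 2) \<le> g \<delta> + g1 \<delta> * (\<delta> / 2 - \<delta>)" using \<delta> by (intro g_le_tangent) auto
  also have "g1 \<delta> * (\<delta> / 2 - \<delta>) = - D / 2" by (simp add: D_def field_simps)
  finally have 1: "g (\<delta> / 2) \<le> g \<delta> + - D / 2" .
  have "(\<delta> / 2 - s) * (4/3 * g1 \<delta>) \<le> (\<delta> / 2 - s) * g1 \<xi>"
    using g1_half[of \<xi> \<delta>] x assms by (intro mult_left_mono) auto
  also have "(\<delta> / 2 - s) * (4/3 * g1 \<delta>) = 4/3 * (D / 2 - S)" by (simp add: D_def S_def field_simps)
  finally have 2: "4/3 * (D / 2 - S) \<le> g (\<delta> / 2) - g s" using x(3) by simp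
  have "s * g1 \<delta> \<le> (\<delta> / 4) * g1 \<delta>"
    using assms g1_pos[OF \<delta>] by (intro mult_right_mono) auto
  then have 3: "S \<le> D / 4" by (simp add: D_def S_def)
  have 4: "0 < D" using \<delta> g1_pos by (simp add: D_def)
  have e: "g1 \<delta> * \<delta> / 16 = D / 16" "g1 \<delta> * (s - \<delta>) = S - D" by (simp_all add: D_def S_def algebra_simps)
  have "D / 16 \<le> g \<delta> + (S - D) - g s" using 1 2 3 4 by argo
  then show ?thesis unfolding e .
qed

lemma tangent_gap_large:
  assumes "0 < \<delta>" "4 * \<delta> < s"
  shows "g1 \<delta> * s / 8 \<le> g \<delta> + g1 \<delta> * (s - \<delta>) - g s"
proof -
  have "2 * \<delta> < s" using assms by simp
  obtain \<xi> where x: "2 * \<delta> < \<xi>" "\<xi> < s" "g s - g (2 * \<delta>) = (s - 2 * \<delta>) * g1 \<xi>" 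
    using g_mvt[OF _ \<open>2 * \<delta> < s\<close>] assms by auto
  have "g (2 * \<delta>) \<le> g \<delta> + g1 \<delta> * (2 * \<delta> - \<delta>)" using assms by (intro g_le_tangent) auto
  moreover have "(s - 2 * \<delta>) * g1 \<xi> \<le> (s - 2 * \<delta>) * (3/4 * g1 \<delta>)"
    using g1_half[of \<delta> \<xi>] x assms by (intro mult_left_mono) auto
  moreover have "(s / 2) * g1 \<delta> \<le> (s - 2 * \<delta>) * g1 \<delta>"
    using assms g1_pos[OF assms(1)] by (intro mult_right_mono) auto
  ultimately show ?thesis using x(3) by (simp add: algebra_simps)
qed

text \<open>This is the concavity that produces the term with \<open>\<kappa> \<beta>\<close> in the elliptic operator; it is the reason for the
exponential in \<open>g\<close>, as a pure power would only give a multiple \<open>1 - \<beta>\<close> independent of \<open>K\<close>.\<close>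

lemma g2_le:
  assumes "0 < s" "s \<le> 1" shows "g2 s \<le> - (\<kappa> * \<beta>) * g1 s"
proof -
  have "1 \<le> s powr (\<beta> - 1)" using assms \<beta> powr_mono'[of "\<beta> - 1" 0 s] by simp
  then have "\<kappa> * \<beta> * 1 \<le> \<kappa> * \<beta> * s powr (\<beta> - 1)" using \<kappa> \<beta> by (intro mult_left_mono) auto
  moreover have "(\<beta> - 1) / s \<le> 0" using assms \<beta> by (simp add: divide_nonpos_pos)
  ultimately have "(\<beta> - 1) / s - \<kappa> * \<beta> * s powr (\<beta> - 1) \<le> - (\<kappa> * \<beta>)" by linarith
  then have "g1 s * ((\<beta> - 1) / s - \<kappa> * \<beta> * s powr (\<beta> - 1)) \<le> g1 s * (- (\<kappa> * \<beta>))"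
    using g1_pos[OF assms(1)] by (intro mult_left_mono) auto
  then show ?thesis by (simp add: g2_def mult.commute)
qed

lemma times_g1: "0 < s \<Longrightarrow> s * g1 s = \<beta> * (\<kappa> * s powr \<beta> * exp (- \<kappa> * s powr \<beta>))"
  by (simp add: g1_def powr_diff)

text \<open>The tangent to \<open>g\<close> at \<open>s\<close> has the value \<open>g s - s g'(s)\<close> at \<open>0\<close>; the bound leaves room for
tilting the tangent while keeping it positive.\<close>

lemma g_ge: 
  assumes "0 < s" shows "2 * (s * g1 s) \<le> g s"
proof -
  let ?y = "\<kappa> * s powr \<beta>"
  have y: "0 < ?y * exp (- ?y)" using assms \<kappa> by simp
  have "(1 + ?y) * exp (- ?y) \<le> exp ?y * exp (- ?y)"
    by (intro mult_right_mono) auto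
  then have "?y * exp (- ?y) \<le> g s" by (simp add: g_def algebra_simps flip: exp_add)
  moreover have "2 * \<beta> * (?y * exp (- ?y)) \<le> 1 * (?y * exp (- ?y))"
    using y \<beta> by (intro mult_right_mono) auto
  ultimately show ?thesis using times_g1[OF assms] by simp
qed

lemma g1_ge: 
  assumes "0 < s" "s \<le> 1" shows "\<kappa> * \<beta> * exp (- \<kappa>) * s powr (\<beta> - 1) \<le> g1 s"
proof -
  have "s powr \<beta> \<le> 1" using assms \<beta> by (intro powr_le1) auto
  then have "\<kappa> * s powr \<beta> \<le> \<kappa> * 1" using \<kappa> by (intro mult_left_mono) auto
  then have "exp (- \<kappa>) \<le> exp (- \<kappa> * s powr \<beta>)" by simp
  then have "\<kappa> * \<beta> * s powr (\<beta> - 1) * exp (- \<kappa>) \<le> g1 s"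
    unfolding g1_def using \<kappa> \<beta> by (intro mult_left_mono) auto
  then show ?thesis by (simp add: ac_simps)
qed

lemma times_g1_ge:
  assumes "0 < s" "s \<le> 1" shows "\<beta> * exp (- \<kappa>) * g s \<le> s * g1 s"
proof -
  have "\<beta> * exp (- \<kappa>) * g s \<le> \<beta> * exp (- \<kappa>) * (\<kappa> * s powr \<beta>)"
    using \<beta> by (intro mult_left_mono g_le) auto
  also have "\<dots> = s * (\<kappa> * \<beta> * exp (- \<kappa>) * s powr (\<beta> - 1))" using assms by (simp add: powr_diff)
  also have "\<dots> \<le> s * g1 s" using assms by (intro mult_left_mono g1_ge) auto
  finally show ?thesis .
qed

lemma g1_comparable:
  assumes "0 < s" "s \<le> 1" "s \<le> 4 * \<delta>" "0 < \<delta>" shows "exp (- \<kappa>) / 4 * g1 \<delta> \<le> g1 s"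
proof (cases "s \<le> \<delta>")
  case True
  have "exp (- \<kappa>) \<le> 1" using \<kappa> by simp
  then have "exp (- \<kappa>) / 4 \<le> 1" by linarith
  then have "exp (- \<kappa>) / 4 * g1 \<delta> \<le> 1 * g1 \<delta>" using g1_pos[OF assms(4)] by (intro mult_right_mono) auto
  then show ?thesis using g1_antimono[OF assms(1) True] by simp
next
  case False
  have "1/4 \<le> (\<delta> / s) powr 1" using assms by (simp add: field_simps)
  also have "\<dots> \<le> (\<delta> / s) powr (1 - \<beta>)" using assms False \<beta> by (intro powr_mono') auto
  also have "\<dots> = s powr (\<beta> - 1) / \<delta> powr (\<beta> - 1)" using assms by (simp add: powr_divide powr_diff field_simps)
  finally have p: "\<delta> powr (\<beta> - 1) / 4 \<le> s powr (\<beta> - 1)" using assms by (simp add: field_simps)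
  have "g1 \<delta> \<le> \<kappa> * \<beta> * \<delta> powr (\<beta> - 1)"
    unfolding g1_def using \<kappa> \<beta> by (intro mult_left_le) auto
  then have "exp (- \<kappa>) / 4 * g1 \<delta> \<le> exp (- \<kappa>) / 4 * (\<kappa> * \<beta> * \<delta> powr (\<beta> - 1))" by (intro mult_left_mono) auto
  also have "\<dots> = \<kappa> * \<beta> * exp (- \<kappa>) * (\<delta> powr (\<beta> - 1) / 4)" by simp
  also have "\<dots> \<le> \<kappa> * \<beta> * exp (- \<kappa>) * s powr (\<beta> - 1)" using \<kappa> \<beta> p by (intro mult_left_mono) auto
  also have "\<dots> \<le> g1 s" using assms by (intro g1_ge)
  finally show ?thesis .
qed

end

lemma psi_pos: "x \<in> ball 0 1 \<Longrightarrow> 0 < psi x"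
  by (simp add: psi_def power_less_one_iff abs_square_less_1)

lemma psi_le_1: "psi x \<le> 1"
  by (simp add: psi_def)

section \<open>Perturbed tangent planes of the barrier\<close>

text \<open>The polarisation of \<open>\<psi>\<close> is affine in \<open>x\<close>, touches \<open>\<psi>\<close> at \<open>x0\<close> and exceeds it by \<open>\<bar>x - x0\<bar>\<^sup>2\<close>. It is the tangent
plane of \<open>\<psi>\<close>.\<close>

lemma polar_identity: "2 * (1 - x \<bullet> x0) - psi x0 = psi x + (norm (x - x0))\<^sup>2"
  by (simp add: psi_def power2_norm_eq_inner inner_diff_left inner_diff_right inner_commute)

lemma psi_le_polar:
  assumes "norm x \<le> 1" "norm x0 \<le> 1" shows "psi x0 \<le> 2 * (1 - x \<bullet> x0)"
proof -
  have "0 \<le> psi x" using assms by (simp add: psi_def power_le_one)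
  then show ?thesis using polar_identity[of x x0] zero_le_power2[of "norm (x - x0)"] by linarith
qed

text \<open>The linear map with eigenvalue \<open>1\<close> on the line through \<open>x0\<close> and eigenvalue \<open>sqrt (\<psi>(x0))\<close> on its orthogonal
complement: \<open>sqrt \<psi> + \<bar>x0\<bar>\<^sup>2 / (1 + sqrt \<psi>) = 1\<close> because \<open>\<bar>x0\<bar>\<^sup>2 = 1 - \<psi>\<close>. A point \<open>x\<close> of the ball with
\<open>1 - x \<bullet> x0\<close> of the order \<open>\<delta> = \<psi>(x0)\<close> is within \<open>\<delta>\<close> of \<open>x0\<close> in the direction of \<open>x0\<close> but only within \<open>sqrt \<delta>\<close> tangentially;
with this scaling all tilts change the plane there by the order of \<open>\<delta>\<close>.\<close>

definition slope :: "real^'n \<Rightarrow> real^'n \<Rightarrow> real^'n" where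
  "slope x0 \<omega> = sqrt (psi x0) *\<^sub>R \<omega> + ((x0 \<bullet> \<omega>) / (1 + sqrt (psi x0))) *\<^sub>R x0"

text \<open>The tangential part is bounded by \<open>2 sqrt \<delta> \<bar>x - x0\<bar> \<le> \<delta> + \<bar>x - x0\<bar>\<^sup>2\<close> and the polar identity, the radial
part by \<open>x0 \<bullet> (x - x0) = \<delta> - (1 - x \<bullet> x0)\<close>.\<close>

lemma slope_inner_le:
  assumes x: "norm x \<le> 1" and x0: "x0 \<in> ball 0 1" and w: "norm \<omega> \<le> \<eta>"
  shows "\<bar>slope x0 \<omega> \<bullet> (x - x0)\<bar> \<le> 3 * \<eta> * (1 - x \<bullet> x0)"
proof -
  define \<delta> where "\<delta> = psi x0"
  define A where "A = 1 - x \<bullet> x0"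
  have \<delta>: "0 < \<delta>" using psi_pos[OF x0] by (simp add: \<delta>_def)
  have \<eta>: "0 \<le> \<eta>" using w norm_ge_zero order_trans by blast
  have A: "\<delta> \<le> 2 * A" unfolding \<delta>_def A_def using psi_le_polar[of x x0] x x0 by simp
  have id: "(norm (x - x0))\<^sup>2 \<le> 2 * A - \<delta>"
  proof -
    have "0 \<le> psi x" using x by (simp add: psi_def power_le_one)
    then show ?thesis using polar_identity[of x x0] unfolding \<delta>_def A_def by linarith
  qed
  have e1: "\<bar>sqrt \<delta> * (\<omega> \<bullet> (x - x0))\<bar> \<le> \<eta> * A"
  proof -
    have "\<bar>\<omega> \<bullet> (x - x0)\<bar> \<le> norm \<omega> * norm (x - x0)" by (rule Cauchy_Schwarz_ineq2)
    also have "\<dots> \<le> \<eta> * norm (x - x0)" using w by (intro mult_right_mono) auto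
    finally have "\<bar>sqrt \<delta> * (\<omega> \<bullet> (x - x0))\<bar> \<le> sqrt \<delta> * (\<eta> * norm (x - x0))"
      using \<delta> by (simp add: abs_mult mult_left_mono)
    also have "\<dots> = \<eta> * (sqrt \<delta> * norm (x - x0))" by simp
    also have "\<dots> \<le> \<eta> * A"
    proof (rule mult_left_mono[OF _ \<eta>])
      have "0 \<le> (sqrt \<delta> - norm (x - x0))\<^sup>2" by simp
      then have "2 * (sqrt \<delta> * norm (x - x0)) \<le> \<delta> + (norm (x - x0))\<^sup>2"
        using \<delta> by (simp add: power2_diff)
      then show "sqrt \<delta> * norm (x - x0) \<le> A" using id by linarith
    qed
    finally show ?thesis .
  qed
  have e2: "\<bar>(x0 \<bullet> \<omega>) / (1 + sqrt \<delta>) * (x0 \<bullet> (x - x0))\<bar> \<le> 2 * \<eta> * A"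
  proof -
    have "\<bar>x0 \<bullet> \<omega>\<bar> \<le> norm x0 * norm \<omega>" by (rule Cauchy_Schwarz_ineq2)
    also have "\<dots> \<le> 1 * \<eta>" using x0 w by (intro mult_mono) auto
    finally have a: "\<bar>x0 \<bullet> \<omega>\<bar> \<le> \<eta>" by simp
    have b: "\<bar>(x0 \<bullet> \<omega>) / (1 + sqrt \<delta>)\<bar> \<le> \<eta>"
    proof -
      have "\<bar>x0 \<bullet> \<omega>\<bar> / (1 + sqrt \<delta>) \<le> \<eta> / 1" using a \<delta> \<eta> by (intro frac_le) auto
      then show ?thesis using \<delta> by (simp add: abs_divide)
    qed
    have "x0 \<bullet> (x - x0) = \<delta> - A"
      by (simp add: \<delta>_def A_def psi_def power2_norm_eq_inner inner_diff_right inner_commute)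
    then have c: "\<bar>x0 \<bullet> (x - x0)\<bar> \<le> 2 * A" using A \<delta> by simp
    have "\<bar>(x0 \<bullet> \<omega>) / (1 + sqrt \<delta>) * (x0 \<bullet> (x - x0))\<bar> \<le> \<eta> * (2 * A)"
      unfolding abs_mult by (intro mult_mono b c) (use \<eta> in auto)
    then show ?thesis by simp
  qed
  have "slope x0 \<omega> \<bullet> (x - x0) = sqrt \<delta> * (\<omega> \<bullet> (x - x0)) + (x0 \<bullet> \<omega>) / (1 + sqrt \<delta>) * (x0 \<bullet> (x - x0))"
    by (simp add: slope_def \<delta>_def inner_add_left)
  then show ?thesis using e1 e2 unfolding A_def[symmetric] by linarith
qed

lemma norm_slope_le:
  assumes x0: "x0 \<in> ball 0 1" and w: "norm \<omega> \<le> \<eta>"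
  shows "norm (slope x0 \<omega>) \<le> 2 * \<eta>"
proof -
  have \<delta>: "0 < psi x0" using psi_pos[OF x0] .
  have \<eta>: "0 \<le> \<eta>" using w norm_ge_zero order_trans by blast
  have "sqrt (psi x0) \<le> 1" using psi_le_1[of x0] by simp
  then have 1: "norm (sqrt (psi x0) *\<^sub>R \<omega>) \<le> 1 * \<eta>"
    using \<delta> w unfolding norm_scaleR by (intro mult_mono) auto
  have "\<bar>x0 \<bullet> \<omega>\<bar> \<le> norm x0 * norm \<omega>" by (rule Cauchy_Schwarz_ineq2)
  also have "\<dots> \<le> 1 * \<eta>" using x0 w by (intro mult_mono) auto
  finally have "\<bar>x0 \<bullet> \<omega>\<bar> / (1 + sqrt (psi x0)) \<le> \<eta> / 1" using \<delta> \<eta> by (intro frac_le) auto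
  then have b: "\<bar>(x0 \<bullet> \<omega>) / (1 + sqrt (psi x0))\<bar> \<le> \<eta>" using \<delta> by (simp add: abs_divide)
  have 2: "norm (((x0 \<bullet> \<omega>) / (1 + sqrt (psi x0))) *\<^sub>R x0) \<le> \<eta> * 1"
    unfolding norm_scaleR by (intro mult_mono b) (use x0 \<eta> in auto)
  show ?thesis unfolding slope_def
    by (rule order_trans[OF norm_triangle_ineq]) (use 1 2 in simp)
qed

context barrier
begin

text \<open>The tangent plane of \<open>g(\<psi>)\<close> at \<open>x0\<close>, lowered by \<open>\<tau> \<psi> g'(\<psi>)\<close> at \<open>x0\<close> and with slope perturbed by
\<open>g'(\<psi>) slope x0 \<omega>\<close>.\<close>

definition plane :: "real^'n \<Rightarrow> real \<Rightarrow> real^'n \<Rightarrow> real^'n \<Rightarrow> real" where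
  "plane x0 \<tau> \<omega> x = g (psi x0) - \<tau> * (psi x0 * g1 (psi x0))
      + (g1 (psi x0) *\<^sub>R (slope x0 \<omega> - 2 *\<^sub>R x0)) \<bullet> (x - x0)"

lemma plane_eq:
  "plane x0 \<tau> \<omega> x = g (psi x0) + g1 (psi x0) * (2 * (1 - x \<bullet> x0) - psi x0 - psi x0)
     + g1 (psi x0) * (slope x0 \<omega> \<bullet> (x - x0) - \<tau> * psi x0)"
proof -
  have e: "x0 \<bullet> (x - x0) = psi x0 - (1 - x \<bullet> x0)"
    by (simp add: psi_def power2_norm_eq_inner inner_diff_right inner_commute)
  show ?thesis
    unfolding plane_def inner_scaleR_left inner_diff_left[of "slope x0 \<omega>"] e by (simp add: algebra_simps)
qed

lemma plane_perturbation:
  assumes x: "norm x \<le> 1" and x0: "x0 \<in> ball 0 1" and w: "norm \<omega> \<le> \<eta>" and t: "0 \<le> \<tau>" "\<tau> \<le> 2 * \<eta>"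
  shows "- 7 * \<eta> * (1 - x \<bullet> x0) \<le> slope x0 \<omega> \<bullet> (x - x0) - \<tau> * psi x0"
proof -
  have \<delta>: "0 < psi x0" using psi_pos[OF x0] .
  have \<eta>: "0 \<le> \<eta>" using w norm_ge_zero order_trans by blast
  have A: "psi x0 \<le> 2 * (1 - x \<bullet> x0)" using psi_le_polar[of x x0] x x0 by simp
  have "\<tau> * psi x0 \<le> (2 * \<eta>) * (2 * (1 - x \<bullet> x0))" using t \<delta> A \<eta> by (intro mult_mono) auto
  then show ?thesis using slope_inner_le[OF x x0 w] by linarith
qed

lemma plane_pos:
  assumes x: "norm x \<le> 1" and x0: "x0 \<in> ball 0 1" and w: "norm \<omega> \<le> 1/256" and t: "0 \<le> \<tau>" "\<tau> \<le> 2/256"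
  shows "0 < plane x0 \<tau> \<omega> x"
proof -
  let ?d = "psi x0" and ?A = "1 - x \<bullet> x0"
  have \<delta>: "0 < ?d" using psi_pos[OF x0] .
  have A: "?d \<le> 2 * ?A" using psi_le_polar[of x x0] x x0 by simp
  have p: "- 7 * (1/256) * ?A \<le> slope x0 \<omega> \<bullet> (x - x0) - \<tau> * ?d"
    using plane_perturbation[OF x x0 w] t by simp
  have "g1 ?d * (- 7 * (1/256) * ?A) \<le> g1 ?d * (slope x0 \<omega> \<bullet> (x - x0) - \<tau> * ?d)"
    using p g1_pos[OF \<delta>] by (intro mult_left_mono) auto
  moreover have "g1 ?d * (- 7 * (1/256) * ?A) = - 7/256 * (g1 ?d * ?A)" by simp
  moreover have "g1 ?d * (2 * ?A - ?d - ?d) = 2 * (g1 ?d * ?A) - 2 * (?d * g1 ?d)" by (simp add: algebra_simps)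
  moreover have "2 * (?d * g1 ?d) \<le> g ?d" using g_ge[OF \<delta>] .
  moreover have "0 < g1 ?d * ?A" using g1_pos[OF \<delta>] A \<delta> by (intro mult_pos_pos) auto
  ultimately show ?thesis unfolding plane_eq by linarith
qed

text \<open>Measured in units of \<open>g'(\<delta>) A\<close> with \<open>A = 1 - x \<bullet> x0\<close>, the perturbation of the tangent plane costs at most
\<open>7/256\<close> and the tolerance \<open>1/512 \<delta> g'(\<delta>)\<close> at most \<open>1/256\<close>, together \<open>1/32\<close>. If \<open>\<psi>(x)\<close> were
far from \<open>\<delta> = \<psi>(x0)\<close>, the gap between \<open>g\<close> and its tangent would be larger.\<close>

lemma plane_contact_localized:
  assumes x: "x \<in> ball 0 1" and x0: "x0 \<in> ball 0 1" and w: "norm \<omega> \<le> 1/256" and t: "0 \<le> \<tau>" "\<tau> \<le> 2/256"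
    and le: "plane x0 \<tau> \<omega> x \<le> g (psi x) + 1/512 * (psi x0 * g1 (psi x0))"
  shows "psi x0 / 4 \<le> psi x" and "psi x \<le> 4 * psi x0"
proof -
  define \<delta> where "\<delta> = psi x0" 
  define s where "s = psi x"
  define A where "A = 1 - x \<bullet> x0"
  have \<delta>: "0 < \<delta>" and s: "0 < s" using psi_pos x x0 by (auto simp: \<delta>_def s_def)
  have nx: "norm x \<le> 1" using x by simp
  have A: "\<delta> \<le> 2 * A" unfolding \<delta>_def A_def using psi_le_polar[of x x0] nx x0 by simp
  define m where "m = 2 * A - \<delta>"
  have m: "s \<le> m" unfolding m_def A_def \<delta>_def s_def using polar_identity[of x x0] by simp
  have g1p: "0 < g1 \<delta>" using g1_pos[OF \<delta>] .
  have p: "g1 \<delta> * (- 7 * (1/256) * A) \<le> g1 \<delta> * (slope x0 \<omega> \<bullet> (x - x0) - \<tau> * \<delta>)"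
    using plane_perturbation[OF nx x0 w] t g1p unfolding A_def \<delta>_def by (intro mult_left_mono) auto
  have "1/512 * (\<delta> * g1 \<delta>) \<le> 1/256 * (g1 \<delta> * A)" using A g1p by simp
  moreover have "plane x0 \<tau> \<omega> x = g \<delta> + g1 \<delta> * (m - \<delta>) + g1 \<delta> * (slope x0 \<omega> \<bullet> (x - x0) - \<tau> * \<delta>)"
    unfolding plane_eq m_def A_def \<delta>_def ..
  ultimately have key: "g \<delta> + g1 \<delta> * (m - \<delta>) - g s \<le> g1 \<delta> * A / 32"
    using le p unfolding \<delta>_def[symmetric] s_def[symmetric] by (simp add: algebra_simps)
  have split: "g \<delta> + g1 \<delta> * (m - \<delta>) - g s = (g \<delta> + g1 \<delta> * (s - \<delta>) - g s) + g1 \<delta> * (m - s)"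
    by (simp add: algebra_simps)
  have gA: "0 < g1 \<delta> * A" using g1p A \<delta> by simp
  have gm: "0 \<le> g1 \<delta> * (m - s)" using g1p m by simp
  have Am: "g1 \<delta> * A = (g1 \<delta> * m + g1 \<delta> * \<delta>) / 2" by (simp add: m_def algebra_simps)
  show "psi x0 / 4 \<le> psi x"
  proof (rule ccontr)
    assume "\<not> psi x0 / 4 \<le> psi x"
    then have sd: "s < \<delta> / 4" by (simp add: \<delta>_def s_def)
    have "g1 \<delta> * s \<le> g1 \<delta> * (\<delta> / 4)" using sd g1p by (intro mult_left_mono) auto
    then have "g1 \<delta> * A / 32 < g1 \<delta> * \<delta> / 16 + g1 \<delta> * (m - s)"
      using Am gA gm by (simp add: algebra_simps)
    then show False using tangent_gap_small[OF s sd] key split by linarith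
  qed
  show "psi x \<le> 4 * psi x0"
  proof (rule ccontr)
    assume "\<not> psi x \<le> 4 * psi x0"
    then have sd: "4 * \<delta> < s" by (simp add: \<delta>_def s_def)
    have "g1 \<delta> * (4 * \<delta>) \<le> g1 \<delta> * s" using sd g1p by (intro mult_left_mono) auto
    then have "g1 \<delta> * A / 32 < g1 \<delta> * s / 8 + g1 \<delta> * (m - s)"
      using Am gA gm by (simp add: algebra_simps)
    then show False using tangent_gap_large[OF \<delta> sd] key split by linarith
  qed
qed

definition \<theta> :: "real^'n \<Rightarrow> real" where "\<theta> x = g (psi x)"
definition grad_\<theta> :: "real^'n \<Rightarrow> real^'n" where "grad_\<theta> x = (- 2 * g1 (psi x)) *\<^sub>R x"
definition hess_\<theta> :: "real^'n \<Rightarrow> real^'n^'n" where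
  "hess_\<theta> x = (\<chi> i j. 4 * g2 (psi x) * (x $ i * x $ j) - (if i = j then 2 * g1 (psi x) else 0))"

lemma psi_has_derivative: "(psi has_derivative (\<lambda>h. - 2 * (x \<bullet> h))) (at x)"
  unfolding psi_def[abs_def] power2_norm_eq_inner
  by (rule derivative_eq_intros refl)+ (auto simp: inner_commute fun_eq_iff)

lemma \<theta>_has_derivative:
  assumes "x \<in> ball 0 1" shows "(\<theta> has_derivative (\<lambda>h. grad_\<theta> x \<bullet> h)) (at x)"
proof -
  have "((\<lambda>x. g (psi x)) has_derivative (\<lambda>h. g1 (psi x) * (- 2 * (x \<bullet> h)))) (at x)"
    by (rule has_derivative_compose[OF psi_has_derivative g_deriv[OF psi_pos[OF assms], unfolded has_field_derivative_def]])
  then show ?thesis by (simp add: \<theta>_def[abs_def] grad_\<theta>_def ac_simps)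
qed

lemma grad_\<theta>_has_derivative:
  assumes "x \<in> ball 0 1" shows "(grad_\<theta> has_derivative (\<lambda>h. hess_\<theta> x *v h)) (at x)"
proof -
  have g: "((\<lambda>x. g1 (psi x)) has_derivative (\<lambda>h. g2 (psi x) * (- 2 * (x \<bullet> h)))) (at x)"
    by (rule has_derivative_compose[OF psi_has_derivative g1_deriv[OF psi_pos[OF assms], unfolded has_field_derivative_def]])
  have "((\<lambda>x. (- 2 * g1 (psi x)) *\<^sub>R x) has_derivative
      (\<lambda>h. (- 2 * g1 (psi x)) *\<^sub>R h + (- 2 * (g2 (psi x) * (- 2 * (x \<bullet> h)))) *\<^sub>R x)) (at x)"
    by (rule has_derivative_scaleR[OF has_derivative_mult_right[OF g] has_derivative_ident])
  moreover have "(- 2 * g1 (psi x)) *\<^sub>R h + (- 2 * (g2 (psi x) * (- 2 * (x \<bullet> h)))) *\<^sub>R x = hess_\<theta> x *v h" for h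
  proof -
    have "(hess_\<theta> x *v h) $ i = ((- 2 * g1 (psi x)) *\<^sub>R h + (- 2 * (g2 (psi x) * (- 2 * (x \<bullet> h)))) *\<^sub>R x) $ i" for i
      by (simp add: hess_\<theta>_def matrix_vector_mult_def left_diff_distrib sum_subtractf inner_vec_def
          sum_distrib_left sum_distrib_right if_distrib[of "\<lambda>c. c * _"] cong: if_cong) (simp add: ac_simps)
    then show ?thesis by (simp add: vec_eq_iff)
  qed
  ultimately show ?thesis by (simp add: grad_\<theta>_def[abs_def])
qed

lemma norm_grad_\<theta>: 
  assumes "x \<in> ball 0 1" shows "norm (grad_\<theta> x) = 2 * g1 (psi x) * norm x"
  using g1_pos[OF psi_pos[OF assms]] by (simp add: grad_\<theta>_def)

text \<open>The Hessian is the sum of \<open>4 g''(\<psi>) x x\<^sup>T\<close> and \<open>- 2 g'(\<psi>) I\<close>; both are negative, and the smallest eigenvalue bounds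
their pairings with \<open>a\<close> from below in absolute value.\<close>

lemma frob_hess_\<theta>_le:
  fixes a :: "real^'n^'n" and x :: "real^'n"
  assumes x: "x \<in> ball 0 1" and a: "sym_nonneg_definite a"
  shows "frob a (hess_\<theta> x) \<le> - smallest_eigenvalue a * (g1 (psi x) * (2 * real CARD('n) + 4 * \<kappa> * \<beta> * (norm x)\<^sup>2))"
proof -
  let ?\<mu> = "smallest_eigenvalue a" and ?s = "psi x"
  have s: "0 < ?s" "?s \<le> 1" using psi_pos[OF x] psi_le_1 by auto
  have sym: "transpose a = a" using a by (simp add: sym_nonneg_definite_def)
  have \<mu>: "0 \<le> ?\<mu>" using smallest_eigenvalue_nonneg[OF a] .
  have gp: "0 < g1 ?s" using g1_pos s by simp
  have g2: "g2 ?s \<le> - (\<kappa> * \<beta>) * g1 ?s" using g2_le s by simp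
  have g2n: "g2 ?s \<le> 0" using g2 gp \<kappa> \<beta> by (smt (verit) mult_nonneg_nonneg mult_minus_left)
  have "frob a (hess_\<theta> x) = 4 * g2 ?s * (x \<bullet> (a *v x)) - 2 * g1 ?s * trace a"
    by (simp add: frob_def hess_\<theta>_def right_diff_distrib sum_subtractf trace_def inner_vec_def matrix_vector_mult_def
        sum_distrib_left if_distrib[of "\<lambda>c. _ * c"] cong: if_cong) (simp add: ac_simps)
  moreover have "4 * g2 ?s * (x \<bullet> (a *v x)) \<le> 4 * g2 ?s * (?\<mu> * (norm x)\<^sup>2)"
    using smallest_eigenvalue_le_quadratic_form(1)[OF sym, of x] g2n by (intro mult_left_mono_neg) auto
  moreover have "g2 ?s * (?\<mu> * (norm x)\<^sup>2) \<le> (- (\<kappa> * \<beta>) * g1 ?s) * (?\<mu> * (norm x)\<^sup>2)"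
    using g2 \<mu> by (intro mult_right_mono) auto
  moreover have "2 * g1 ?s * (real CARD('n) * ?\<mu>) \<le> 2 * g1 ?s * trace a"
    using trace_ge_smallest_eigenvalue[OF sym] gp by (intro mult_left_mono) auto
  ultimately show ?thesis by (simp add: algebra_simps)
qed

end

section \<open>The volume of the set of planes\<close>

text \<open>Conjugate by an orthogonal matrix whose columns include the direction of \<open>x\<close>.\<close>

lemma det_rank_one_perturbation:
  fixes x :: "real^'n"
  assumes s: "0 < s"
  shows "det (\<chi> i j. (if i = j then s else 0) + k * (x $ i * x $ j)) = s ^ (CARD('n) - 1) * (s + k * (norm x)\<^sup>2)"
proof -
  let ?M = "(\<chi> i j. (if i = j then s else 0) + k * (x $ i * x $ j)) :: real^'n^'n"
  obtain i0 :: 'n where True by blast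
  obtain A where A: "orthogonal_matrix A" "x = norm x *\<^sub>R column i0 A"
  proof (cases "x = 0")
    case True
    then show ?thesis using that[of "mat 1"] by (simp add: orthogonal_matrix_id)
  next
    case False
    then have "norm ((1 / norm x) *\<^sub>R x) = 1" by simp
    then obtain A where "orthogonal_matrix A" "A *v axis i0 1 = (1 / norm x) *\<^sub>R x"
      using orthogonal_matrix_exists_basis by metis
    then show ?thesis using that[of A] False by (simp add: matrix_vector_mult_basis)
  qed
  have AA: "transpose A ** A = mat 1" using A(1) by (simp add: orthogonal_matrix)
  have col: "column i A \<bullet> column j A = (if i = j then 1 else 0)" for i j
  proof -
    have "(mat 1 :: real^'n^'n) $ i $ j = column i A \<bullet> column j A"
      using congruence_diag[of A "mat 1" i j] by (simp add: AA)
    then show ?thesis by (simp add: mat_def)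
  qed
  have Mv: "?M *v w = s *\<^sub>R w + (k * (x \<bullet> w)) *\<^sub>R x" for w
  proof -
    have "(?M *v w) $ i = (s *\<^sub>R w + (k * (x \<bullet> w)) *\<^sub>R x) $ i" for i
      by (simp add: matrix_vector_mult_def inner_vec_def distrib_right sum.distrib sum_distrib_left sum_distrib_right
          if_distrib[of "\<lambda>c. c * _"] cong: if_cong) (simp add: ac_simps)
    then show ?thesis by (simp add: vec_eq_iff)
  qed
  have xc: "x \<bullet> column j A = (if j = i0 then norm x else 0)" for j
    by (subst A(2)) (simp add: col)
  let ?D = "(transpose A ** ?M ** A)"
  have D: "?D $ i $ j = (if i = j then s + (if i = i0 then k * (norm x)\<^sup>2 else 0) else 0)" for i j
    unfolding congruence_diag Mv
    by (auto simp: inner_add_right col xc inner_commute[of _ x] power2_eq_square)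
  have "det ?M = det ?D"
  proof -
    have "det A * det A = 1" using arg_cong[OF AA, of det] by (simp add: det_mul det_transpose)
    then show ?thesis by (simp add: det_mul det_transpose)
  qed
  also have "\<dots> = (\<Prod>i\<in>UNIV. ?D $ i $ i)" by (rule det_diagonal) (simp add: D)
  also have "\<dots> = (s + k * (norm x)\<^sup>2) * (\<Prod>i\<in>UNIV - {i0}. ?D $ i $ i)"
    by (subst prod.remove[of _ i0]) (auto simp: D)
  also have "(\<Prod>i\<in>UNIV - {i0}. ?D $ i $ i) = (\<Prod>i\<in>UNIV - {i0}. s)"
    by (rule prod.cong) (auto simp: D)
  finally show ?thesis by (simp add: mult.commute)
qed

lemma det_slope:
  fixes x0 :: "real^'n"
  assumes x0: "x0 \<in> ball 0 1"
  shows "det (\<chi> i j. c * slope x0 (axis j 1) $ i) = c ^ CARD('n) * sqrt (psi x0) ^ (CARD('n) - 1)"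
proof -
  let ?s = "sqrt (psi x0)"
  have s: "0 < ?s" using psi_pos[OF x0] by simp
  have n: "(norm x0)\<^sup>2 = 1 - ?s * ?s" using psi_pos[OF x0] by (simp add: psi_def)
  have "(\<chi> i j. c * slope x0 (axis j 1) $ i) = (\<chi> i. c *s (\<chi> i j. (if i = j then ?s else 0) + 1 / (1 + ?s) * (x0 $ i * x0 $ j)) $ i)"
  proof -
    have 1: "axis j (1::real) $ i = (if i = j then 1 else 0)" for i j :: 'n by (simp add: axis_def)
    have 2: "x0 \<bullet> axis j 1 = x0 $ j" for j by (simp add: inner_axis)
    show ?thesis by (simp add: vec_eq_iff slope_def 1 2)
  qed
  also have "det \<dots> = c ^ CARD('n) * det (\<chi> i j. (if i = j then ?s else 0) + 1 / (1 + ?s) * (x0 $ i * x0 $ j))"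
    by (subst det_rows_mul) simp
  also have "\<dots> = c ^ CARD('n) * (?s ^ (CARD('n) - 1) * (?s + 1 / (1 + ?s) * (norm x0)\<^sup>2))"
    by (simp only: det_rank_one_perturbation[OF s])
  also have "?s + 1 / (1 + ?s) * (norm x0)\<^sup>2 = 1"
  proof -
    have "r + 1 / (1 + r) * (1 - r * r) = 1" if "0 < r" for r :: real using that by (simp add: field_simps)
    then show ?thesis unfolding n using s .
  qed
  finally show ?thesis by simp
qed

lemma emeasure_affine_image_join:
  fixes \<Lambda> :: "real \<times> (real^'n) \<Rightarrow> real \<times> (real^'n)"
  assumes lin: "linear \<Lambda>" and D: "compact D"
  shows "emeasure lborel ((\<lambda>z. b + \<Lambda> z) ` D)
    = ennreal \<bar>det (matrix (\<lambda>y. join (\<Lambda> (unjoin y))))\<bar> * emeasure lborel D"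
proof -
  let ?f = "\<lambda>y. join (\<Lambda> (unjoin y))"
  have lf: "linear ?f"
    using linear_compose[OF linear_compose[OF linear_unjoin lin] linear_join] by (simp add: o_def)
  have jm: "emeasure lborel A = emeasure lebesgue (join ` A)" if "A \<in> sets borel" for A :: "(real \<times> (real^'n)) set"
  proof -
    have jA: "join ` A = unjoin -` A"
    proof (intro equalityI subsetI)
      fix y assume "y \<in> unjoin -` A"
      then have "y = join (unjoin y)" "unjoin y \<in> A" by auto
      then show "y \<in> join ` A" by blast
    qed auto
    have m: "unjoin -` A \<in> sets borel" using measurable_sets[OF measurable_unjoin that] by simp
    have "emeasure lebesgue (unjoin -` A) = emeasure lborel (unjoin -` A)" using m by simp
    also have "\<dots> = emeasure lborel (join -` (unjoin -` A))"
      by (subst lborel_join) (subst emeasure_distr, use m in auto)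
    also have "join -` (unjoin -` A) = A" by (auto simp: vimage_def)
    finally show ?thesis by (simp add: jA)
  qed
  have cont: "continuous_on S \<Lambda>" for S
    using lin by (intro linear_continuous_on) (simp add: linear_conv_bounded_linear)
  have contj: "continuous_on S join" for S :: "(real \<times> (real^'n)) set"
    by (rule linear_continuous_on[OF bounded_linear_join])
  have cD: "compact (join ` D)" by (rule compact_continuous_image[OF contj D])
  have "compact ((\<lambda>z. b + \<Lambda> z) ` D)"
    by (rule compact_continuous_image[OF continuous_on_add[OF continuous_on_const cont] D])
  then have "emeasure lborel ((\<lambda>z. b + \<Lambda> z) ` D) = emeasure lebesgue (join ` ((\<lambda>z. b + \<Lambda> z) ` D))"
    by (intro jm borel_compact)
  also have "join ` ((\<lambda>z. b + \<Lambda> z) ` D) = (+) (join b) ` (?f ` (join ` D))"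
    by (simp add: image_image linear_add[OF linear_join])
  also have "emeasure lebesgue \<dots> = ennreal (measure lebesgue ((+) (join b) ` (?f ` (join ` D))))"
  proof (rule emeasure_eq_measure2)
    have "bounded_linear ?f" using lf by (simp add: linear_conv_bounded_linear)
    then have "compact (?f ` (join ` D))"
      by (rule compact_continuous_image[OF linear_continuous_on cD])
    then have "compact ((+) (join b) ` (?f ` (join ` D)))" by (rule compact_translation)
    then show "(+) (join b) ` (?f ` (join ` D)) \<in> lmeasurable" by (rule lmeasurable_compact)
  qed
  also have "\<dots> = ennreal (\<bar>det (matrix ?f)\<bar> * measure lebesgue (join ` D))"
    by (simp add: measure_translation measure_linear_image[OF lf lmeasurable_compact[OF cD]])
  also have "\<dots> = ennreal \<bar>det (matrix ?f)\<bar> * emeasure lebesgue (join ` D)"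
    by (simp add: ennreal_mult emeasure_eq_measure2[OF lmeasurable_compact[OF cD]])
  also have "emeasure lebesgue (join ` D) = emeasure lborel D"
    by (rule jm[symmetric]) (rule borel_compact[OF D])
  finally show ?thesis .
qed

text \<open>Admissible pairs \<open>(\<tau>, \<omega>)\<close>. The lower bound on \<open>\<tau>\<close> makes every plane start strictly below the function it is compared with,
with room for the error of an approximation.\<close>

definition plane_params :: "(real \<times> (real^'n)) set" where
  "plane_params = {1/256..2/256} \<times> cball 0 (1/256)"

lemma emeasure_plane_params_pos:
  "0 < emeasure lborel (plane_params :: (real \<times> (real^'n)) set)"
  "emeasure lborel (plane_params :: (real \<times> (real^'n)) set) < \<infinity>"
proof -
  let ?B = "box (1/256) (2/256) \<times> ball 0 (1/256) :: (real \<times> (real^'n)) set"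
  have "open ?B" by (intro open_Times) auto
  moreover have "?B \<noteq> {}" by auto
  ultimately have "\<not> negligible ?B" by (rule open_not_negligible)
  then have "emeasure lborel ?B \<noteq> 0"
    using \<open>open ?B\<close> by (auto simp: negligible_iff_null_sets null_sets_def)
  then have "0 < emeasure lborel ?B" by (simp add: zero_less_iff_neq_zero)
  also have "\<dots> \<le> emeasure lborel (plane_params :: (real \<times> (real^'n)) set)"
    unfolding plane_params_def by (intro emeasure_mono) (auto intro!: borel_closed closed_Times)
  finally show "0 < emeasure lborel (plane_params :: (real \<times> (real^'n)) set)" .
  have "compact (plane_params :: (real \<times> (real^'n)) set)"
    unfolding plane_params_def by (intro compact_Times) auto
  then show "emeasure lborel (plane_params :: (real \<times> (real^'n)) set) < \<infinity>" by (rule emeasure_compact_finite)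
qed

lemma compact_plane_params: "compact plane_params"
  unfolding plane_params_def by (intro compact_Times) auto

lemma linear_slope: "linear (slope x0)"
  by (rule linearI) (simp_all add: slope_def inner_add_right add_divide_distrib algebra_simps)

context barrier
begin

text \<open>The planes \<open>m * plane x0 \<tau> \<omega>\<close>, each represented by its value at \<open>x0\<close> and its gradient. These are the values that the Legendre map
takes at contact points.\<close>

definition plane_image :: "real \<Rightarrow> real^'n \<Rightarrow> (real \<times> (real^'n)) set" where
  "plane_image m x0 = (\<lambda>(\<tau>, \<omega>). (m * plane x0 \<tau> \<omega> x0, m *\<^sub>R (g1 (psi x0) *\<^sub>R (slope x0 \<omega> - 2 *\<^sub>R x0)))) ` plane_params"

lemma plane_image_measure:
  fixes x0 :: "real^'n"
  assumes x0: "x0 \<in> ball 0 1" and m: "0 < m"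
  shows "emeasure lborel (plane_image m x0) =
      ennreal ((m * g1 (psi x0)) ^ (CARD('n) + 1) * psi x0 * sqrt (psi x0) ^ (CARD('n) - 1)) * emeasure lborel (plane_params :: (real \<times> (real^'n)) set)"
    and "plane_image m x0 \<in> sets borel"
proof -
  let ?d = "psi x0" 
  let ?b = "(m * g ?d, (- 2 * m * g1 ?d) *\<^sub>R x0)"
  define \<Lambda> where "\<Lambda> z = (- (m * ?d * g1 ?d) * fst z, (m * g1 ?d) *\<^sub>R slope x0 (snd z))" for z
  have \<delta>: "0 < ?d" using psi_pos[OF x0] .
  have lin: "linear \<Lambda>"
    unfolding \<Lambda>_def by (rule linearI)
      (simp_all add: linear_add[OF linear_slope] linear_scale[OF linear_slope] algebra_simps)
  have eq: "plane_image m x0 = (\<lambda>z. ?b + \<Lambda> z) ` plane_params"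
    unfolding plane_image_def \<Lambda>_def case_prod_beta
    by (intro image_cong refl) (simp add: plane_def prod_eq_iff algebra_simps)
  let ?M = "matrix (\<lambda>y. join (\<Lambda> (unjoin y))) :: real^'n idx^'n idx"
  have uO: "unjoin (axis Origin 1 :: real^'n idx) = (1, 0)"
    by (simp add: unjoin_def axis_def vec_eq_iff)
  have uI: "unjoin (axis (Index j) 1 :: real^'n idx) = (0, axis j 1)" for j
    by (simp add: unjoin_def axis_def vec_eq_iff)
  have "det ?M = ?M $ Origin $ Origin * det (\<chi> i j. ?M $ Index i $ Index j)"
    by (rule det_idx_block) (simp add: matrix_def uI \<Lambda>_def join_def)
  also have "?M $ Origin $ Origin = - (m * ?d * g1 ?d)"
    by (simp add: matrix_def uO \<Lambda>_def join_def)
  also have "(\<chi> i j. ?M $ Index i $ Index j) = (\<chi> i j. (m * g1 ?d) * slope x0 (axis j 1) $ i)"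
    by (simp add: matrix_def uI \<Lambda>_def join_def vec_eq_iff)
  finally have "\<bar>det ?M\<bar> = \<bar>m * ?d * g1 ?d\<bar> * \<bar>(m * g1 ?d) ^ CARD('n) * sqrt ?d ^ (CARD('n) - 1)\<bar>"
    by (simp only: det_slope[OF x0] abs_mult abs_minus_cancel)
  also have "\<dots> = (m * g1 ?d) ^ (CARD('n) + 1) * ?d * sqrt ?d ^ (CARD('n) - 1)"
    using m g1_pos[OF \<delta>] \<delta> by (simp add: ac_simps)
  finally have det: "\<bar>det ?M\<bar> = (m * g1 ?d) ^ (CARD('n) + 1) * ?d * sqrt ?d ^ (CARD('n) - 1)" .
  show "emeasure lborel (plane_image m x0) =
      ennreal ((m * g1 (psi x0)) ^ (CARD('n) + 1) * psi x0 * sqrt (psi x0) ^ (CARD('n) - 1)) * emeasure lborel (plane_params :: (real \<times> (real^'n)) set)"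
    unfolding eq emeasure_affine_image_join[OF lin compact_plane_params] det ..
  have "continuous_on S \<Lambda>" for S
    using lin by (intro linear_continuous_on) (simp add: linear_conv_bounded_linear)
  then have "compact (plane_image m x0)"
    unfolding eq by (rule compact_continuous_image[OF continuous_on_add[OF continuous_on_const] compact_plane_params])
  then show "plane_image m x0 \<in> sets borel" by (rule borel_compact)
qed

text \<open>This is where the relation between \<open>\<alpha>\<close> and \<open>\<beta>\<close> is used: the powers of \<open>\<psi>(x0)\<close> combine to
\<open>(\<beta> - 1) (n + 1) + 1 + (n - 1) / 2 = - \<alpha>\<close>.\<close>

lemma plane_image_measure_ge:
  fixes x0 :: "real^'n"
  assumes x0: "x0 \<in> ball 0 1" and m: "0 < m" and al: "\<beta> = 1/2 - \<alpha> / (real CARD('n) + 1)"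
  shows "ennreal ((m * \<kappa> * \<beta> * exp (- \<kappa>)) ^ (CARD('n) + 1) * psi x0 powr (- \<alpha>)) * emeasure lborel (plane_params :: (real \<times> (real^'n)) set)
    \<le> emeasure lborel (plane_image m x0)"
proof -
  let ?d = "psi x0" and ?n = "CARD('n)"
  have \<delta>: "0 < ?d" "?d \<le> 1" using psi_pos[OF x0] psi_le_1 by auto
  have n: "real (?n - 1) = real ?n - 1" by (simp add: of_nat_diff)
  have "(m * \<kappa> * \<beta> * exp (- \<kappa>) * ?d powr (\<beta> - 1)) ^ (?n + 1) \<le> (m * g1 ?d) ^ (?n + 1)"
  proof (rule power_mono)
    have "m * (\<kappa> * \<beta> * exp (- \<kappa>) * ?d powr (\<beta> - 1)) \<le> m * g1 ?d"
      using m by (intro mult_left_mono g1_ge \<delta>) auto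
    then show "m * \<kappa> * \<beta> * exp (- \<kappa>) * ?d powr (\<beta> - 1) \<le> m * g1 ?d" by (simp add: ac_simps)
    show "0 \<le> m * \<kappa> * \<beta> * exp (- \<kappa>) * ?d powr (\<beta> - 1)" using m \<kappa> \<beta> by simp
  qed
  then have "(m * \<kappa> * \<beta> * exp (- \<kappa>) * ?d powr (\<beta> - 1)) ^ (?n + 1) * (?d * sqrt ?d ^ (?n - 1)) \<le> (m * g1 ?d) ^ (?n + 1) * (?d * sqrt ?d ^ (?n - 1))"
    using \<delta> by (intro mult_right_mono) auto
  moreover have "(m * \<kappa> * \<beta> * exp (- \<kappa>) * ?d powr (\<beta> - 1)) ^ (?n + 1) * (?d * sqrt ?d ^ (?n - 1))
      = (m * \<kappa> * \<beta> * exp (- \<kappa>)) ^ (?n + 1) * ?d powr (- \<alpha>)"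
  proof -
    have "(?d powr (\<beta> - 1)) ^ (?n + 1) = ?d powr ((\<beta> - 1) * (real ?n + 1))"
    proof -
      have "(?d powr (\<beta> - 1)) ^ (?n + 1) = (?d powr (\<beta> - 1)) powr real (?n + 1)"
        by (rule powr_realpow[symmetric]) (use \<delta> in simp)
      then show ?thesis by (simp add: powr_powr add.commute)
    qed
    moreover have "sqrt ?d ^ (?n - 1) = ?d powr (1/2 * (real ?n - 1))"
    proof -
      have sq: "sqrt ?d = ?d powr (1/2)" using \<delta> by (simp add: powr_half_sqrt)
      have "(?d powr (1/2)) ^ (?n - 1) = (?d powr (1/2)) powr real (?n - 1)"
        by (rule powr_realpow[symmetric]) (use \<delta> in simp)
      then show ?thesis by (simp only: sq powr_powr n)
    qed
    ultimately have "(?d powr (\<beta> - 1)) ^ (?n + 1) * (?d * sqrt ?d ^ (?n - 1))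
        = ?d powr ((\<beta> - 1) * (real ?n + 1)) * (?d powr 1 * ?d powr (1/2 * (real ?n - 1)))"
      using \<delta> by simp
    also have "\<dots> = ?d powr ((\<beta> - 1) * (real ?n + 1) + (1 + 1/2 * (real ?n - 1)))"
      by (simp only: powr_add)
    also have "(\<beta> - 1) * (real ?n + 1) + (1 + 1/2 * (real ?n - 1)) = - \<alpha>"
      unfolding al by (simp add: field_simps)
    finally show ?thesis by (simp only: power_mult_distrib mult.assoc)
  qed
  ultimately have "(m * \<kappa> * \<beta> * exp (- \<kappa>)) ^ (?n + 1) * ?d powr (- \<alpha>) \<le> (m * g1 ?d) ^ (?n + 1) * (?d * sqrt ?d ^ (?n - 1))"
    by (simp only:)
  then have "(m * \<kappa> * \<beta> * exp (- \<kappa>)) ^ (?n + 1) * ?d powr (- \<alpha>) \<le> (m * g1 ?d) ^ (?n + 1) * ?d * sqrt ?d ^ (?n - 1)"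
    by (simp only: mult.assoc)
  then show ?thesis
    unfolding plane_image_measure(1)[OF x0 m] by (intro mult_right_mono ennreal_leI) auto
qed

end

section \<open>Last contact with a plane\<close>

text \<open>Take the latest time at which \<open>v \<ge> l\<close> holds somewhere. Afterwards \<open>v < l\<close>, and by continuity \<open>v \<le> l\<close> at that time too. The side
condition keeps the contact point away from the later and the lateral boundary.\<close>

lemma last_contact:
  fixes v :: "real \<times> (real^'n) \<Rightarrow> real" and l :: "real^'n \<Rightarrow> real"
  assumes v: "continuous_on ({t0..t1} \<times> cball 0 R) v" and l: "continuous_on (cball 0 R) l"
    and x0: "x0 \<in> cball 0 R" and t: "t0 \<le> t1" and start: "l x0 < v (t0, x0)"
    and side: "\<And>t x. t \<in> {t0..t1} \<Longrightarrow> x \<in> cball 0 R \<Longrightarrow> t = t1 \<or> norm x = R \<Longrightarrow> v (t, x) < l x"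
  obtains s y where "t0 < s" "s < t1" "norm y < R" "v (s, y) = l y"
    "\<And>t x. s \<le> t \<Longrightarrow> t \<le> t1 \<Longrightarrow> x \<in> cball 0 R \<Longrightarrow> v (t, x) \<le> l x"
proof -
  let ?Q = "{t0..t1} \<times> cball 0 R :: (real \<times> (real^'n)) set"
  define Z where "Z = {z \<in> ?Q. 0 \<le> v z - l (snd z)}"
  have Q: "compact ?Q" by (intro compact_Times) auto
  have c: "continuous_on ?Q (\<lambda>z. v z - l (snd z))"
    by (intro continuous_intros v continuous_on_compose2[OF l]) auto
  have "closed (?Q \<inter> (\<lambda>z. v z - l (snd z)) -` {0..})"
    by (rule continuous_closed_preimage[OF c compact_imp_closed[OF Q]]) simp
  moreover have "?Q \<inter> (\<lambda>z. v z - l (snd z)) -` {0..} = Z" by (auto simp: Z_def)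
  ultimately have "closed Z" by simp
  moreover have "bounded Z" using compact_imp_bounded[OF Q] by (rule bounded_subset) (auto simp: Z_def)
  ultimately have Z: "compact Z" by (simp add: compact_eq_bounded_closed)
  have ne: "(t0, x0) \<in> Z" using x0 t start by (simp add: Z_def)
  have cf: "continuous_on Z fst" by (intro continuous_intros)
  obtain z where z: "z \<in> Z" "\<And>w. w \<in> Z \<Longrightarrow> fst w \<le> fst z"
    using continuous_attains_sup[OF Z _ cf] ne by blast
  define s where "s = fst z"
  define y where "y = snd z"
  have sy: "s \<in> {t0..t1}" "y \<in> cball 0 R" "l y \<le> v (s, y)" using z(1) by (auto simp: Z_def s_def y_def)
  have s1: "s < t1" using side[OF sy(1,2)] sy by (cases "s = t1") auto
  have yR: "norm y < R" using side[OF sy(1,2)] sy by (cases "norm y = R") auto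
  have after: "v (t, x) < l x" if "s < t" "t \<le> t1" "x \<in> cball 0 R" for t x
  proof (rule ccontr)
    assume "\<not> v (t, x) < l x"
    then have "(t, x) \<in> Z" using that sy by (simp add: Z_def)
    then show False using z(2)[of "(t, x)"] that by (simp add: s_def)
  qed
  have at: "v (s, x) \<le> l x" if x: "x \<in> cball 0 R" for x
  proof (rule ccontr)
    assume "\<not> v (s, x) \<le> l x"
    then have gt: "l x < v (s, x)" by simp
    have "continuous_on {t0..t1} (\<lambda>t. v (t, x))"
      by (rule continuous_on_compose2[OF v]) (use x in \<open>auto intro!: continuous_intros\<close>)
    then have "continuous (at s within {t0..t1}) (\<lambda>t. v (t, x))"
      using sy(1) by (simp add: continuous_on_eq_continuous_within)
    then have "eventually (\<lambda>t. l x < v (t, x)) (at s within {t0..t1})"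
      unfolding continuous_within using gt by (rule order_tendstoD(1))
    then obtain d where d: "d > 0" "\<And>t. t \<in> {t0..t1} \<Longrightarrow> t \<noteq> s \<Longrightarrow> dist t s < d \<Longrightarrow> l x < v (t, x)"
      unfolding eventually_at by auto
    define t where "t = min t1 (s + d / 2)"
    have "s < t" "t \<le> t1" "dist t s < d" using d(1) s1 by (auto simp: t_def dist_real_def)
    then show False using d(2)[of t] after[of t x] x sy by auto
  qed
  have "v (s, y) = l y" using at[OF sy(2)] sy(3) by simp
  moreover have "t0 < s"
  proof (rule ccontr)
    assume "\<not> t0 < s"
    then have "s = t0" using sy by simp
    then show False using at[OF x0] start by simp
  qed
  moreover have "v (t, x) \<le> l x" if "s \<le> t" "t \<le> t1" "x \<in> cball 0 R" for t x
    using after[of t x] at[of x] that by (cases "t = s") (auto intro: less_imp_le)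
  ultimately show ?thesis using that[of s y] s1 yR by blast
qed

text \<open>The conditions of first and second order at a maximum over \<open>t \<ge> s\<close>. In time the maximum is
one-sided, hence only the sign of the time derivative. For the Hessian, a positive second derivative along a
line would make the function strictly increasing on one side of the contact point.\<close>

lemma contact_derivatives:
  fixes v vt :: "real \<times> (real^'n) \<Rightarrow> real" and p pt :: "real \<times> (real^'n) \<Rightarrow> real^'n"
    and H :: "real \<times> (real^'n) \<Rightarrow> real^'n^'n" and q :: "real^'n"
  assumes dv: "\<And>z. norm (snd z) < R \<Longrightarrow> (v has_derivative (\<lambda>h. vt z * fst h + p z \<bullet> snd h)) (at z)"
    and dp: "(p has_derivative (\<lambda>h. fst h *\<^sub>R pt (s, y) + H (s, y) *v snd h)) (at (s, y))"
    and sy: "s < t1" "norm y < R"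
    and le: "\<And>t x. s \<le> t \<Longrightarrow> t \<le> t1 \<Longrightarrow> norm x < R \<Longrightarrow> v (t, x) \<le> v (s, y) + q \<bullet> (x - y)"
  shows "p (s, y) = q" and "vt (s, y) \<le> 0" and "\<And>\<xi>. \<xi> \<bullet> (H (s, y) *v \<xi>) \<le> 0"
proof -
  have dx: "((\<lambda>\<tau>. (t, x + \<tau> *\<^sub>R \<xi>)) has_derivative (\<lambda>h. (0, h *\<^sub>R \<xi>))) (at \<tau>)" for t x \<tau> and \<xi> :: "real^'n"
    by (auto intro!: derivative_eq_intros)
  have line: "((\<lambda>\<tau>. v (s, y + \<tau> *\<^sub>R \<xi>) - \<tau> * (q \<bullet> \<xi>)) has_real_derivative (p (s, y + \<tau> *\<^sub>R \<xi>) \<bullet> \<xi> - q \<bullet> \<xi>)) (at \<tau>)"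
    if "norm (y + \<tau> *\<^sub>R \<xi>) < R" for \<xi> \<tau>
  proof -
    have "((\<lambda>\<tau>. v (s, y + \<tau> *\<^sub>R \<xi>)) has_derivative (\<lambda>h. vt (s, y + \<tau> *\<^sub>R \<xi>) * fst (0, h *\<^sub>R \<xi>) + p (s, y + \<tau> *\<^sub>R \<xi>) \<bullet> snd (0 :: real, h *\<^sub>R \<xi>))) (at \<tau>)"
      by (rule has_derivative_compose[OF dx dv]) (use that in simp)
    then have "((\<lambda>\<tau>. v (s, y + \<tau> *\<^sub>R \<xi>)) has_real_derivative (p (s, y + \<tau> *\<^sub>R \<xi>) \<bullet> \<xi>)) (at \<tau>)"
      by (simp add: has_field_derivative_def mult.commute[of _ "p _ \<bullet> \<xi>"])
    then show ?thesis by (rule DERIV_diff) (auto intro!: derivative_eq_intros)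
  qed
  have small: "\<exists>d>0. \<forall>\<tau>. \<bar>\<tau>\<bar> < d \<longrightarrow> norm (y + \<tau> *\<^sub>R \<xi>) < R" for \<xi>
  proof -
    have p: "0 < (R - norm y) / (norm \<xi> + 1)" using sy by (simp add: add_nonneg_pos)
    have "norm (y + \<tau> *\<^sub>R \<xi>) < R" if t: "\<bar>\<tau>\<bar> < (R - norm y) / (norm \<xi> + 1)" for \<tau>
    proof -
      have "\<bar>\<tau>\<bar> * (norm \<xi> + 1) < R - norm y" using t by (simp add: pos_less_divide_eq add_nonneg_pos)
      then have "\<bar>\<tau>\<bar> * norm \<xi> < R - norm y" by (simp add: algebra_simps)
      then show ?thesis using norm_triangle_ineq[of y "\<tau> *\<^sub>R \<xi>"] by simp
    qed
    then show ?thesis using p by blast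
  qed
  have below: "v (s, y + \<tau> *\<^sub>R \<xi>) - \<tau> * (q \<bullet> \<xi>) \<le> v (s, y)" if "norm (y + \<tau> *\<^sub>R \<xi>) < R" for \<tau> \<xi>
    using le[of s "y + \<tau> *\<^sub>R \<xi>"] sy that by simp
  have crit: "(p (s, y) - q) \<bullet> \<xi> = 0" for \<xi>
  proof -
    obtain d where d: "d > 0" "\<And>\<tau>. \<bar>\<tau>\<bar> < d \<Longrightarrow> norm (y + \<tau> *\<^sub>R \<xi>) < R" using small by blast
    have "((\<lambda>\<tau>. v (s, y + \<tau> *\<^sub>R \<xi>) - \<tau> * (q \<bullet> \<xi>)) has_real_derivative (p (s, y) \<bullet> \<xi> - q \<bullet> \<xi>)) (at 0)"
      using line[of 0 \<xi>] sy by simp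
    from DERIV_local_max[OF this d(1)] have "p (s, y) \<bullet> \<xi> - q \<bullet> \<xi> = 0"
      using below[of _ \<xi>] d(2) by simp
    then show ?thesis by (simp add: inner_diff_left)
  qed
  from crit[of "p (s, y) - q"] show pq: "p (s, y) = q" by simp
  have dt': "((\<lambda>t. v (t, y)) has_real_derivative vt (s, y)) (at s)"
  proof -
    have 1: "((\<lambda>t. (t, y)) has_derivative (\<lambda>h. (h, 0))) (at s)" by (auto intro!: derivative_eq_intros)
    have "((\<lambda>t. v (t, y)) has_derivative (\<lambda>h. vt (s, y) * fst (h, 0 :: real^'n) + p (s, y) \<bullet> snd (h, 0 :: real^'n))) (at s)"
      by (rule has_derivative_compose[OF 1 dv]) (use sy in simp)
    then show ?thesis by (simp add: has_field_derivative_def)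
  qed
  show "vt (s, y) \<le> 0"
  proof (rule ccontr)
    assume "\<not> vt (s, y) \<le> 0"
    then obtain d where d: "d > 0" "\<And>h. 0 < h \<Longrightarrow> h < d \<Longrightarrow> v (s, y) < v (s + h, y)"
      using DERIV_pos_inc_right[OF dt'] by auto
    define h where "h = min (d / 2) (t1 - s)"
    have "0 < h" "h < d" "s + h \<le> t1" using d(1) sy by (auto simp: h_def)
    then show False using d(2)[of h] le[of "s + h" y] sy by simp
  qed
  fix \<xi>
  show "\<xi> \<bullet> (H (s, y) *v \<xi>) \<le> 0"
  proof (rule ccontr)
    assume "\<not> \<xi> \<bullet> (H (s, y) *v \<xi>) \<le> 0"
    then have pos: "0 < \<xi> \<bullet> (H (s, y) *v \<xi>)" by simp
    obtain d where d: "d > 0" "\<And>\<tau>. \<bar>\<tau>\<bar> < d \<Longrightarrow> norm (y + \<tau> *\<^sub>R \<xi>) < R" using small by blast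
    have "((\<lambda>\<tau>. p (s, y + \<tau> *\<^sub>R \<xi>)) has_derivative (\<lambda>h. fst (0, h *\<^sub>R \<xi>) *\<^sub>R pt (s, y) + H (s, y) *v snd (0 :: real, h *\<^sub>R \<xi>))) (at 0)"
      by (rule has_derivative_compose[OF dx]) (use dp in simp)
    then have "((\<lambda>\<tau>. p (s, y + \<tau> *\<^sub>R \<xi>) \<bullet> \<xi>) has_derivative (\<lambda>h. (H (s, y) *v (h *\<^sub>R \<xi>)) \<bullet> \<xi>)) (at 0)"
      by (intro has_derivative_inner_left) simp
    then have "((\<lambda>\<tau>. p (s, y + \<tau> *\<^sub>R \<xi>) \<bullet> \<xi>) has_real_derivative (\<xi> \<bullet> (H (s, y) *v \<xi>))) (at 0)"
      by (simp add: has_field_derivative_def matrix_vector_mult_scaleR inner_commute mult.commute[of _ "\<xi> \<bullet> _"])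
    from DERIV_pos_inc_right[OF this pos]
    obtain d2 where d2: "d2 > 0" "\<And>h. 0 < h \<Longrightarrow> h < d2 \<Longrightarrow> q \<bullet> \<xi> < p (s, y + h *\<^sub>R \<xi>) \<bullet> \<xi>"
      using pq by auto
    define b where "b = min d d2 / 2"
    have b: "0 < b" "b < d" "b < d2" using d(1) d2(1) by (auto simp: b_def)
    let ?f = "\<lambda>\<tau>. v (s, y + \<tau> *\<^sub>R \<xi>) - \<tau> * (q \<bullet> \<xi>)"
    have der: "(?f has_real_derivative (p (s, y + \<tau> *\<^sub>R \<xi>) \<bullet> \<xi> - q \<bullet> \<xi>)) (at \<tau>)" if "0 \<le> \<tau>" "\<tau> \<le> b" for \<tau>
      by (rule line) (use d(2)[of \<tau>] that b in simp)
    have "?f 0 < ?f b"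
    proof (rule DERIV_pos_imp_increasing_open[OF b(1)])
      fix \<tau> assume "0 < \<tau>" "\<tau> < b"
      then show "\<exists>y'. (?f has_real_derivative y') (at \<tau>) \<and> 0 < y'"
        using der[of \<tau>] d2(2)[of \<tau>] b by (intro exI[of _ "p (s, y + \<tau> *\<^sub>R \<xi>) \<bullet> \<xi> - q \<bullet> \<xi>"]) auto
    next
      show "continuous_on {0..b} ?f"
        by (rule DERIV_continuous_on[of _ _ "\<lambda>\<tau>. p (s, y + \<tau> *\<^sub>R \<xi>) \<bullet> \<xi> - q \<bullet> \<xi>"])
           (use der in \<open>auto intro: has_field_derivative_at_within\<close>)
    qed
    then show False using below[of b \<xi>] d(2)[of b] b by simp
  qed
qed

section \<open>Contact sets of the mollified functions\<close>

lemma sum_Basis_pair: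
  "(\<Sum>b\<in>Basis. f (b :: real \<times> (real^'n))) = f dt + (\<Sum>i\<in>UNIV. f (dx i))"
proof -
  have B: "(Basis :: (real \<times> (real^'n)) set) = insert (1, 0) ((\<lambda>i. (0, axis i 1)) ` UNIV)"
    by (auto simp: Basis_prod_def Basis_vec_def)
  have inj: "inj (\<lambda>i::'n. (0::real, axis i (1::real)))" by (auto simp: inj_def axis_eq_axis)
  show ?thesis unfolding B dt_def dx_def by (subst sum.insert) (auto simp: sum.reindex[OF inj])
qed

lemma inner_dt: "h \<bullet> dt = fst h"
  by (cases h) (simp add: dt_def)

lemma inner_dx: "h \<bullet> dx i = snd h $ i"
  by (cases h) (simp add: dx_def inner_axis)

lemma mder_has_derivative_pair:
  fixes u :: "real \<times> (real^'n) \<Rightarrow> real"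
  assumes "continuous_on (cbox A B) u"
  shows "(mder A B u k es has_derivative (\<lambda>h. fst h * mder A B u k (es @ [dt]) z
    + (\<Sum>i\<in>UNIV. snd h $ i * mder A B u k (es @ [dx i]) z))) (at z)"
  using mder_has_derivative[OF assms, of k es z] unfolding sum_Basis_pair inner_dt inner_dx .

lemma has_derivative_vec_lambda:
  fixes f :: "'i::finite \<Rightarrow> 'a::real_normed_vector \<Rightarrow> real"
  assumes "\<And>i. (f i has_derivative f' i) (at z)"
  shows "((\<lambda>z. \<chi> i. f i z) has_derivative (\<lambda>h. \<chi> i. f' i h)) (at z)"
proof (rule has_derivative_componentwise_within[THEN iffD2], intro ballI)
  fix b :: "real^'i" assume "b \<in> Basis"
  then obtain i where "b = axis i 1" by (auto simp: Basis_vec_def)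
  then show "((\<lambda>z. (\<chi> i. f i z) \<bullet> b) has_derivative (\<lambda>h. (\<chi> i. f' i h) \<bullet> b)) (at z)"
    using assms[of i] by (simp add: inner_axis)
qed

lemma continuous_on_det:
  fixes F :: "'a::topological_space \<Rightarrow> real^'n^'n"
  assumes "\<And>i j. continuous_on S (\<lambda>z. F z $ i $ j)"
  shows "continuous_on S (\<lambda>z. det (F z))"
  unfolding det_def by (intro continuous_on_sum continuous_on_mult continuous_on_prod continuous_on_const assms)

lemma tendsto_det:
  fixes F :: "'a \<Rightarrow> real^'n^'n"
  assumes "\<And>i j. ((\<lambda>k. F k $ i $ j) \<longlongrightarrow> A $ i $ j) G"
  shows "((\<lambda>k. det (F k)) \<longlongrightarrow> det A) G"
  unfolding det_def by (intro tendsto_sum tendsto_mult tendsto_prod tendsto_const assms)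

lemma measurable_det:
  fixes F :: "'a \<Rightarrow> real^'n^'n"
  assumes "\<And>i j. (\<lambda>z. F z $ i $ j) \<in> borel_measurable M"
  shows "(\<lambda>z. det (F z)) \<in> borel_measurable M"
  unfolding det_def
  by (intro borel_measurable_sum borel_measurable_times borel_measurable_prod borel_measurable_const assms)

context barrier
begin

lemma continuous_on_psi: "continuous_on S psi"
  unfolding psi_def[abs_def] by (intro continuous_intros)

lemma continuous_on_\<theta>: "continuous_on (ball 0 1) \<theta>"
  by (rule has_derivative_continuous_on, rule has_derivative_at_withinI, rule \<theta>_has_derivative)

lemma continuous_on_grad_\<theta>: "continuous_on (ball 0 1) grad_\<theta>"
  by (rule has_derivative_continuous_on, rule has_derivative_at_withinI, rule grad_\<theta>_has_derivative)

lemma continuous_on_hess_\<theta>: "continuous_on (ball 0 1) (\<lambda>x. hess_\<theta> x $ i $ j)"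
proof -
  have 1: "continuous_on (ball 0 1) (\<lambda>x. g1 (psi x))"
    by (rule continuous_on_compose2[OF g1_continuous continuous_on_psi]) (use psi_pos in auto)
  have 2: "continuous_on (ball 0 1) (\<lambda>x. g2 (psi x))"
    by (rule continuous_on_compose2[OF g2_continuous continuous_on_psi]) (use psi_pos in auto)
  have "continuous_on (ball 0 1) (\<lambda>x. 4 * g2 (psi x) * (x $ i * x $ j) - (if i = j then 2 * g1 (psi x) else 0))"
    by (cases "i = j") (auto intro!: continuous_on_diff continuous_on_mult continuous_on_const 1 2 continuous_on_component continuous_on_id)
  then show ?thesis by (simp add: hess_\<theta>_def)
qed

lemma \<theta>_nonneg: "0 \<le> \<theta> x" by (simp add: \<theta>_def g_nonneg)

end

text \<open>The smooth competitors \<open>v = u\<^sub>k - m - L \<theta>\<close> for the mollifications \<open>u\<^sub>k\<close> of a continuous function \<open>u\<close>.\<close>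

locale approximant = barrier \<kappa> \<beta> for \<kappa> \<beta> +
  fixes A B :: "real \<times> (real^'n)" and u :: "real \<times> (real^'n) \<Rightarrow> real" and m L :: real
  assumes u: "continuous_on (cbox A B) u"
begin

text \<open>The function \<open>v\<close> followed by its time derivative, its gradient in space, its Hessian in space and the time
derivative of its gradient.\<close>

definition va :: "nat \<Rightarrow> real \<times> (real^'n) \<Rightarrow> real" where
  "va k z = mder A B u k [] z - m - L * \<theta> (snd z)"
definition vt :: "nat \<Rightarrow> real \<times> (real^'n) \<Rightarrow> real" where
  "vt k z = mder A B u k [dt] z"
definition pa :: "nat \<Rightarrow> real \<times> (real^'n) \<Rightarrow> real^'n" where
  "pa k z = (\<chi> i. mder A B u k [dx i] z) - L *\<^sub>R grad_\<theta> (snd z)"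
definition Ha :: "nat \<Rightarrow> real \<times> (real^'n) \<Rightarrow> real^'n^'n" where
  "Ha k z = (\<chi> i j. mder A B u k [dx i, dx j] z) - L *\<^sub>R hess_\<theta> (snd z)"
definition pta :: "nat \<Rightarrow> real \<times> (real^'n) \<Rightarrow> real^'n" where
  "pta k z = (\<chi> i. mder A B u k [dx i, dt] z)"

lemma va_has_derivative:
  assumes z: "norm (snd z) < 1"
  shows "(va k has_derivative (\<lambda>h. vt k z * fst h + pa k z \<bullet> snd h)) (at z)"
proof -
  have s: "(snd has_derivative snd) (at z)" by (rule has_derivative_snd[OF has_derivative_ident])
  have t: "((\<lambda>z. \<theta> (snd z)) has_derivative (\<lambda>h. grad_\<theta> (snd z) \<bullet> snd h)) (at z)"
    by (rule has_derivative_compose[OF s \<theta>_has_derivative]) (use z in simp)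
  have "(va k has_derivative (\<lambda>h. (fst h * mder A B u k ([] @ [dt]) z
    + (\<Sum>i\<in>UNIV. snd h $ i * mder A B u k ([] @ [dx i]) z)) - 0 - L * (grad_\<theta> (snd z) \<bullet> snd h))) (at z)"
    unfolding va_def[abs_def]
    by (intro has_derivative_diff has_derivative_mult_right t has_derivative_const mder_has_derivative_pair u)
  then show ?thesis
    by (simp add: vt_def pa_def inner_diff_left inner_vec_def[of "vec_lambda _"] mult.commute add_diff_eq)
qed

lemma pa_has_derivative:
  assumes z: "norm (snd z) < 1"
  shows "(pa k has_derivative (\<lambda>h. fst h *\<^sub>R pta k z + Ha k z *v snd h)) (at z)"
proof -
  have s: "(snd has_derivative snd) (at z)" by (rule has_derivative_snd[OF has_derivative_ident])
  have t: "((\<lambda>z. grad_\<theta> (snd z)) has_derivative (\<lambda>h. hess_\<theta> (snd z) *v snd h)) (at z)"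
    by (rule has_derivative_compose[OF s grad_\<theta>_has_derivative]) (use z in simp)
  have "(pa k has_derivative (\<lambda>h. (\<chi> i. fst h * mder A B u k ([dx i] @ [dt]) z
    + (\<Sum>j\<in>UNIV. snd h $ j * mder A B u k ([dx i] @ [dx j]) z)) - L *\<^sub>R (hess_\<theta> (snd z) *v snd h))) (at z)"
    unfolding pa_def[abs_def]
    by (intro has_derivative_diff has_derivative_scaleR_right t has_derivative_vec_lambda mder_has_derivative_pair u)
  moreover have "(\<chi> i. fst h * mder A B u k ([dx i] @ [dt]) z
    + (\<Sum>j\<in>UNIV. snd h $ j * mder A B u k ([dx i] @ [dx j]) z)) - L *\<^sub>R (hess_\<theta> (snd z) *v snd h)
    = fst h *\<^sub>R pta k z + Ha k z *v snd h" for h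
    by (simp add: vec_eq_iff pta_def Ha_def matrix_vector_mult_def left_diff_distrib right_diff_distrib sum_subtractf sum_distrib_left ac_simps)
  ultimately show ?thesis by simp
qed

lemma Ha_symmetric: "transpose (Ha k z) = Ha k z"
  using mder_commute[of A B u k]
  by (simp add: vec_eq_iff transpose_def Ha_def hess_\<theta>_def mult.commute eq_commute)

lemma continuous_on_snd_ball: "S \<subseteq> UNIV \<times> ball 0 1 \<Longrightarrow> continuous_on (ball 0 1) f \<Longrightarrow> continuous_on S (\<lambda>z. f (snd z))"
  by (rule continuous_on_compose2[OF _ continuous_on_snd[OF continuous_on_id]]) auto

lemma continuous_on_va: "S \<subseteq> UNIV \<times> ball 0 1 \<Longrightarrow> continuous_on S (va k)"
  unfolding va_def[abs_def]
  by (intro continuous_on_diff continuous_on_mult continuous_on_const mder_continuous[OF u] continuous_on_snd_ball continuous_on_\<theta>)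

lemma continuous_on_vt: "continuous_on S (vt k)"
  unfolding vt_def[abs_def] by (rule mder_continuous[OF u])

lemma continuous_on_pa: "S \<subseteq> UNIV \<times> ball 0 1 \<Longrightarrow> continuous_on S (pa k)"
  unfolding pa_def[abs_def]
  by (intro continuous_on_diff continuous_on_scaleR continuous_on_const continuous_on_vec_lambda mder_continuous[OF u] continuous_on_snd_ball continuous_on_grad_\<theta>)

lemma continuous_on_Ha: "S \<subseteq> UNIV \<times> ball 0 1 \<Longrightarrow> continuous_on S (\<lambda>z. Ha k z $ i $ j)"
  unfolding Ha_def
  by (simp, intro continuous_on_diff continuous_on_mult continuous_on_const mder_continuous[OF u] continuous_on_snd_ball continuous_on_hess_\<theta>)

text \<open>A closed set containing the contact points. Contact itself is replaced by its pointwise consequences, all of them closed conditions on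
the function and its derivatives, which therefore survive the passage to the limit.\<close>

definition contact_set :: "(real \<times> (real^'n)) set \<Rightarrow> real^'n \<Rightarrow> real \<Rightarrow> nat \<Rightarrow> (real \<times> (real^'n)) set" where
  "contact_set Q x0 c k = {z \<in> Q. psi x0 / 4 \<le> psi (snd z) \<and> psi (snd z) \<le> 4 * psi x0 \<and>
     0 \<le> mder A B u k [] z - m \<and> vt k z \<le> 0 \<and> norm (pa k z) \<le> c \<and> (\<forall>\<xi>. \<xi> \<bullet> (Ha k z *v \<xi>) \<le> 0)}"

lemma closed_contact_set:
  assumes Q: "compact Q" "Q \<subseteq> UNIV \<times> ball 0 1"
  shows "closed (contact_set Q x0 c k)"
proof -
  have cQ: "closed Q" using Q(1) by (rule compact_imp_closed)
  have 1: "closed {z \<in> Q. psi x0 / 4 \<le> psi (snd z)}" "closed {z \<in> Q. psi (snd z) \<le> 4 * psi x0}"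
    by (intro continuous_on_closed_Collect_le cQ continuous_on_const continuous_on_snd_ball Q continuous_on_psi)+
  have 2: "closed {z \<in> Q. 0 \<le> mder A B u k [] z - m}" "closed {z \<in> Q. vt k z \<le> 0}" "closed {z \<in> Q. norm (pa k z) \<le> c}"
    by (intro continuous_on_closed_Collect_le cQ continuous_on_const continuous_on_diff mder_continuous[OF u] continuous_on_vt
      continuous_on_norm continuous_on_pa Q)+
  have q: "continuous_on Q (\<lambda>z. \<xi> \<bullet> (Ha k z *v \<xi>))" for \<xi>
    unfolding inner_vec_def matrix_vector_mult_def inner_real_def vec_lambda_beta
    by (intro continuous_on_sum continuous_on_mult continuous_on_const continuous_on_Ha Q)
  have 3: "closed {z \<in> Q. \<xi> \<bullet> (Ha k z *v \<xi>) \<le> 0}" for \<xi>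
    by (intro continuous_on_closed_Collect_le cQ continuous_on_const q)
  have "contact_set Q x0 c k = {z \<in> Q. psi x0 / 4 \<le> psi (snd z)} \<inter> {z \<in> Q. psi (snd z) \<le> 4 * psi x0} \<inter>
    {z \<in> Q. 0 \<le> mder A B u k [] z - m} \<inter> {z \<in> Q. vt k z \<le> 0} \<inter> {z \<in> Q. norm (pa k z) \<le> c} \<inter> (\<Inter>\<xi>. {z \<in> Q. \<xi> \<bullet> (Ha k z *v \<xi>) \<le> 0})"
    by (auto simp: contact_set_def)
  then show ?thesis using 1 2 3 by (simp only:) (intro closed_Int closed_INT ballI; simp)
qed

lemma contact_set_measurable:
  assumes Q: "compact Q" "Q \<subseteq> UNIV \<times> ball 0 1"
  shows "(\<lambda>z. indicator (contact_set Q x0 c k) z * \<bar>vt k z * det (Ha k z)\<bar>) \<in> borel_measurable borel"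
proof -
  have sub: "contact_set Q x0 c k \<subseteq> UNIV \<times> ball 0 1" using Q by (auto simp: contact_set_def)
  have "(\<lambda>z. indicator (contact_set Q x0 c k) z *\<^sub>R \<bar>vt k z * det (Ha k z)\<bar>) \<in> borel_measurable borel"
    by (intro borel_measurable_continuous_on_indicator borel_closed closed_contact_set Q continuous_on_rabs continuous_on_mult
        continuous_on_vt continuous_on_det continuous_on_Ha sub)
  then show ?thesis by simp
qed

text \<open>Each plane in \<open>plane_image\<close> has a last contact point with \<open>v\<close>, the Legendre map sends this point to the plane, and
localization puts the point into \<open>contact_set\<close>. The tolerance \<open>E\<close> is the error of the approximation on either side: it is lost once in
\<open>v \<le> \<epsilon> M \<theta> + E\<close> and twice at the starting point, and the minimal lowering \<open>\<tau> \<ge> 1/256\<close> of the planes amounts to \<open>2 E\<close>.\<close>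

lemma contact_set_estimate:
  assumes x0: "norm x0 < R" and R: "R < 1" and t: "t0 < t1" and \<epsilon>: "0 < \<epsilon>" "\<epsilon> \<le> 1" and M: "0 < M"
    and L: "L = (1 - \<epsilon>) * M"
    and up: "\<And>z. z \<in> {t0..t1} \<times> cball 0 R \<Longrightarrow> mder A B u k [] z - m \<le> M * \<theta> (snd z) + E"
    and side: "\<And>t x. t \<in> {t0..t1} \<Longrightarrow> x \<in> cball 0 R \<Longrightarrow> t = t1 \<or> norm x = R \<Longrightarrow> mder A B u k [] (t, x) - m < 0"
    and start: "M * \<theta> x0 - 2 * E < mder A B u k [] (t0, x0) - m"
    and E: "E = \<epsilon> * M / 512 * (psi x0 * g1 (psi x0))"
  shows "emeasure lborel (plane_image (\<epsilon> * M) x0)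
    \<le> (\<integral>\<^sup>+z. ennreal (indicator (contact_set ({t0..t1} \<times> cball 0 R) x0 (4 * (\<epsilon> * M) * g1 (psi x0)) k) z * \<bar>vt k z * det (Ha k z)\<bar>) \<partial>lborel)"
proof -
  let ?Q = "{t0..t1} \<times> cball 0 R :: (real \<times> (real^'n)) set"
  let ?G = "contact_set ?Q x0 (4 * (\<epsilon> * M) * g1 (psi x0)) k"
  have Q: "compact ?Q" "?Q \<subseteq> UNIV \<times> ball 0 1" using R by (auto intro: compact_Times)
  have x0b: "x0 \<in> ball 0 1" using x0 R by simp
  have \<delta>: "0 < psi x0" "0 < g1 (psi x0)" using psi_pos[OF x0b] g1_pos by auto
  have eM: "0 < \<epsilon> * M" using \<epsilon> M by simp
  have L0: "0 \<le> L" using \<epsilon> M L by simp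
  show ?thesis
  proof (rule emeasure_legendre_image_le[where v="va k" and p="pa k" and pt="pta k"])
    show "?G \<in> sets borel" using closed_contact_set[OF Q] by (rule borel_closed)
    show "plane_image (\<epsilon> * M) x0 \<in> sets borel" by (rule plane_image_measure(2)[OF x0b eM])
    show "(va k has_derivative (\<lambda>h. vt k z * fst h + pa k z \<bullet> snd h)) (at z)" if "z \<in> ?G" for z
      by (rule va_has_derivative) (use that Q in \<open>auto simp: contact_set_def\<close>)
    show "(pa k has_derivative (\<lambda>h. fst h *\<^sub>R pta k z + Ha k z *v snd h)) (at z)" if "z \<in> ?G" for z
      by (rule pa_has_derivative) (use that Q in \<open>auto simp: contact_set_def\<close>)
    show "(\<lambda>z. indicator ?G z * \<bar>vt k z * det (Ha k z)\<bar>) \<in> borel_measurable borel"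
      by (rule contact_set_measurable[OF Q])
    show "plane_image (\<epsilon> * M) x0 \<subseteq> (\<lambda>z. (va k z - pa k z \<bullet> (snd z - x0), pa k z)) ` ?G"
    proof
      fix hq assume "hq \<in> plane_image (\<epsilon> * M) x0"
      then obtain \<tau> \<omega> where tw: "1/256 \<le> \<tau>" "\<tau> \<le> 2/256" "norm \<omega> \<le> 1/256"
        and hq: "hq = (\<epsilon> * M * plane x0 \<tau> \<omega> x0, (\<epsilon> * M) *\<^sub>R (g1 (psi x0) *\<^sub>R (slope x0 \<omega> - 2 *\<^sub>R x0)))"
        unfolding plane_image_def plane_params_def by auto
      define q where "q = (\<epsilon> * M) *\<^sub>R (g1 (psi x0) *\<^sub>R (slope x0 \<omega> - 2 *\<^sub>R x0))"
      define l where "l x = \<epsilon> * M * plane x0 \<tau> \<omega> x" for x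
      have l: "l x = \<epsilon> * M * plane x0 \<tau> \<omega> x0 + q \<bullet> (x - x0)" for x
        unfolding l_def q_def plane_def by (simp add: distrib_left)
      have lp: "0 < l x" if "norm x \<le> 1" for x
        unfolding l_def using plane_pos[OF that x0b tw(3) _ tw(2)] tw(1) eM by simp
      obtain s y where sy: "t0 < s" "s < t1" "norm y < R" "va k (s, y) = l y"
        "\<And>t x. s \<le> t \<Longrightarrow> t \<le> t1 \<Longrightarrow> x \<in> cball 0 R \<Longrightarrow> va k (t, x) \<le> l x"
      proof (rule last_contact[of t0 t1 R "va k" l x0])
        show "continuous_on ?Q (va k)" by (rule continuous_on_va[OF Q(2)])
        show "continuous_on (cball 0 R) l" unfolding l
          by (intro continuous_on_add continuous_on_const continuous_on_inner continuous_on_diff continuous_on_id)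
        show "x0 \<in> cball 0 R" using x0 by simp
        show "t0 \<le> t1" using t by simp
        have "\<epsilon> * M * (psi x0 * g1 (psi x0)) * (1/256) \<le> \<epsilon> * M * (psi x0 * g1 (psi x0)) * \<tau>"
          using tw eM \<delta> by (intro mult_left_mono) auto
        moreover have "2 * E = \<epsilon> * M * (psi x0 * g1 (psi x0)) * (1/256)" unfolding E by simp
        moreover have "\<epsilon> * M * (\<tau> * (psi x0 * g1 (psi x0))) = \<epsilon> * M * (psi x0 * g1 (psi x0)) * \<tau>" by simp
        ultimately have "2 * E \<le> \<epsilon> * M * (\<tau> * (psi x0 * g1 (psi x0)))" by linarith
        moreover have "l x0 = \<epsilon> * M * \<theta> x0 - \<epsilon> * M * (\<tau> * (psi x0 * g1 (psi x0)))"
          unfolding l_def plane_def \<theta>_def by (simp add: right_diff_distrib)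
        moreover have "va k (t0, x0) = mder A B u k [] (t0, x0) - m - M * \<theta> x0 + \<epsilon> * M * \<theta> x0"
        proof -
          have "L * \<theta> x0 = M * \<theta> x0 - \<epsilon> * M * \<theta> x0" by (simp add: L algebra_simps)
          then show ?thesis by (simp add: va_def)
        qed
        ultimately show "l x0 < va k (t0, x0)" using start by linarith
        show "va k (t, x) < l x" if "t \<in> {t0..t1}" "x \<in> cball 0 R" "t = t1 \<or> norm x = R" for t x
        proof -
          have "0 \<le> L * \<theta> x" by (intro mult_nonneg_nonneg L0 \<theta>_nonneg)
          then have "va k (t, x) < 0" using side[OF that] by (simp add: va_def)
          then show ?thesis using lp[of x] that(2) R by simp
        qed
      qed blast
      have pd: "(pa k has_derivative (\<lambda>h. fst h *\<^sub>R pta k (s, y) + Ha k (s, y) *v snd h)) (at (s, y))"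
        by (rule pa_has_derivative) (use sy R in simp)
      have vd: "(va k has_derivative (\<lambda>h. vt k z * fst h + pa k z \<bullet> snd h)) (at z)" if "norm (snd z) < R" for z
        by (rule va_has_derivative) (use that R in simp)
      have le: "va k (t, x) \<le> va k (s, y) + q \<bullet> (x - y)" if "s \<le> t" "t \<le> t1" "norm x < R" for t x
        using sy(5)[of t x] that unfolding sy(4) l by (simp add: inner_diff_right)
      have cd: "pa k (s, y) = q" "vt k (s, y) \<le> 0" "\<And>\<xi>. \<xi> \<bullet> (Ha k (s, y) *v \<xi>) \<le> 0"
        using contact_derivatives[where v="va k" and vt="vt k" and p="pa k" and pt="pta k" and H="Ha k" and q=q
            and R=R and s=s and y=y ] vd pd sy(2,3) le by blast+
      have inQ: "(s, y) \<in> ?Q" using sy by simp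
      have yb: "y \<in> ball 0 1" using sy R by simp
      have "\<epsilon> * M * plane x0 \<tau> \<omega> y \<le> \<epsilon> * M * (g (psi y) + 1/512 * (psi x0 * g1 (psi x0)))"
      proof -
        have "\<epsilon> * M * plane x0 \<tau> \<omega> y = mder A B u k [] (s, y) - m - L * \<theta> y"
          using sy(4) by (simp add: l_def va_def)
        also have "\<dots> \<le> M * \<theta> y + E - L * \<theta> y" using up[OF inQ] by simp
        also have "\<dots> = \<epsilon> * M * \<theta> y + E" by (simp add: L algebra_simps)
        also have "\<dots> = \<epsilon> * M * (g (psi y) + 1/512 * (psi x0 * g1 (psi x0)))"
          by (simp add: E \<theta>_def algebra_simps)
        finally show ?thesis .
      qed
      then have "plane x0 \<tau> \<omega> y \<le> g (psi y) + 1/512 * (psi x0 * g1 (psi x0))"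
        using eM by (simp only: mult_le_cancel_left_pos)
      note loc = plane_contact_localized[OF yb x0b tw(3) _ tw(2) this]
      have "0 \<le> L * \<theta> y" by (intro mult_nonneg_nonneg L0 \<theta>_nonneg)
      then have "0 \<le> mder A B u k [] (s, y) - m"
        using sy(4) lp[of y] yb unfolding va_def by simp
      moreover have "norm (pa k (s, y)) \<le> 4 * (\<epsilon> * M) * g1 (psi x0)"
      proof -
        have "norm (slope x0 \<omega> - 2 *\<^sub>R x0) \<le> norm (slope x0 \<omega>) + norm (2 *\<^sub>R x0)" by (rule norm_triangle_ineq4)
        also have "\<dots> \<le> 4" using norm_slope_le[OF x0b tw(3)] x0b by simp
        finally have "\<epsilon> * M * (g1 (psi x0) * norm (slope x0 \<omega> - 2 *\<^sub>R x0)) \<le> \<epsilon> * M * (g1 (psi x0) * 4)"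
          using eM \<delta> by (intro mult_left_mono) auto
        then show ?thesis unfolding cd(1) q_def using eM \<delta> \<epsilon> M by (simp add: abs_mult ac_simps)
      qed
      ultimately have "(s, y) \<in> ?G"
        using inQ loc tw(1) cd(2,3) by (simp add: contact_set_def)
      moreover have "hq = (va k (s, y) - pa k (s, y) \<bullet> (snd (s, y) - x0), pa k (s, y))"
        unfolding cd(1) sy(4) l hq q_def[symmetric] by simp
      ultimately show "hq \<in> (\<lambda>z. (va k z - pa k z \<bullet> (snd z - x0), pa k z)) ` ?G" by blast
    qed
  qed
qed

end

section \<open>Passage to the limit in the contact sets\<close>

lemma interior_cyl: "interior (cyl T) = {0<..<T} \<times> ball 0 1"
  by (simp add: cyl_def interior_Times)

lemma closure_cyl: "0 < T \<Longrightarrow> closure (cyl T) = {0..T} \<times> cball 0 1"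
  by (simp add: cyl_def closure_Times)

lemma weak_deriv_cong:
  assumes "weak_deriv \<Omega> es u v" and eq: "\<And>z. z \<in> \<Omega> \<Longrightarrow> u z = u' z"
  shows "weak_deriv \<Omega> es u' v"
proof -
  have i: "indicator S z *\<^sub>R u z = indicator S z *\<^sub>R u' z" if "S \<subseteq> \<Omega>" for S z
    using eq that by (cases "z \<in> S") auto
  have "locally_integrable \<Omega> u'"
    using assms(1) unfolding weak_deriv_def locally_integrable_def set_integrable_def
    by (metis (no_types, lifting) ext i)
  moreover have "(LINT z:\<Omega>|lebesgue. u z * f z) = (LINT z:\<Omega>|lebesgue. u' z * f z)" for f
  proof -
    have "indicator \<Omega> z *\<^sub>R (u z * f z) = indicator \<Omega> z *\<^sub>R (u' z * f z)" for z
      using eq by (cases "z \<in> \<Omega>") auto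
    then show ?thesis unfolding set_lebesgue_integral_def by (simp only:)
  qed
  ultimately show ?thesis using assms(1) unfolding weak_deriv_def by simp
qed

definition box_cyl :: "real \<Rightarrow> real \<Rightarrow> (real \<times> (real^'n)) set" where
  "box_cyl T \<rho> = {\<rho>..T - \<rho>} \<times> cball 0 (1 - \<rho>)"

lemma compact_box_cyl: "compact (box_cyl T \<rho>)"
  unfolding box_cyl_def by (intro compact_Times) auto

lemma box_cyl_subset: "0 < \<rho> \<Longrightarrow> box_cyl T \<rho> \<subseteq> {0<..<T} \<times> ball 0 1"
  unfolding box_cyl_def by auto

lemma box_cyl_interior: "\<rho>' < \<rho> \<Longrightarrow> box_cyl T \<rho> \<subseteq> interior (box_cyl T \<rho>')"
  unfolding box_cyl_def by (auto simp: interior_Times)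

lemma Lp_loc_power_integrable:
  fixes v :: "real \<times> (real^'n) \<Rightarrow> real"
  assumes v: "v \<in> Lp_loc (real CARD('n) + 1) T" and \<rho>: "0 < \<rho>'" "\<rho>' < \<rho>"
  shows "integrable lebesgue (\<lambda>z. indicator (box_cyl T \<rho>) z * \<bar>v z\<bar> ^ (CARD('n) + 1))"
proof -
  let ?S = "{\<rho>'..<T - \<rho>'} \<times> ball 0 (1 - \<rho>') :: (real \<times> (real^'n)) set"
  have "integrable (lebesgue_on ?S) (\<lambda>z. \<bar>v z\<bar> powr (real CARD('n) + 1))"
    using v \<rho>(1) unfolding Lp_loc_def Lp_on_def by blast
  moreover have Sm: "?S \<in> sets lebesgue"
    by (intro sets_completionI_sets) (simp add: borel_Times)
  ultimately have iS: "integrable lebesgue (\<lambda>z. indicator ?S z *\<^sub>R (\<bar>v z\<bar> powr (real CARD('n) + 1)))"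
    by (simp add: integrable_restrict_space)
  have "box_cyl T \<rho> \<in> sets lebesgue"
    by (intro sets_completionI_sets) (simp add: borel_compact compact_box_cyl)
  from integrable_mult_indicator[OF this iS] have "integrable lebesgue (\<lambda>z. indicator (box_cyl T \<rho>) z *\<^sub>R (indicator ?S z *\<^sub>R (\<bar>v z\<bar> powr (real CARD('n) + 1))))"
    .
  also have "(\<lambda>z. indicator (box_cyl T \<rho>) z *\<^sub>R (indicator ?S z *\<^sub>R (\<bar>v z\<bar> powr (real CARD('n) + 1))))
     = (\<lambda>z. indicator (box_cyl T \<rho>) z * \<bar>v z\<bar> ^ (CARD('n) + 1))"
  proof
    fix z
    have "\<bar>v z\<bar> powr (real CARD('n) + 1) = \<bar>v z\<bar> ^ (CARD('n) + 1)"
      using powr_realpow[of "\<bar>v z\<bar>" "CARD('n) + 1"] by (cases "v z = 0") (auto simp: add.commute)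
    moreover have "z \<in> box_cyl T \<rho> \<Longrightarrow> z \<in> ?S" using \<rho> by (auto simp: box_cyl_def)
    ultimately show "indicator (box_cyl T \<rho>) z *\<^sub>R (indicator ?S z *\<^sub>R (\<bar>v z\<bar> powr (real CARD('n) + 1)))
      = indicator (box_cyl T \<rho>) z * \<bar>v z\<bar> ^ (CARD('n) + 1)" by (auto simp: indicator_def)
  qed
  finally show ?thesis .
qed

text \<open>The pairs of options enumerate the derivatives that occur: \<open>(Some i, None)\<close> stands for \<open>D\<^sub>i\<close>,
\<open>(Some i, Some j)\<close> for \<open>D\<^sub>i\<^sub>j\<close>, and the pairs starting with \<open>None\<close> for the time derivative. In this way one statement about a
finite family treats them all.\<close>

definition dirs :: "'n option \<times> 'n option \<Rightarrow> (real \<times> (real^'n)) list" where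
  "dirs q = (case fst q of None \<Rightarrow> [dt] | Some i \<Rightarrow> (case snd q of None \<Rightarrow> [dx i] | Some j \<Rightarrow> [dx i, dx j]))"

definition deriv_version :: "('z \<Rightarrow> real) \<Rightarrow> ('z \<Rightarrow> real^'n) \<Rightarrow> ('z \<Rightarrow> real^'n^'n) \<Rightarrow> 'n option \<times> 'n option \<Rightarrow> 'z \<Rightarrow> real" where
  "deriv_version ut Du D2u q z = (case fst q of None \<Rightarrow> ut z | Some i \<Rightarrow> (case snd q of None \<Rightarrow> Du z $ i | Some j \<Rightarrow> D2u z $ i $ j))"

lemma generalized_derivs_deriv_version:
  "generalized_derivs T u ut Du D2u \<Longrightarrow> weak_deriv (interior (cyl T)) (dirs q) u (deriv_version ut Du D2u q)"
  by (auto simp: generalized_derivs_def dirs_def deriv_version_def[abs_def] split: option.splits)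

lemma W12_loc_deriv_version:
  "u \<in> W12_loc p T \<Longrightarrow> \<exists>v\<in>Lp_loc p T. weak_deriv (interior (cyl T)) (dirs q) u v"
  by (auto simp: W12_loc_def dirs_def split: option.splits)

text \<open>Membership in the Sobolev space only provides some version in \<open>L\<^sub>p\<close>; the given one agrees with it almost
everywhere. The larger box is needed because uniqueness of versions holds in the interior.\<close>

lemma deriv_version_power_integrable:
  fixes u ut :: "real \<times> (real^'n) \<Rightarrow> real"
  assumes W: "u \<in> W12_loc (real CARD('n) + 1) T" and gd: "generalized_derivs T u ut Du D2u"
    and \<rho>: "0 < \<rho>'" "\<rho>' < \<rho>"
  shows "integrable lebesgue (\<lambda>z. indicator (box_cyl T \<rho>) z * deriv_version ut Du D2u q z)"
    and "integrable lebesgue (\<lambda>z. \<bar>indicator (box_cyl T \<rho>) z * deriv_version ut Du D2u q z\<bar> ^ (CARD('n) + 1))"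
proof -
  let ?R = "box_cyl T \<rho> :: (real \<times> (real^'n)) set" and ?V = "deriv_version ut Du D2u q"
  let ?\<Omega> = "interior (cyl T) :: (real \<times> (real^'n)) set"
  obtain v where v: "v \<in> Lp_loc (real CARD('n) + 1) T" "weak_deriv ?\<Omega> (dirs q) u v"
    using W12_loc_deriv_version[OF W] by blast
  have wV: "weak_deriv ?\<Omega> (dirs q) u ?V" by (rule generalized_derivs_deriv_version[OF gd])
  have R: "compact (box_cyl T \<rho>' :: (real \<times> (real^'n)) set)" "box_cyl T \<rho>' \<subseteq> ?\<Omega>"
    using compact_box_cyl box_cyl_subset[OF \<rho>(1)] by (auto simp: interior_cyl)
  have R': "compact ?R" "?R \<subseteq> ?\<Omega>"
    using compact_box_cyl box_cyl_subset[of \<rho>] \<rho> by (auto simp: interior_cyl)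
  show iV: "integrable lebesgue (\<lambda>z. indicator ?R z * ?V z)"
    using wV R' unfolding weak_deriv_def locally_integrable_def set_integrable_def by auto
  have "AE z in lebesgue. z \<in> interior (box_cyl T \<rho>') \<longrightarrow> ?V z = v z"
    by (rule weak_deriv_unique_AE[OF wV v(2) R])
  then have ae: "AE z in lebesgue. indicator ?R z * \<bar>v z\<bar> ^ (CARD('n) + 1) = \<bar>indicator ?R z * ?V z\<bar> ^ (CARD('n) + 1)"
  proof (rule AE_mp, intro AE_I2 impI)
    fix z assume "z \<in> interior (box_cyl T \<rho>') \<longrightarrow> ?V z = v z"
    then have "?V z = v z" if "z \<in> ?R" using box_cyl_interior[OF \<rho>(2), of T] that by auto
    then show "indicator ?R z * \<bar>v z\<bar> ^ (CARD('n) + 1) = \<bar>indicator ?R z * ?V z\<bar> ^ (CARD('n) + 1)"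
      by (auto simp: indicator_def)
  qed
  have i: "integrable lebesgue (\<lambda>z. indicator ?R z * \<bar>v z\<bar> ^ (CARD('n) + 1))"
    by (rule Lp_loc_power_integrable[OF v(1) \<rho>])
  have m: "(\<lambda>z. \<bar>indicator ?R z * ?V z\<bar> ^ (CARD('n) + 1)) \<in> borel_measurable lebesgue"
    using iV by (intro borel_measurable_power borel_measurable_abs) auto
  show "integrable lebesgue (\<lambda>z. \<bar>indicator ?R z * ?V z\<bar> ^ (CARD('n) + 1))"
    using integrable_cong_AE[OF _ m ae] i by auto
qed

text \<open>Points near the boundary are compared, by uniform continuity, with \<open>(T, x)\<close> or with their radial projection
to the sphere; a width below \<open>1\<close> keeps the centre out of the layer.\<close>

lemma boundary_layer:
  fixes u :: "real \<times> (real^'n) \<Rightarrow> real"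
  assumes T: "0 < T" and c: "continuous_on ({0..T} \<times> cball 0 1) u" and s: "0 < s"
    and bd: "\<And>t x. t \<in> {0..T} \<Longrightarrow> norm x \<le> 1 \<Longrightarrow> t = T \<or> norm x = 1 \<Longrightarrow> u (t, x) \<le> - s"
  obtains d where "0 < d"
    "\<And>t x. t \<in> {0..T} \<Longrightarrow> norm x \<le> 1 \<Longrightarrow> T - d \<le> t \<or> 1 - d \<le> norm x \<Longrightarrow> u (t, x) \<le> - s / 2"
proof -
  have "uniformly_continuous_on ({0..T} \<times> cball 0 1) u"
    by (rule compact_uniformly_continuous[OF c]) (intro compact_Times; simp)
  from uniformly_continuous_onE[OF this, of "s / 2"] s
  obtain d where d: "0 < d" "\<And>z w. z \<in> {0..T} \<times> cball 0 1 \<Longrightarrow> w \<in> {0..T} \<times> cball 0 1 \<Longrightarrow> dist w z < d \<Longrightarrow> dist (u w) (u z) < s / 2"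
    by (metis half_gt_zero)
  have near: "u (t, x) \<le> - s / 2" if "t \<in> {0..T}" "norm x \<le> 1" "t' \<in> {0..T}" "norm x' \<le> 1" "t' = T \<or> norm x' = 1"
    "dist (t, x) (t', x') < d" for t x t' x'
  proof -
    have "dist (u (t, x)) (u (t', x')) < s / 2" by (rule d(2)) (use that in auto)
    then show ?thesis using bd[of t' x'] that by (simp add: dist_real_def abs_if split: if_splits)
  qed
  define e where "e = min (d / 2) (1 / 2)"
  have e: "0 < e" "e < d" "e < 1" using d(1) by (auto simp: e_def)
  show ?thesis
  proof (rule that[of e])
    show "0 < e" by (rule e)
    fix t :: real and x :: "real^'n"
    assume tx: "t \<in> {0..T}" "norm x \<le> 1" "T - e \<le> t \<or> 1 - e \<le> norm x"
    show "u (t, x) \<le> - s / 2"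
    proof (cases "T - e \<le> t")
      case True
      have "dist (t, x) (T, x) = T - t" using tx by (simp add: dist_Pair_Pair dist_real_def)
      then show ?thesis using near[of t x T x] tx True e T by auto
    next
      case False
      then have nx: "1 - e \<le> norm x" "0 < norm x" using tx e by auto
      let ?x = "(1 / norm x) *\<^sub>R x"
      have "x - ?x = (1 - 1 / norm x) *\<^sub>R x" by (simp add: scaleR_left_diff_distrib)
      then have "dist x ?x = \<bar>1 - 1 / norm x\<bar> * norm x" by (simp add: dist_norm)
      also have "\<dots> = 1 - norm x" using nx(2) tx(2) by (simp add: abs_if field_simps)
      finally have "dist (t, x) (t, ?x) = 1 - norm x" using tx by (simp add: dist_Pair_Pair)
      moreover have "norm ?x = 1" using nx by simp
      ultimately show ?thesis using near[of t x t ?x] tx nx e by auto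
    qed
  qed
qed

lemma limsup_set_frequently:
  fixes r :: "nat \<Rightarrow> nat"
  assumes "G = (\<Inter>n. \<Union>k\<in>{n..}. S k)"
  shows "z \<in> G \<Longrightarrow> frequently (\<lambda>k. z \<in> S k) sequentially" and "z \<notin> G \<Longrightarrow> eventually (\<lambda>k. z \<notin> S k) sequentially"
  using assms by (auto simp: frequently_sequentially eventually_sequentially)

lemma frequently_le_limit:
  fixes f :: "nat \<Rightarrow> real"
  assumes fr: "frequently P sequentially" and lim: "f \<longlonglongrightarrow> l" and le: "\<And>k. P k \<Longrightarrow> f k \<le> c"
  shows "l \<le> c"
proof (rule ccontr)
  assume "\<not> l \<le> c"
  then have "eventually (\<lambda>k. c < f k) sequentially" using order_tendstoD(1)[OF lim, of c] by simp
  then have "eventually (\<lambda>k. \<not> P k) sequentially" by eventually_elim (use le in force)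
  then show False using fr by (simp add: frequently_def)
qed

context barrier
begin

text \<open>The estimate for contact sets survives mollification. The limit set is the upper limit of the contact sets of a subsequence along
which all derivatives converge almost everywhere: its points satisfy the limiting contact conditions, and
outside of it the approximating integrands eventually vanish. The integrands are dominated by \<open>(n + 1)\<close>-st
powers of mollifications, which Jensen's inequality bounds by mollifications of \<open>(n + 1)\<close>-st powers.\<close>

lemma contact_limit:
  fixes u ut :: "real \<times> (real^'n) \<Rightarrow> real" and Du :: "real \<times> (real^'n) \<Rightarrow> real^'n"
    and D2u :: "real \<times> (real^'n) \<Rightarrow> real^'n^'n" and x0 :: "real^'n"
  assumes T: "0 < T" and W: "u \<in> W12_loc (real CARD('n) + 1) T"
    and cont: "continuous_on (closure (cyl T)) u" and gd: "generalized_derivs T u ut Du D2u"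
    and \<epsilon>: "0 < \<epsilon>" "\<epsilon> \<le> 1" and M: "0 < M" and L: "L = (1 - \<epsilon>) * M"
    and slack: "0 < slack"
    and bd: "\<And>t x. t \<in> {0..T} \<Longrightarrow> norm x \<le> 1 \<Longrightarrow> t = T \<or> norm x = 1 \<Longrightarrow> u (t, x) - m \<le> - slack"
    and up: "\<And>t x. 0 < t \<Longrightarrow> t < T \<Longrightarrow> norm x < 1 \<Longrightarrow> u (t, x) - m \<le> M * \<theta> x"
    and t0: "0 < t0" "t0 < T" and x0: "norm x0 < 1"
    and E: "E = \<epsilon> * M / 512 * (psi x0 * g1 (psi x0))"
    and start: "M * \<theta> x0 - E < u (t0, x0) - m"
  obtains G where "G \<subseteq> interior (cyl T)"
    "(\<lambda>z. indicator G z * \<bar>ut z * det (D2u z - L *\<^sub>R hess_\<theta> (snd z))\<bar>) \<in> borel_measurable lebesgue"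
    "emeasure lborel (plane_image (\<epsilon> * M) x0)
      \<le> (\<integral>\<^sup>+z. ennreal (indicator G z * \<bar>ut z * det (D2u z - L *\<^sub>R hess_\<theta> (snd z))\<bar>) \<partial>lebesgue)"
    "AE z in lebesgue. z \<in> G \<longrightarrow> ut z \<le> 0 \<and> 0 \<le> u z - m \<and> psi x0 / 4 \<le> psi (snd z) \<and> psi (snd z) \<le> 4 * psi x0 \<and>
       norm (Du z - L *\<^sub>R grad_\<theta> (snd z)) \<le> 4 * (\<epsilon> * M) * g1 (psi x0) \<and>
       sym_nonneg_definite (- (D2u z - L *\<^sub>R hess_\<theta> (snd z)))"
proof -
  let ?n = "CARD('n)" and ?V = "deriv_version ut Du D2u" and ?p = "CARD('n) + 1"
  let ?\<Omega> = "interior (cyl T) :: (real \<times> (real^'n)) set"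
  let ?C = "{0..T} \<times> cball 0 1 :: (real \<times> (real^'n)) set"
  have cont': "continuous_on ?C u" using cont closure_cyl[OF T] by metis
  have x0b: "x0 \<in> ball 0 1" using x0 by simp
  have \<delta>: "0 < psi x0" "0 < g1 (psi x0)" using psi_pos[OF x0b] g1_pos by auto
  have E0: "0 < E" unfolding E using \<epsilon> M \<delta> by simp
  \<comment> \<open>The nearest point projection extends \<open>u\<close> continuously from the closed cylinder to a box.\<close>
  have Cne: "closed ?C" "convex ?C" "?C \<noteq> {}"
    using T by (auto intro!: closed_Times convex_Times)
  define w where "w z = u (closest_point ?C z)" for z
  have w_cont: "continuous_on S w" for S
    unfolding w_def
    by (rule continuous_on_compose2[OF cont' continuous_on_closest_point[OF Cne(2,1,3)]])
       (use closest_point_in_set[OF Cne(1,3)] in blast)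
  have w_eq: "w z = u z" if "z \<in> ?C" for z
    unfolding w_def using closest_point_self[OF that] by simp
  have "bounded ?C" by (intro bounded_Times) auto
  then obtain b where b: "?C \<subseteq> cbox (- b) b" using bounded_subset_cbox_symmetric by blast
  have \<Omega>C: "?\<Omega> \<subseteq> ?C" by (auto simp: interior_cyl)
  have \<Omega>b: "?\<Omega> \<subseteq> cbox (- b) b" using \<Omega>C b by blast
  have wd: "weak_deriv ?\<Omega> (dirs q) w (?V q)" for q
    by (rule weak_deriv_cong[OF generalized_derivs_deriv_version[OF gd]]) (use w_eq \<Omega>C in auto)
  interpret approximant \<kappa> \<beta> "- b" b w m L
    by unfold_locales (rule w_cont)
  \<comment> \<open>The contact argument runs in a smaller cylinder \<open>Q\<close>, on whose top and lateral boundary half of the slack is left. The margin between \<open>Q\<close> and \<open>R\<close> accommodates the support of the mollifier.\<close>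
  have "continuous_on ?C (\<lambda>z. u z - m)" by (intro continuous_on_diff cont' continuous_on_const)
  from boundary_layer[OF T this slack bd]
  obtain d where d: "0 < d" "\<And>t x. t \<in> {0..T} \<Longrightarrow> norm x \<le> 1 \<Longrightarrow>
      T - d \<le> t \<or> 1 - d \<le> norm x \<Longrightarrow> u (t, x) - m \<le> - slack / 2" by auto
  define \<rho> where "\<rho> = min (min d (1/2)) (min (min (t0 / 2) ((T - t0) / 2)) ((1 - norm x0) / 2))"
  have \<rho>: "0 < \<rho>" "\<rho> \<le> d" "\<rho> \<le> 1/2" "\<rho> < t0" "t0 < T - \<rho>" "norm x0 < 1 - \<rho>"
  proof -
    have a: "\<rho> \<le> d" "\<rho> \<le> 1/2" "\<rho> \<le> t0 / 2" "\<rho> \<le> (T - t0) / 2" "\<rho> \<le> (1 - norm x0) / 2"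
      unfolding \<rho>_def by linarith+
    show "0 < \<rho>" using d(1) t0 x0 by (simp add: \<rho>_def)
    with a show "\<rho> \<le> d" "\<rho> \<le> 1/2" "\<rho> < t0" "t0 < T - \<rho>" "norm x0 < 1 - \<rho>"
      using t0 x0 by (simp_all add: field_simps)
  qed
  define Q where "Q = {t0..T - \<rho>} \<times> cball (0::real^'n) (1 - \<rho>)"
  define R where "R = (box_cyl T (\<rho> / 2) :: (real \<times> (real^'n)) set)"
  have Q: "compact Q" "Q \<subseteq> UNIV \<times> ball 0 1" "Q \<subseteq> ?C" "Q \<subseteq> ?\<Omega>" "Q \<subseteq> box_cyl T \<rho>"
    using \<rho> t0 by (auto simp: Q_def interior_cyl box_cyl_def intro!: compact_Times)
  have R: "R \<subseteq> ?\<Omega>" "R \<in> sets lebesgue" "compact R"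
  proof -
    show "R \<subseteq> ?\<Omega>" unfolding R_def interior_cyl using box_cyl_subset[of "\<rho> / 2" T] \<rho>(1) by simp
    show cR: "compact R" unfolding R_def by (rule compact_box_cyl)
    show "R \<in> sets lebesgue" using borel_compact[OF cR] by (intro sets_completionI_sets) simp
  qed
  have QR: "cball z (radius k) \<subseteq> R" if "z \<in> Q" "radius k \<le> \<rho> / 2" for z k
  proof
    fix y assume "y \<in> cball z (radius k)"
    then have dy: "dist z y \<le> \<rho> / 2" using that by simp
    have "\<bar>fst z - fst y\<bar> \<le> \<rho> / 2" using dist_fst_le[of z y] dy by (simp add: dist_real_def)
    moreover have "norm (snd y) \<le> norm (snd z) + \<rho> / 2"
      using dist_snd_le[of z y] dy norm_triangle_ineq2[of "snd y" "snd z"] by (simp add: dist_norm norm_minus_commute)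
    ultimately show "y \<in> R" using that(1) \<rho> by (auto simp: R_def box_cyl_def Q_def mem_Times_iff abs_if split: if_splits)
  qed
  define f where "f q z = indicator R z * ?V q z" for q z
  have fi: "integrable lebesgue (f q)" "integrable lebesgue (\<lambda>z. \<bar>f q z\<bar> ^ ?p)" for q
    using deriv_version_power_integrable[OF W gd, of "\<rho> / 4" "\<rho> / 2" q] \<rho>(1) unfolding f_def R_def by auto
  obtain r :: "nat \<Rightarrow> nat" where r: "strict_mono r"
    "AE z in lebesgue. \<forall>q\<in>UNIV. (\<lambda>k. mollify (r k) (f q) z) \<longlonglongrightarrow> f q z"
    using mollify_AE_tendsto[of "UNIV :: ('n option \<times> 'n option) set" f] fi by auto
  define e0 where "e0 = min E (slack / 4)"
  have e0: "0 < e0" "e0 \<le> E" "e0 \<le> slack / 4" using E0 slack by (auto simp: e0_def)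
  obtain k1 where k1: "\<And>k z. k1 \<le> k \<Longrightarrow> cball z (radius k) \<subseteq> cbox (- b) b \<Longrightarrow> \<bar>mder (- b) b w k [] z - w z\<bar> \<le> e0"
    using mder_uniform_limit[OF w_cont e0(1)] by blast
  obtain k2 :: nat where k2: "2 / \<rho> < real k2" using reals_Archimedean2 by blast
  \<comment> \<open>The shift makes the uniform error at most \<open>e0\<close> and the support of the mollifier smaller than the margin for every index, not only eventually.\<close>
  define kk where "kk j = r (j + max k1 k2)" for j
  have kk: "k1 \<le> kk j" "radius (kk j) \<le> \<rho> / 2" for j
  proof -
    have "j + max k1 k2 \<le> kk j" unfolding kk_def using r(1) by (rule seq_suble)
    then have "k1 \<le> kk j" "k2 \<le> kk j" by auto
    then have "2 / \<rho> < real (kk j) + 1" using k2 by linarith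
    then show "radius (kk j) \<le> \<rho> / 2" using \<rho>(1) by (simp add: radius_def field_simps)
    show "k1 \<le> kk j" by fact
  qed
  have kk_mono: "strict_mono kk" unfolding kk_def using r(1) by (auto simp: strict_mono_def)
  have md: "mder (- b) b w (kk j) (dirs q) z = mollify (kk j) (f q) z" if "z \<in> Q" for j q z
    unfolding f_def by (rule mder_eq_mollify[OF \<Omega>b w_cont wd QR[OF that kk(2)] R(1)])
  have unif: "\<bar>mder (- b) b w (kk j) [] z - u z\<bar> \<le> e0" if "z \<in> Q" for j z
    using k1[OF kk(1), of z j] QR[OF that kk(2)] R(1) \<Omega>b w_eq[of z] Q(3) that by (metis order_trans subsetD)
  define G where "G = (\<Inter>n. \<Union>j\<in>{n..}. contact_set Q x0 (4 * (\<epsilon> * M) * g1 (psi x0)) (kk j))"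
  let ?S = "\<lambda>j. contact_set Q x0 (4 * (\<epsilon> * M) * g1 (psi x0)) (kk j)"
  have SQ: "?S j \<subseteq> Q" for j by (auto simp: contact_set_def)
  then have GQ: "G \<subseteq> Q" unfolding G_def by blast
  define H where "H z = D2u z - L *\<^sub>R hess_\<theta> (snd z)" for z
  define J where "J = (\<lambda>z. indicator G z * \<bar>ut z * det (H z)\<bar>)"
  define Jk where "Jk j z = indicator (?S j) z * \<bar>vt (kk j) z * det (Ha (kk j) z)\<bar>" for j z
  have Sm: "?S j \<in> sets borel" for j by (intro borel_closed closed_contact_set Q)
  then have Gm: "G \<in> sets borel" unfolding G_def by auto
  have Jkm: "Jk j \<in> borel_measurable lebesgue" for j
    unfolding Jk_def by (rule measurable_completion) (use contact_set_measurable[OF Q(1,2)] in simp)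
  \<comment> \<open>The versions \<open>ut\<close> and \<open>D2u\<close> are known to be measurable only in compact parts of the cylinder, so they are cut off to \<open>R\<close> before the determinant is formed.\<close>
  have cH: "continuous_on Q (\<lambda>z. hess_\<theta> (snd z) $ i $ j)" for i j
    by (rule continuous_on_snd_ball[OF Q(2) continuous_on_hess_\<theta>])
  have Jm: "J \<in> borel_measurable lebesgue"
  proof -
    define F where "F z = ((\<chi> i j. f (Some i, Some j) z - L * (indicator Q z *\<^sub>R hess_\<theta> (snd z) $ i $ j)) :: real^'n^'n)" for z
    have "(\<lambda>z. indicator Q z *\<^sub>R hess_\<theta> (snd z) $ i $ j) \<in> borel_measurable lebesgue" for i j
      by (rule measurable_completion)
         (use borel_measurable_continuous_on_indicator[OF borel_compact[OF Q(1)] cH] in simp)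
    then have "(\<lambda>z. det (F z)) \<in> borel_measurable lebesgue"
      using fi(1) unfolding F_def
      by (intro measurable_det) (auto intro!: borel_measurable_diff borel_measurable_times)
    then have "(\<lambda>z. indicator G z * \<bar>f (None, None) z * det (F z)\<bar>) \<in> borel_measurable lebesgue"
      using Gm fi(1)[of "(None, None)"]
      by (intro borel_measurable_times borel_measurable_abs borel_measurable_indicator) auto
    also have "(\<lambda>z. indicator G z * \<bar>f (None, None) z * det (F z)\<bar>) = J"
    proof
      fix z
      have "z \<in> R" if "z \<in> Q" using QR[OF that kk(2)[of 0]] radius_pos[of "kk 0"] by (meson centre_in_cball less_imp_le subsetD)
      then have "f (None, None) z = ut z \<and> F z = H z" if "z \<in> G"
        using that GQ by (auto simp: f_def deriv_version_def F_def H_def vec_eq_iff)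
      then show "indicator G z * \<bar>f (None, None) z * det (F z)\<bar> = J z"
        by (cases "z \<in> G") (auto simp: J_def)
    qed
    finally show ?thesis .
  qed
  \<comment> \<open>The derivatives of \<open>\<theta>\<close> are bounded in \<open>Q\<close>, and the remaining terms are mollifications of the functions \<open>f q\<close>.\<close>
  have "\<exists>c. \<forall>z\<in>Q. \<bar>L * hess_\<theta> (snd z) $ i $ j\<bar> \<le> c" for i j
  proof -
    have "bounded ((\<lambda>z. L * hess_\<theta> (snd z) $ i $ j) ` Q)"
      by (intro compact_imp_bounded compact_continuous_image Q(1) continuous_on_mult continuous_on_const cH)
    then show ?thesis by (auto simp: bounded_iff)
  qed
  then obtain c where c: "\<And>i j z. z \<in> Q \<Longrightarrow> \<bar>L * hess_\<theta> (snd z) $ i $ j\<bar> \<le> c i j" by metis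
  define C0 where "C0 = (\<Sum>i\<in>UNIV. \<Sum>j\<in>UNIV. \<bar>c i j\<bar>)"
  have C0: "\<bar>L * hess_\<theta> (snd z) $ i $ j\<bar> \<le> C0" if "z \<in> Q" for i j z
  proof -
    have "\<bar>c i j\<bar> \<le> (\<Sum>j\<in>UNIV. \<bar>c i j\<bar>)" by (rule member_le_sum) auto
    also have "\<dots> \<le> C0" unfolding C0_def by (rule member_le_sum) (auto intro: sum_nonneg)
    finally show ?thesis using c[OF that, of i j] by linarith
  qed
  have C0n: "0 \<le> C0" unfolding C0_def by (intro sum_nonneg) auto
  define N where "N = real (card (UNIV :: ('n option \<times> 'n option) set)) ^ ?p"
  have Nn: "0 \<le> N" by (simp add: N_def)
  define Hk where "Hk j z = fact ?n * 2 ^ ?p * (indicator Q z * C0 ^ ?p + N * (\<Sum>q\<in>UNIV. mollify (kk j) (\<lambda>z. \<bar>f q z\<bar> ^ ?p) z))" for j z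
  define HH where "HH z = fact ?n * 2 ^ ?p * (indicator Q z * C0 ^ ?p + N * (\<Sum>q\<in>UNIV. \<bar>f q z\<bar> ^ ?p))" for z
  have mollify_nonneg: "0 \<le> mollify k (\<lambda>z. \<bar>f q z\<bar> ^ ?p) z" for k q z
    unfolding mollify_def by (intro integral_nonneg_AE AE_I2) (simp add: rho_nonneg)
  have Hk_nonneg: "0 \<le> Hk j z" for j z
    unfolding Hk_def using C0n Nn by (intro mult_nonneg_nonneg add_nonneg_nonneg sum_nonneg mollify_nonneg) auto
  have bound: "Jk j z \<le> Hk j z" for j z
  proof (cases "z \<in> ?S j")
    case False
    then show ?thesis using Hk_nonneg by (simp add: Jk_def)
  next
    case True
    then have z: "z \<in> Q" using SQ by blast
    define X where "X = (\<Sum>q\<in>UNIV. \<bar>mollify (kk j) (f q) z\<bar>)"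
    have X: "\<bar>mder (- b) b w (kk j) (dirs q) z\<bar> \<le> X" for q
      unfolding md[OF z] X_def by (rule member_le_sum) auto
    have X0: "0 \<le> X" unfolding X_def by (intro sum_nonneg) auto
    have 1: "\<bar>vt (kk j) z\<bar> \<le> C0 + X" using X[of "(None, None)"] C0n by (simp add: vt_def dirs_def)
    have "\<bar>Ha (kk j) z $ i $ l\<bar> \<le> C0 + X" for i l
      using X[of "(Some i, Some l)"] C0[OF z, of i l] by (simp add: Ha_def dirs_def)
    then have 2: "\<bar>det (Ha (kk j) z)\<bar> \<le> fact ?n * (C0 + X) ^ ?n" by (rule abs_det_le_fact_entries)
    have "Jk j z = \<bar>vt (kk j) z\<bar> * \<bar>det (Ha (kk j) z)\<bar>" using True by (simp add: Jk_def abs_mult)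
    also have "\<dots> \<le> (C0 + X) * (fact ?n * (C0 + X) ^ ?n)" using 1 2 C0n X0 by (intro mult_mono) auto
    also have "\<dots> = fact ?n * (C0 + X) ^ ?p" by simp
    also have "\<dots> \<le> fact ?n * (2 ^ ?p * (C0 ^ ?p + X ^ ?p))"
      using sum_power_le[of "UNIV :: bool set" "\<lambda>b. if b then C0 else X" ?p] C0n X0
      by (intro mult_left_mono) (auto simp: UNIV_bool add.commute)
    also have "X ^ ?p \<le> N * (\<Sum>q\<in>UNIV. \<bar>mollify (kk j) (f q) z\<bar> ^ ?p)"
      unfolding X_def N_def by (rule sum_power_le) auto
    also have "(\<Sum>q\<in>UNIV. \<bar>mollify (kk j) (f q) z\<bar> ^ ?p) \<le> (\<Sum>q\<in>UNIV. mollify (kk j) (\<lambda>z. \<bar>f q z\<bar> ^ ?p) z)"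
      by (intro sum_mono mollify_power_le fi)
    finally show ?thesis using z Nn by (simp add: Hk_def mult.assoc mult_left_mono)
  qed
  have iQ: "integrable lebesgue (\<lambda>z. indicator Q z * C0 ^ ?p)"
    using lmeasurable_compact[OF Q(1)] by (intro integrable_mult_left) (auto simp: lmeasurable_iff_integrable)
  have Hki: "integrable lebesgue (Hk j)" for j
    unfolding Hk_def by (intro integrable_mult_right Bochner_Integration.integrable_add iQ
        Bochner_Integration.integrable_sum mollify_L1_tendsto(1) fi)
  have HHi: "integrable lebesgue HH"
    unfolding HH_def by (intro integrable_mult_right Bochner_Integration.integrable_add iQ
        Bochner_Integration.integrable_sum fi)
  have HL: "(\<lambda>j. LINT z|lebesgue. \<bar>Hk j z - HH z\<bar>) \<longlonglongrightarrow> 0"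
  proof (rule Lim_null_comparison)
    let ?c = "fact ?n * 2 ^ ?p * N"
    let ?I = "\<lambda>j q. LINT z|lebesgue. \<bar>mollify (kk j) (\<lambda>z. \<bar>f q z\<bar> ^ ?p) z - \<bar>f q z\<bar> ^ ?p\<bar>"
    have ii: "integrable lebesgue (\<lambda>z. \<bar>mollify (kk j) (\<lambda>z. \<bar>f q z\<bar> ^ ?p) z - \<bar>f q z\<bar> ^ ?p\<bar>)" for j q
      by (intro integrable_abs Bochner_Integration.integrable_diff mollify_L1_tendsto(1) fi)
    show "\<forall>\<^sub>F j in sequentially. norm (LINT z|lebesgue. \<bar>Hk j z - HH z\<bar>) \<le> ?c * (\<Sum>q\<in>UNIV. ?I j q)"
    proof (rule always_eventually, rule allI)
      fix j
      have "norm (LINT z|lebesgue. \<bar>Hk j z - HH z\<bar>) = (LINT z|lebesgue. \<bar>Hk j z - HH z\<bar>)" by simp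
      also have "\<dots> \<le> (LINT z|lebesgue. ?c * (\<Sum>q\<in>UNIV. \<bar>mollify (kk j) (\<lambda>z. \<bar>f q z\<bar> ^ ?p) z - \<bar>f q z\<bar> ^ ?p\<bar>))"
      proof (rule integral_mono)
        show "integrable lebesgue (\<lambda>z. \<bar>Hk j z - HH z\<bar>)"
          by (intro integrable_abs Bochner_Integration.integrable_diff Hki HHi)
        show "integrable lebesgue (\<lambda>z. ?c * (\<Sum>q\<in>UNIV. \<bar>mollify (kk j) (\<lambda>z. \<bar>f q z\<bar> ^ ?p) z - \<bar>f q z\<bar> ^ ?p\<bar>))"
          by (intro integrable_mult_right Bochner_Integration.integrable_sum ii)
        fix z
        have "Hk j z - HH z = ?c * (\<Sum>q\<in>UNIV. mollify (kk j) (\<lambda>z. \<bar>f q z\<bar> ^ ?p) z - \<bar>f q z\<bar> ^ ?p)"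
          unfolding Hk_def HH_def sum_subtractf by (simp add: algebra_simps)
        then have "\<bar>Hk j z - HH z\<bar> = ?c * \<bar>\<Sum>q\<in>UNIV. mollify (kk j) (\<lambda>z. \<bar>f q z\<bar> ^ ?p) z - \<bar>f q z\<bar> ^ ?p\<bar>"
          using Nn by (simp add: abs_mult)
        also have "\<dots> \<le> ?c * (\<Sum>q\<in>UNIV. \<bar>mollify (kk j) (\<lambda>z. \<bar>f q z\<bar> ^ ?p) z - \<bar>f q z\<bar> ^ ?p\<bar>)"
          using Nn by (intro mult_left_mono sum_abs) auto
        finally show "\<bar>Hk j z - HH z\<bar> \<le> ?c * (\<Sum>q\<in>UNIV. \<bar>mollify (kk j) (\<lambda>z. \<bar>f q z\<bar> ^ ?p) z - \<bar>f q z\<bar> ^ ?p\<bar>)" .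
      qed
      also have "\<dots> = ?c * (\<Sum>q\<in>UNIV. ?I j q)"
        using ii by (simp add: Bochner_Integration.integral_sum)
      finally show "norm (LINT z|lebesgue. \<bar>Hk j z - HH z\<bar>) \<le> ?c * (\<Sum>q\<in>UNIV. ?I j q)" .
    qed
    have I0: "(\<lambda>j. ?I j q) \<longlonglongrightarrow> 0" for q
      using LIMSEQ_subseq_LIMSEQ[OF mollify_L1_tendsto(2)[OF fi(2)[of q]] kk_mono] by (simp add: o_def)
    have "(\<lambda>j. ?c * (\<Sum>q\<in>UNIV. ?I j q)) \<longlonglongrightarrow> ?c * (\<Sum>q\<in>(UNIV :: ('n option \<times> 'n option) set). 0)"
      by (intro tendsto_mult tendsto_const tendsto_sum I0)
    then show "(\<lambda>j. ?c * (\<Sum>q\<in>UNIV. ?I j q)) \<longlonglongrightarrow> 0" by simp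
  qed
  have "(\<lambda>j. mollify (kk j) (f q) z) \<longlonglongrightarrow> f q z" if "(\<lambda>k. mollify (r k) (f q) z) \<longlonglongrightarrow> f q z" for q z
    unfolding kk_def by (rule LIMSEQ_ignore_initial_segment[OF that])
  then have ae: "AE z in lebesgue. z \<in> Q \<longrightarrow> (\<forall>q. (\<lambda>j. mder (- b) b w (kk j) (dirs q) z) \<longlonglongrightarrow> ?V q z)"
    using r(2)
  proof (elim AE_mp, intro AE_I2 impI allI)
    fix z q
    assume 1: "\<And>q z. (\<lambda>k. mollify (r k) (f q) z) \<longlonglongrightarrow> f q z \<Longrightarrow> (\<lambda>j. mollify (kk j) (f q) z) \<longlonglongrightarrow> f q z"
      and 2: "\<forall>q\<in>UNIV. (\<lambda>k. mollify (r k) (f q) z) \<longlonglongrightarrow> f q z" and z: "z \<in> Q"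
    have "z \<in> R" using QR[OF z kk(2)[of 0]] radius_pos[of "kk 0"] by (meson centre_in_cball less_imp_le subsetD)
    then have fV: "f q z = ?V q z" by (simp add: f_def)
    have "(\<lambda>j. mollify (kk j) (f q) z) \<longlonglongrightarrow> f q z" using 1 2 by blast
    then show "(\<lambda>j. mder (- b) b w (kk j) (dirs q) z) \<longlonglongrightarrow> ?V q z"
      unfolding md[OF z] fV .
  qed
  have lims: "(\<lambda>j. vt (kk j) z) \<longlonglongrightarrow> ut z" "(\<lambda>j. pa (kk j) z $ i) \<longlonglongrightarrow> (Du z - L *\<^sub>R grad_\<theta> (snd z)) $ i"
    "(\<lambda>j. Ha (kk j) z $ i $ l) \<longlonglongrightarrow> H z $ i $ l"
    if "\<forall>q. (\<lambda>j. mder (- b) b w (kk j) (dirs q) z) \<longlonglongrightarrow> ?V q z" for z i l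
  proof -
    show "(\<lambda>j. vt (kk j) z) \<longlonglongrightarrow> ut z"
      using spec[OF that, of "(None, None)"] by (simp add: vt_def dirs_def deriv_version_def)
    show "(\<lambda>j. pa (kk j) z $ i) \<longlonglongrightarrow> (Du z - L *\<^sub>R grad_\<theta> (snd z)) $ i"
      using spec[OF that, of "(Some i, None)"] by (simp add: pa_def dirs_def deriv_version_def) (intro tendsto_diff tendsto_const)
    show "(\<lambda>j. Ha (kk j) z $ i $ l) \<longlonglongrightarrow> H z $ i $ l"
      using spec[OF that, of "(Some i, Some l)"] by (simp add: Ha_def H_def dirs_def deriv_version_def) (intro tendsto_diff tendsto_const)
  qed
  have limJ: "AE z in lebesgue. \<forall>e>0. eventually (\<lambda>j. Jk j z \<le> J z + e) sequentially"
    using ae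
  proof (rule AE_mp, intro AE_I2 impI allI)
    fix z and e :: real
    assume z: "z \<in> Q \<longrightarrow> (\<forall>q. (\<lambda>j. mder (- b) b w (kk j) (dirs q) z) \<longlonglongrightarrow> ?V q z)" and e: "0 < e"
    show "eventually (\<lambda>j. Jk j z \<le> J z + e) sequentially"
    proof (cases "z \<in> G")
      case True
      then have zQ: "\<forall>q. (\<lambda>j. mder (- b) b w (kk j) (dirs q) z) \<longlonglongrightarrow> ?V q z" using z GQ by blast
      have "(\<lambda>j. \<bar>vt (kk j) z * det (Ha (kk j) z)\<bar>) \<longlonglongrightarrow> \<bar>ut z * det (H z)\<bar>"
        by (intro tendsto_rabs tendsto_mult tendsto_det lims zQ)
      then have "eventually (\<lambda>j. \<bar>vt (kk j) z * det (Ha (kk j) z)\<bar> < \<bar>ut z * det (H z)\<bar> + e) sequentially"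
        using e by (intro order_tendstoD(2)) auto
      then show ?thesis
        by eventually_elim (use True e in \<open>auto simp: Jk_def J_def indicator_def\<close>)
    next
      case False
      have "eventually (\<lambda>j. z \<notin> ?S j) sequentially" by (rule limsup_set_frequently(2)[OF G_def False])
      then show ?thesis by eventually_elim (use False e in \<open>simp add: Jk_def J_def\<close>)
    qed
  qed
  have est: "emeasure lborel (plane_image (\<epsilon> * M) x0) \<le> (\<integral>\<^sup>+z. ennreal (Jk j z) \<partial>lebesgue)" for j
  proof -
    have "emeasure lborel (plane_image (\<epsilon> * M) x0) \<le> (\<integral>\<^sup>+z. ennreal (indicator (?S j) z * \<bar>vt (kk j) z * det (Ha (kk j) z)\<bar>) \<partial>lborel)"
      unfolding Q_def
    proof (rule contact_set_estimate[OF _ _ _ \<epsilon> M L _ _ _ E])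
      show "norm x0 < 1 - \<rho>" "1 - \<rho> < 1" "t0 < T - \<rho>" using \<rho> by auto
      show "mder (- b) b w (kk j) [] z - m \<le> M * \<theta> (snd z) + E" if "z \<in> {t0..T - \<rho>} \<times> cball 0 (1 - \<rho>)" for z
        using unif[of z j] up[of "fst z" "snd z"] that t0 \<rho> e0(2) by (auto simp: Q_def)
      show "mder (- b) b w (kk j) [] (t, x) - m < 0" if "t \<in> {t0..T - \<rho>}" "x \<in> cball 0 (1 - \<rho>)" "t = T - \<rho> \<or> norm x = 1 - \<rho>" for t x
      proof -
        have "u (t, x) - m \<le> - slack / 2" by (rule d(2)) (use that t0 \<rho> in auto)
        then show ?thesis using unif[of "(t, x)" j] that e0 slack by (auto simp: Q_def)
      qed
      show "M * \<theta> x0 - 2 * E < mder (- b) b w (kk j) [] (t0, x0) - m"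
        using unif[of "(t0, x0)" j] start e0(2) \<rho> by (auto simp: Q_def)
    qed
    then show ?thesis unfolding Jk_def nn_integral_completion .
  qed
  have main: "emeasure lborel (plane_image (\<epsilon> * M) x0) \<le> (\<integral>\<^sup>+z. ennreal (J z) \<partial>lebesgue)"
    by (rule nn_integral_limit_lower_bound[OF Hki HHi HL Jkm Jm AE_I2 _ _ limJ est])
       (auto simp: Jk_def J_def intro: bound[unfolded Jk_def])
  have cond: "AE z in lebesgue. z \<in> G \<longrightarrow> ut z \<le> 0 \<and> 0 \<le> u z - m \<and> psi x0 / 4 \<le> psi (snd z) \<and> psi (snd z) \<le> 4 * psi x0 \<and>
       norm (Du z - L *\<^sub>R grad_\<theta> (snd z)) \<le> 4 * (\<epsilon> * M) * g1 (psi x0) \<and> sym_nonneg_definite (- H z)"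
    using ae
  proof (rule AE_mp, intro AE_I2 impI)
    fix z
    assume z: "z \<in> Q \<longrightarrow> (\<forall>q. (\<lambda>j. mder (- b) b w (kk j) (dirs q) z) \<longlonglongrightarrow> ?V q z)" and zG: "z \<in> G"
    have zQ: "z \<in> Q" using zG GQ by blast
    then have l: "\<forall>q. (\<lambda>j. mder (- b) b w (kk j) (dirs q) z) \<longlonglongrightarrow> ?V q z" using z by blast
    have fr: "frequently (\<lambda>j. z \<in> ?S j) sequentially" by (rule limsup_set_frequently(1)[OF G_def zG])
    have "\<exists>j. z \<in> ?S j" using fr frequently_ex by fastforce
    then have psi: "psi x0 / 4 \<le> psi (snd z)" "psi (snd z) \<le> 4 * psi x0" by (auto simp: contact_set_def)
    have ut: "ut z \<le> 0" by (rule frequently_le_limit[OF fr lims(1)[OF l]]) (auto simp: contact_set_def)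
    have nu: "0 \<le> u z - m"
    proof -
      have "cball z (radius (kk j)) \<subseteq> cbox (- b) b" for j using QR[OF zQ kk(2)] R(1) \<Omega>b by blast
      have "(\<lambda>j. mder (- b) b w (kk j) [] z) \<longlonglongrightarrow> w z"
      proof (rule tendstoI)
        fix e :: real assume "0 < e"
        then obtain k3 where k3: "\<And>k. k3 \<le> k \<Longrightarrow> cball z (radius k) \<subseteq> cbox (- b) b \<Longrightarrow> \<bar>mder (- b) b w k [] z - w z\<bar> \<le> e / 2"
          using mder_uniform_limit[OF w_cont, of "e / 2"] by (metis half_gt_zero)
        have "dist (mder (- b) b w (kk j) [] z) (w z) < e" if "k3 \<le> j" for j
        proof -
          have "k3 \<le> kk j" using seq_suble[OF kk_mono, of j] that by simp
          then have "\<bar>mder (- b) b w (kk j) [] z - w z\<bar> \<le> e / 2" by (rule k3) fact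
          then show ?thesis using \<open>0 < e\<close> by (simp add: dist_real_def)
        qed
        then show "eventually (\<lambda>j. dist (mder (- b) b w (kk j) [] z) (w z) < e) sequentially"
          unfolding eventually_sequentially by blast
      qed
      then have "(\<lambda>j. - mder (- b) b w (kk j) [] z) \<longlonglongrightarrow> - w z" by (rule tendsto_minus)
      then have "- w z \<le> - m" by (rule frequently_le_limit[OF fr]) (auto simp: contact_set_def)
      then show ?thesis using w_eq[of z] zQ Q(3) by auto
    qed
    have np: "norm (Du z - L *\<^sub>R grad_\<theta> (snd z)) \<le> 4 * (\<epsilon> * M) * g1 (psi x0)"
    proof -
      have "(\<lambda>j. pa (kk j) z) \<longlonglongrightarrow> Du z - L *\<^sub>R grad_\<theta> (snd z)"
        by (rule vec_tendstoI) (rule lims(2)[OF l])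
      from tendsto_norm[OF this] show ?thesis by (rule frequently_le_limit[OF fr]) (auto simp: contact_set_def)
    qed
    have symH: "H z $ i $ l = H z $ l $ i" for i l
    proof -
      have "Ha (kk j) z $ i $ l = Ha (kk j) z $ l $ i" for j
        using Ha_symmetric[of "kk j" z] by (simp add: vec_eq_iff transpose_def)
      then have "(\<lambda>j. Ha (kk j) z $ i $ l) \<longlonglongrightarrow> H z $ l $ i" using lims(3)[OF \<open>\<forall>q. _ q\<close>, of l i] by simp
      then show ?thesis using lims(3)[OF \<open>\<forall>q. _ q\<close>, of i l] LIMSEQ_unique by blast
    qed
    have "\<xi> \<bullet> (H z *v \<xi>) \<le> 0" for \<xi>
    proof -
      have "(\<lambda>j. \<xi> \<bullet> (Ha (kk j) z *v \<xi>)) \<longlonglongrightarrow> \<xi> \<bullet> (H z *v \<xi>)"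
        unfolding inner_vec_def matrix_vector_mult_def inner_real_def vec_lambda_beta
        by (intro tendsto_sum tendsto_mult tendsto_const lims(3)[OF l])
      then show ?thesis by (rule frequently_le_limit[OF fr]) (auto simp: contact_set_def)
    qed
    moreover have "(- H z) *v \<xi> = - (H z *v \<xi>)" for \<xi>
      by (simp add: matrix_vector_mult_def vec_eq_iff sum_negf)
    moreover have "transpose (- H z) = - H z" by (simp add: vec_eq_iff transpose_def symH)
    ultimately have "sym_nonneg_definite (- H z)" by (simp add: sym_nonneg_definite_def)
    then show "ut z \<le> 0 \<and> 0 \<le> u z - m \<and> psi x0 / 4 \<le> psi (snd z) \<and> psi (snd z) \<le> 4 * psi x0 \<and>
       norm (Du z - L *\<^sub>R grad_\<theta> (snd z)) \<le> 4 * (\<epsilon> * M) * g1 (psi x0) \<and> sym_nonneg_definite (- H z)"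
      using ut nu psi np by blast
  qed
  have GO: "G \<subseteq> ?\<Omega>" using GQ Q(4) by blast
  show ?thesis
    by (rule that[OF GO Jm[unfolded J_def H_def] main[unfolded J_def H_def] cond[unfolded H_def]])
qed

end

section \<open>The estimate\<close>

lemma Lop_eq:
  "Lop r a b c u ut Du D2u z = r z * ut z + frob (a z) (D2u z) + b z \<bullet> Du z - c z * u z"
  by (simp add: Lop_def frob_def inner_vec_def)

lemma abs_det_uminus: "\<bar>det (- A)\<bar> = \<bar>det (A :: real^'n^'n)\<bar>"
proof -
  have "- A = (\<chi> i. (- 1) *s A $ i)" by (simp add: vec_eq_iff)
  then have "det (- A) = (\<Prod>i\<in>(UNIV::'n set). - 1) * det (\<chi> i. A $ i)" using det_rows_mul[of "\<lambda>_. - 1" "\<lambda>i. A $ i"] by simp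
  then show ?thesis by (simp add: abs_mult power_abs)
qed

text \<open>Division of \<open>weighted_det_bound\<close> by \<open>q = r det a\<close>, with the conventions \<open>0 / 0 = 0\<close> and \<open>x / 0 = \<infinity>\<close> for \<open>x > 0\<close>: for
\<open>q = 0 < f\<close> the right-hand side is infinite, and for \<open>f = 0\<close> the left-hand side vanishes.\<close>

lemma quotient_bound_ennreal:
  fixes f q s C k :: real
  assumes f: "0 \<le> f" and q: "0 \<le> q" and C: "0 < C" and k: "0 \<le> k" "k \<le> k'" and s: "0 \<le> s"
    and le: "s * q \<le> C * f ^ p" and z: "f = 0 \<Longrightarrow> s = 0" and k': "0 < k'"
  shows "ennreal (k / C * s) \<le> ennreal k' * (ennreal (indicator {z. - f < 0} z * \<bar>- f\<bar> ^ p) / ennreal q)"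
proof (cases "f = 0")
  case True
  then show ?thesis using z by simp
next
  case False
  then have fp: "0 < f" using f by simp
  show ?thesis
  proof (cases "q = 0")
    case True
    then have "ennreal (indicator {z. - f < 0} z * \<bar>- f\<bar> ^ p) / ennreal q = \<infinity>"
      using fp by (simp add: ennreal_divide_zero)
    then show ?thesis using k' by (simp add: ennreal_mult_top)
  next
    case False
    then have qp: "0 < q" using q by simp
    have "s \<le> C * f ^ p / q" using le qp by (simp add: pos_le_divide_eq)
    then have "k / C * s \<le> k / C * (C * f ^ p / q)" using k C by (intro mult_left_mono) auto
    also have "\<dots> = k * (f ^ p / q)" using C by simp
    also have "\<dots> \<le> k' * (f ^ p / q)" using k qp fp by (intro mult_right_mono) auto
    finally have "ennreal (k / C * s) \<le> ennreal (k' * (f ^ p / q))" by (rule ennreal_leI)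
    also have "\<dots> = ennreal k' * ennreal (f ^ p / q)"
      by (rule ennreal_mult) (use k' qp fp in auto)
    also have "ennreal (f ^ p / q) = ennreal (f ^ p) / ennreal q"
      by (rule divide_ennreal[symmetric]) (use qp fp in auto)
    finally show ?thesis using fp by simp
  qed
qed

context barrier
begin

text \<open>Here \<open>H\<close> and \<open>p\<close> are the Hessian and the gradient of \<open>v = u - m - L \<theta>\<close>. The first order terms of \<open>v\<close> and of \<open>L \<theta>\<close>
are absorbed by the negative term \<open>L frob a (hess_\<theta> x)\<close>; this determines \<open>\<kappa>\<close> and \<open>\<epsilon>\<close>.\<close>

lemma pointwise_operator_bound:
  fixes a H :: "real^'n^'n" and b p x :: "real^'n"
  assumes n: "CARD('n) \<ge> 2" and K: "0 \<le> K" and kb: "\<kappa> * \<beta> = (K\<^sup>2 + 8) / 8"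
    and eps: "\<epsilon> = exp (- \<kappa>) / (16 * (K + 1))" and M: "0 < M" and L: "L = (1 - \<epsilon>) * M"
    and x: "x \<in> ball 0 1" and a: "sym_nonneg_definite a" and b: "norm b \<le> K * smallest_eigenvalue a"
    and cu: "0 \<le> c * u" and p: "norm p \<le> 4 * (\<epsilon> * M) * g1 \<delta>" and \<delta>: "0 < \<delta>" "psi x \<le> 4 * \<delta>"
  shows "frob a (- H) \<le> - (frob a (H + L *\<^sub>R hess_\<theta> x) + b \<bullet> (p + L *\<^sub>R grad_\<theta> x) - c * u)"
proof -
  let ?\<mu> = "smallest_eigenvalue a" and ?G = "g1 (psi x)" and ?y = "norm x"
  have \<mu>: "0 \<le> ?\<mu>" using smallest_eigenvalue_nonneg[OF a] .
  have px: "0 < psi x" "psi x \<le> 1" using psi_pos[OF x] psi_le_1 by auto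
  have G: "0 < ?G" using g1_pos px by simp
  have e: "0 < \<epsilon>" "\<epsilon> \<le> 1/2"
  proof -
    show "0 < \<epsilon>" unfolding eps using K by simp
    have "exp (- \<kappa>) \<le> 1" using \<kappa> by simp
    then have "exp (- \<kappa>) / (16 * (K + 1)) \<le> 1 / 2" using K by (intro frac_le) auto
    then show "\<epsilon> \<le> 1/2" unfolding eps .
  qed
  have L2: "M \<le> 2 * L" unfolding L using e M by (simp add: mult.commute)
  have L0: "0 \<le> L" using L2 M by simp
  have hess: "frob a (hess_\<theta> x) \<le> - ?\<mu> * (?G * (2 * real CARD('n) + 4 * \<kappa> * \<beta> * ?y\<^sup>2))"
    by (rule frob_hess_\<theta>_le[OF x a])
  have grad: "b \<bullet> grad_\<theta> x \<le> K * ?\<mu> * (2 * ?G * ?y)"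
  proof -
    have "b \<bullet> grad_\<theta> x \<le> norm b * norm (grad_\<theta> x)" by (rule norm_cauchy_schwarz)
    also have "\<dots> \<le> (K * ?\<mu>) * norm (grad_\<theta> x)" by (intro mult_right_mono b) auto
    finally show ?thesis by (simp add: norm_grad_\<theta>[OF x])
  qed
  \<comment> \<open>The factor \<open>exp (- \<kappa>) / 4\<close> of \<open>\<epsilon>\<close> pays for comparing \<open>g1 \<delta>\<close> with \<open>g1 (psi x)\<close>, the factor \<open>1 / (K + 1)\<close> for the drift, and the rest for the \<open>4\<close> in the bound for \<open>p\<close>.\<close>
  have bp: "b \<bullet> p \<le> ?\<mu> * (M * ?G)"
  proof -
    have "b \<bullet> p \<le> norm b * norm p" by (rule norm_cauchy_schwarz)
    also have "\<dots> \<le> (K * ?\<mu>) * (4 * (\<epsilon> * M) * g1 \<delta>)" using K \<mu> by (intro mult_mono b p) auto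
    also have "\<dots> = (K / (K + 1)) * (?\<mu> * (M * (exp (- \<kappa>) / 4 * g1 \<delta>)))"
      unfolding eps using K by (simp add: field_simps)
    also have "\<dots> \<le> 1 * (?\<mu> * (M * ?G))"
    proof (rule mult_mono)
      show "K / (K + 1) \<le> 1" using K by simp
      show "?\<mu> * (M * (exp (- \<kappa>) / 4 * g1 \<delta>)) \<le> ?\<mu> * (M * ?G)"
        using \<mu> M by (intro mult_left_mono g1_comparable px \<delta>) auto
      show "0 \<le> ?\<mu> * (M * (exp (- \<kappa>) / 4 * g1 \<delta>))"
        using \<mu> M g1_pos[OF \<delta>(1)] by (intro mult_nonneg_nonneg) auto
    qed simp
    finally show ?thesis by simp
  qed
  \<comment> \<open>The value of \<open>\<kappa> \<beta>\<close> is chosen to complete the square \<open>(K \<bar>x\<bar> - 2)\<^sup>2 / 2\<close>; the constant \<open>2\<close> used up there is part of \<open>2 n \<ge> 4\<close>.\<close>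
  have quad: "2 \<le> 2 * real CARD('n) + 4 * \<kappa> * \<beta> * ?y\<^sup>2 - 2 * K * ?y"
  proof -
    have "4 * \<kappa> * \<beta> * ?y\<^sup>2 = 4 * (\<kappa> * \<beta>) * ?y\<^sup>2" by simp
    also have "\<dots> = (K * ?y)\<^sup>2 / 2 + 4 * ?y\<^sup>2" unfolding kb by (simp add: power_mult_distrib field_simps)
    finally have eq: "4 * \<kappa> * \<beta> * ?y\<^sup>2 = (K * ?y)\<^sup>2 / 2 + 4 * ?y\<^sup>2" .
    have "0 \<le> (K * ?y - 2)\<^sup>2 / 2" by simp
    also have "\<dots> = (K * ?y)\<^sup>2 / 2 - 2 * K * ?y + 2" by (simp add: power2_diff field_simps)
    finally have "0 \<le> (K * ?y)\<^sup>2 / 2 - 2 * K * ?y + 2" .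
    moreover have "0 \<le> 4 * ?y\<^sup>2" by simp
    moreover have "4 \<le> 2 * real CARD('n)" using n by simp
    ultimately show ?thesis unfolding eq by linarith
  qed
  have "L * (?\<mu> * ?G) * 2 \<le> L * (?\<mu> * ?G) * (2 * real CARD('n) + 4 * \<kappa> * \<beta> * ?y\<^sup>2 - 2 * K * ?y)"
    using L0 \<mu> G by (intro mult_left_mono quad mult_nonneg_nonneg) auto
  moreover have "M * (?\<mu> * ?G) \<le> 2 * L * (?\<mu> * ?G)" using L2 \<mu> G by (intro mult_right_mono) auto
  moreover have "L * frob a (hess_\<theta> x) \<le> L * (- ?\<mu> * (?G * (2 * real CARD('n) + 4 * \<kappa> * \<beta> * ?y\<^sup>2)))"
    using L0 by (intro mult_left_mono hess)
  moreover have "L * (b \<bullet> grad_\<theta> x) \<le> L * (K * ?\<mu> * (2 * ?G * ?y))" using L0 by (intro mult_left_mono grad)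
  moreover have "L * (?\<mu> * ?G) * (2 * real CARD('n) + 4 * \<kappa> * \<beta> * ?y\<^sup>2 - 2 * K * ?y)
      = - (L * (- ?\<mu> * (?G * (2 * real CARD('n) + 4 * \<kappa> * \<beta> * ?y\<^sup>2)))) - L * (K * ?\<mu> * (2 * ?G * ?y))"
    by (simp add: algebra_simps)
  moreover have "?\<mu> * (M * ?G) = M * (?\<mu> * ?G)" "L * (?\<mu> * ?G) * 2 = 2 * L * (?\<mu> * ?G)" by simp_all
  ultimately have key: "0 \<le> - (L * frob a (hess_\<theta> x)) - L * (b \<bullet> grad_\<theta> x) - b \<bullet> p + c * u"
    using bp cu by linarith
  have "frob a (H + L *\<^sub>R hess_\<theta> x) = frob a H + L * frob a (hess_\<theta> x)"
    by (simp add: frob_def distrib_left sum.distrib sum_distrib_left ac_simps)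
  moreover have "frob a (- H) = - frob a H" by (simp add: frob_def sum_negf)
  ultimately show ?thesis using key by (simp add: inner_add_right)
qed

text \<open>If \<open>u - m \<le> M \<theta>\<close> is nearly an equality somewhere, the integral is at least a constant times \<open>M\<^bsup>n + 1\<^esup>\<close>. The lower
bound \<open>\<psi> \<ge> \<psi>(x0) / 4\<close> on the contact set supplies a factor \<open>\<psi>(x0)\<^sup>\<alpha>\<close>, which cancels the factor
\<open>\<psi>(x0)\<^bsup>- \<alpha>\<^esup>\<close> in the volume of the set of planes.\<close>

lemma weighted_integral_lower_bound:
  fixes a :: "real \<times> (real^'n) \<Rightarrow> real^'n^'n" and r c u ut :: "real \<times> (real^'n) \<Rightarrow> real"
    and b Du :: "real \<times> (real^'n) \<Rightarrow> real^'n" and D2u :: "real \<times> (real^'n) \<Rightarrow> real^'n^'n" and x0 :: "real^'n"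
  assumes n: "CARD('n) \<ge> 2" and K: "0 \<le> K" and kb: "\<kappa> * \<beta> = (K\<^sup>2 + 8) / 8"
    and eps: "\<epsilon> = exp (- \<kappa>) / (16 * (K + 1))" and al: "0 \<le> \<alpha>" "\<beta> = 1/2 - \<alpha> / (real CARD('n) + 1)"
    and T: "0 < T" and a: "\<And>z. z \<in> cyl T \<Longrightarrow> sym_nonneg_definite (a z)"
    and r: "\<And>z. z \<in> cyl T \<Longrightarrow> 0 \<le> r z" and ra: "\<And>z. z \<in> cyl T \<Longrightarrow> r z + trace (a z) > 0"
    and b: "\<And>z. z \<in> cyl T \<Longrightarrow> norm (b z) \<le> K * smallest_eigenvalue (a z)"
    and c: "\<And>z. z \<in> cyl T \<Longrightarrow> 0 \<le> c z"
    and W: "u \<in> W12_loc (real CARD('n) + 1) T" and cont: "continuous_on (closure (cyl T)) u"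
    and gd: "generalized_derivs T u ut Du D2u"
    and M: "0 < M" and m: "0 \<le> m" and slack: "0 < slack"
    and bd: "\<And>t x. t \<in> {0..T} \<Longrightarrow> norm x \<le> 1 \<Longrightarrow> t = T \<or> norm x = 1 \<Longrightarrow> u (t, x) - m \<le> - slack"
    and up: "\<And>t x. 0 < t \<Longrightarrow> t < T \<Longrightarrow> norm x < 1 \<Longrightarrow> u (t, x) - m \<le> M * \<theta> x"
    and t0: "0 < t0" "t0 < T" and x0: "norm x0 < 1"
    and start: "M * \<theta> x0 - \<epsilon> * M / 512 * (psi x0 * g1 (psi x0)) < u (t0, x0) - m"
  shows "ennreal (M ^ (CARD('n) + 1) * ((\<epsilon> * \<kappa> * \<beta> * exp (- \<kappa>)) ^ (CARD('n) + 1) * (1/4) powr \<alpha> / fact CARD('n)))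
      * emeasure lborel (plane_params :: (real \<times> (real^'n)) set)
    \<le> weighted_integral \<alpha> T r a (Lop r a b c u ut Du D2u)"
proof -
  let ?n = "CARD('n)" and ?p = "CARD('n) + 1" and ?L = "Lop r a b c u ut Du D2u" and ?d = "psi x0"
  define L where "L = (1 - \<epsilon>) * M"
  have x0b: "x0 \<in> ball 0 1" using x0 by simp
  have d: "0 < ?d" using psi_pos[OF x0b] .
  have e: "0 < \<epsilon>" "\<epsilon> \<le> 1"
  proof -
    show "0 < \<epsilon>" unfolding eps using K by simp
    have "exp (- \<kappa>) \<le> 1" using \<kappa> by simp
    then have "exp (- \<kappa>) / (16 * (K + 1)) \<le> 1 / 1" using K by (intro frac_le) auto
    then show "\<epsilon> \<le> 1" unfolding eps by simp
  qed
  obtain G where G: "G \<subseteq> interior (cyl T)"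
    "(\<lambda>z. indicator G z * \<bar>ut z * det (D2u z - L *\<^sub>R hess_\<theta> (snd z))\<bar>) \<in> borel_measurable lebesgue"
    "emeasure lborel (plane_image (\<epsilon> * M) x0)
      \<le> (\<integral>\<^sup>+z. ennreal (indicator G z * \<bar>ut z * det (D2u z - L *\<^sub>R hess_\<theta> (snd z))\<bar>) \<partial>lebesgue)"
    "AE z in lebesgue. z \<in> G \<longrightarrow> ut z \<le> 0 \<and> 0 \<le> u z - m \<and> psi x0 / 4 \<le> psi (snd z) \<and> psi (snd z) \<le> 4 * psi x0 \<and>
       norm (Du z - L *\<^sub>R grad_\<theta> (snd z)) \<le> 4 * (\<epsilon> * M) * g1 (psi x0) \<and>
       sym_nonneg_definite (- (D2u z - L *\<^sub>R hess_\<theta> (snd z)))"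
    using contact_limit[OF T W cont gd e M L_def slack bd up t0 x0 refl start] by blast
  let ?H = "\<lambda>z. D2u z - L *\<^sub>R hess_\<theta> (snd z)"
  let ?J = "\<lambda>z. indicator G z * \<bar>ut z * det (?H z)\<bar>"
  let ?k = "(?d / 4) powr \<alpha>"
  let ?I = "\<lambda>z. ennreal (psi (snd z) powr \<alpha>) * (ennreal (indicator {z. ?L z < 0} z * \<bar>?L z\<bar> ^ ?p) / ennreal (r z * det (a z)))"
  have pw: "AE z in lebesgue. ennreal (?k / fact ?n * ?J z) \<le> ?I z * indicator (cyl T) z"
    using G(4)
  proof (rule AE_mp, intro AE_I2 impI)
    fix z assume z: "z \<in> G \<longrightarrow> ut z \<le> 0 \<and> 0 \<le> u z - m \<and> psi x0 / 4 \<le> psi (snd z) \<and> psi (snd z) \<le> 4 * psi x0 \<and>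
       norm (Du z - L *\<^sub>R grad_\<theta> (snd z)) \<le> 4 * (\<epsilon> * M) * g1 (psi x0) \<and> sym_nonneg_definite (- ?H z)"
    show "ennreal (?k / fact ?n * ?J z) \<le> ?I z * indicator (cyl T) z"
    proof (cases "z \<in> G")
      case False
      then show ?thesis by simp
    next
      case True
      then have zi: "z \<in> interior (cyl T)" using G(1) by blast
      then have zc: "z \<in> cyl T" using interior_subset by blast
      have zb: "snd z \<in> ball 0 1" using zi by (auto simp: interior_cyl)
      have zz: "ut z \<le> 0" "0 \<le> u z - m" "psi x0 / 4 \<le> psi (snd z)" "psi (snd z) \<le> 4 * psi x0"
        "norm (Du z - L *\<^sub>R grad_\<theta> (snd z)) \<le> 4 * (\<epsilon> * M) * g1 (psi x0)" "sym_nonneg_definite (- ?H z)"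
        using z True by auto
      define f where "f = - ?L z"
      have cu: "0 \<le> c z * u z" using c[OF zc] zz(2) m by simp
      have "frob (a z) (- ?H z) \<le> - (frob (a z) (?H z + L *\<^sub>R hess_\<theta> (snd z)) + b z \<bullet> ((Du z - L *\<^sub>R grad_\<theta> (snd z)) + L *\<^sub>R grad_\<theta> (snd z)) - c z * u z)"
        by (rule pointwise_operator_bound[OF n K kb eps M L_def zb a[OF zc] b[OF zc] cu zz(5) d zz(4)])
      then have f: "r z * (- ut z) + frob (a z) (- ?H z) \<le> f" by (simp add: f_def Lop_eq)
      have s: "0 \<le> - ut z" using zz(1) by simp
      note wb = weighted_det_bound[OF a[OF zc] zz(6) r[OF zc] s ra[OF zc] f]
      have f0: "0 \<le> f"
        using f frob_nonneg[OF a[OF zc] zz(6)] mult_nonneg_nonneg[OF r[OF zc] s] by linarith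
      have dH: "0 \<le> det (- ?H z)" by (rule det_sym_nonneg[OF zz(6)])
      have J: "?J z = - ut z * det (- ?H z)"
        using True zz(1) dH abs_det_uminus[of "?H z"] by (simp add: abs_mult)
      have "ennreal (?k / fact ?n * (- ut z * det (- ?H z))) \<le> ennreal (psi (snd z) powr \<alpha>) * (ennreal (indicator {w. - f < 0} z * \<bar>- f\<bar> ^ ?p) / ennreal (r z * det (a z)))"
      proof (rule quotient_bound_ennreal)
        show "0 \<le> f" by fact
        show "0 \<le> r z * det (a z)" using r[OF zc] det_sym_nonneg[OF a[OF zc]] by simp
        show "?k \<le> psi (snd z) powr \<alpha>" using zz(3) d al(1) by (intro powr_mono2) auto
        show "0 \<le> - ut z * det (- ?H z)" by (rule mult_nonneg_nonneg[OF s dH])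
        show "- ut z * det (- ?H z) * (r z * det (a z)) \<le> fact ?n * f ^ ?p" by (rule wb(1))
        show "f = 0 \<Longrightarrow> - ut z * det (- ?H z) = 0" by (rule wb(2))
        show "0 < psi (snd z) powr \<alpha>" using zz(3) d by simp
      qed auto
      also have "\<dots> = ?I z * indicator (cyl T) z" using zc by (simp add: f_def indicator_def)
      finally show ?thesis unfolding J .
    qed
  qed
  have cylm: "cyl T \<in> sets lebesgue"
    unfolding cyl_def by (intro sets_completionI_sets) (simp add: borel_Times)
  have "ennreal (?k / fact ?n) * emeasure lborel (plane_image (\<epsilon> * M) x0) \<le> ennreal (?k / fact ?n) * (\<integral>\<^sup>+z. ennreal (?J z) \<partial>lebesgue)"
    by (intro mult_left_mono G(3)) auto
  also have "\<dots> = (\<integral>\<^sup>+z. ennreal (?k / fact ?n) * ennreal (?J z) \<partial>lebesgue)"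
    using G(2) by (intro nn_integral_cmult[symmetric]) auto
  also have "\<dots> = (\<integral>\<^sup>+z. ennreal (?k / fact ?n * ?J z) \<partial>lebesgue)"
    by (intro nn_integral_cong) (subst ennreal_mult, auto)
  also have "\<dots> \<le> (\<integral>\<^sup>+z. ?I z * indicator (cyl T) z \<partial>lebesgue)"
    by (rule nn_integral_mono_AE[OF pw])
  also have "\<dots> = weighted_integral \<alpha> T r a ?L"
    unfolding weighted_integral_def using cylm by (subst nn_integral_restrict_space) auto
  finally have 1: "ennreal (?k / fact ?n) * emeasure lborel (plane_image (\<epsilon> * M) x0) \<le> weighted_integral \<alpha> T r a ?L" .
  let ?v = "emeasure lborel (plane_params :: (real \<times> (real^'n)) set)"
  let ?A = "((\<epsilon> * M) * \<kappa> * \<beta> * exp (- \<kappa>)) ^ ?p"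
  have "ennreal (?A * ?d powr (- \<alpha>)) * ?v \<le> emeasure lborel (plane_image (\<epsilon> * M) x0)"
    using plane_image_measure_ge[OF x0b _ al(2), of "\<epsilon> * M"] e M by simp
  then have "ennreal (?k / fact ?n) * (ennreal (?A * ?d powr (- \<alpha>)) * ?v) \<le> ennreal (?k / fact ?n) * emeasure lborel (plane_image (\<epsilon> * M) x0)"
    by (intro mult_left_mono) auto
  also note 1
  also have "ennreal (?k / fact ?n) * (ennreal (?A * ?d powr (- \<alpha>)) * ?v) = ennreal (?k / fact ?n * (?A * ?d powr (- \<alpha>))) * ?v"
  proof -
    have "0 \<le> ?A * ?d powr (- \<alpha>)" using e M \<kappa> \<beta> by simp
    then have "ennreal (?k / fact ?n * (?A * ?d powr (- \<alpha>))) = ennreal (?k / fact ?n) * ennreal (?A * ?d powr (- \<alpha>))"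
      by (intro ennreal_mult) auto
    then show ?thesis by (simp only: mult.assoc)
  qed
  also have "?k / fact ?n * (?A * ?d powr (- \<alpha>)) = M ^ ?p * ((\<epsilon> * \<kappa> * \<beta> * exp (- \<kappa>)) ^ ?p * (1/4) powr \<alpha> / fact ?n)"
  proof -
    have "?k = ?d powr \<alpha> * (1/4) powr \<alpha>" using powr_mult[of ?d "1/4" \<alpha>] d by simp
    then have kd: "?k * ?d powr (- \<alpha>) = (1/4) powr \<alpha>" using d by (simp add: powr_minus)
    have A: "?A = M ^ ?p * (\<epsilon> * \<kappa> * \<beta> * exp (- \<kappa>)) ^ ?p" by (simp only: power_mult_distrib[symmetric] ac_simps)
    have comm: "k / F * (A * e) = A * (k * e) / F" for k F A e :: real by simp
    have "?k / fact ?n * (?A * ?d powr (- \<alpha>)) = ?A * (?k * ?d powr (- \<alpha>)) / fact ?n" by (rule comm)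
    then show ?thesis unfolding kd A by (simp only: times_divide_eq_right mult.assoc)
  qed
  finally show ?thesis .
qed

text \<open>Otherwise \<open>M = sup (u - m) / \<theta>\<close> exceeds \<open>(I / c1)\<^bsup>1 / (n + 1)\<^esup>\<close>, which contradicts
\<open>weighted_integral_lower_bound\<close>. The supremum is finite, although \<open>\<theta>\<close> vanishes on the boundary, because \<open>u - m\<close> is negative there.\<close>

lemma interior_estimate:
  fixes a :: "real \<times> (real^'n) \<Rightarrow> real^'n^'n" and r c u ut :: "real \<times> (real^'n) \<Rightarrow> real"
    and b Du :: "real \<times> (real^'n) \<Rightarrow> real^'n" and D2u :: "real \<times> (real^'n) \<Rightarrow> real^'n^'n"
  assumes n: "CARD('n) \<ge> 2" and K: "0 \<le> K" and kb: "\<kappa> * \<beta> = (K\<^sup>2 + 8) / 8"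
    and eps: "\<epsilon> = exp (- \<kappa>) / (16 * (K + 1))" and al: "0 \<le> \<alpha>" "\<beta> = 1/2 - \<alpha> / (real CARD('n) + 1)"
    and T: "0 < T" and a: "\<And>z. z \<in> cyl T \<Longrightarrow> sym_nonneg_definite (a z)"
    and r: "\<And>z. z \<in> cyl T \<Longrightarrow> 0 \<le> r z" and ra: "\<And>z. z \<in> cyl T \<Longrightarrow> r z + trace (a z) > 0"
    and b: "\<And>z. z \<in> cyl T \<Longrightarrow> norm (b z) \<le> K * smallest_eigenvalue (a z)"
    and c: "\<And>z. z \<in> cyl T \<Longrightarrow> 0 \<le> c z"
    and W: "u \<in> W12_loc (real CARD('n) + 1) T" and cont: "continuous_on (closure (cyl T)) u"
    and gd: "generalized_derivs T u ut Du D2u"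
    and m: "0 \<le> m" and slack: "0 < slack"
    and bd: "\<And>t x. t \<in> {0..T} \<Longrightarrow> norm x \<le> 1 \<Longrightarrow> t = T \<or> norm x = 1 \<Longrightarrow> u (t, x) - m \<le> - slack"
    and c1: "c1 = (\<epsilon> * \<kappa> * \<beta> * exp (- \<kappa>)) ^ (CARD('n) + 1) * (1/4) powr \<alpha> / fact CARD('n)
       * measure lborel (plane_params :: (real \<times> (real^'n)) set)"
    and I: "weighted_integral \<alpha> T r a (Lop r a b c u ut Du D2u) = ennreal I" "0 \<le> I"
    and tx: "0 < t" "t < T" "norm x < 1"
  shows "u (t, x) - m \<le> (I / c1) powr (1 / (real CARD('n) + 1)) * \<theta> x"
proof (rule ccontr)
  let ?p = "CARD('n) + 1" and ?q = "1 / (real CARD('n) + 1)"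
  define Mb where "Mb = (I / c1) powr ?q"
  assume "\<not> u (t, x) - m \<le> (I / c1) powr ?q * \<theta> x"
  then have viol: "Mb * \<theta> x < u (t, x) - m" by (simp add: Mb_def)
  have Mb0: "0 \<le> Mb" by (simp add: Mb_def)
  have v: "emeasure lborel (plane_params :: (real \<times> (real^'n)) set) = ennreal (measure lborel (plane_params :: (real \<times> (real^'n)) set))"
    "0 < measure lborel (plane_params :: (real \<times> (real^'n)) set)"
  proof -
    show "emeasure lborel (plane_params :: (real \<times> (real^'n)) set) = ennreal (measure lborel (plane_params :: (real \<times> (real^'n)) set))"
      using emeasure_plane_params_pos(2)[where 'n='n] by (intro emeasure_eq_ennreal_measure) auto
    then show "0 < measure lborel (plane_params :: (real \<times> (real^'n)) set)"
      using emeasure_plane_params_pos(1)[where 'n='n] by simp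
  qed
  have e: "0 < \<epsilon>" unfolding eps using K by simp
  have c1p: "0 < c1" unfolding c1 using e \<kappa> \<beta> v(2) by simp
  have \<theta>p: "0 < \<theta> y" if "norm y < 1" for y :: "real^'n"
    using g_pos[OF psi_pos, of y] that by (simp add: \<theta>_def)
  define D where "D = {0<..<T} \<times> ball (0::real^'n) 1"
  define h where "h z = (u z - m) / \<theta> (snd z)" for z
  have cont': "continuous_on ({0..T} \<times> cball 0 1) u" using cont closure_cyl[OF T] by metis
  have bdd: "bdd_above (h ` D)"
  proof -
    have "continuous_on ({0..T} \<times> cball 0 1) (\<lambda>z. u z - m)" by (intro continuous_on_diff cont' continuous_on_const)
    from boundary_layer[OF T this slack bd]
    obtain d where d: "0 < d" "\<And>t x. t \<in> {0..T} \<Longrightarrow> norm x \<le> 1 \<Longrightarrow>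
        T - d \<le> t \<or> 1 - d \<le> norm x \<Longrightarrow> u (t, x) - m \<le> - slack / 2" by auto
    define d' where "d' = min d (1/2)"
    have d': "0 < d'" "d' \<le> d" "d' \<le> 1/2" using d(1) by (auto simp: d'_def)
    have "bounded ((\<lambda>z. u z - m) ` ({0..T} \<times> cball (0::real^'n) 1))"
      by (intro compact_imp_bounded compact_continuous_image compact_Times continuous_on_diff cont' continuous_on_const) auto
    then obtain B where B: "\<And>z. z \<in> {0..T} \<times> cball (0::real^'n) 1 \<Longrightarrow> \<bar>u z - m\<bar> \<le> B" by (auto simp: bounded_iff)
    have cc: "compact (cball (0::real^'n) (1 - d'))" "cball (0::real^'n) (1 - d') \<noteq> {}" using d' by auto
    have cont\<theta>: "continuous_on (cball (0::real^'n) (1 - d')) (\<theta> :: real^'n \<Rightarrow> real)"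
      by (rule continuous_on_subset[OF continuous_on_\<theta>]) (use d' in auto)
    obtain y :: "real^'n" where y: "norm y \<le> 1 - d'" "\<And>x :: real^'n. norm x \<le> 1 - d' \<Longrightarrow> \<theta> y \<le> \<theta> x"
      using continuous_attains_inf[OF cc cont\<theta>] by auto
    have ty: "0 < \<theta> y" using \<theta>p[of y] y d' by simp
    have "h z \<le> B / \<theta> y" if z: "z \<in> D" for z
    proof (cases "norm (snd z) \<le> 1 - d'")
      case True
      have zb: "\<bar>u z - m\<bar> \<le> B" using z by (intro B) (auto simp: D_def)
      have "h z \<le> \<bar>u z - m\<bar> / \<theta> (snd z)"
        unfolding h_def using \<theta>_nonneg[of "snd z"] by (intro divide_right_mono) auto
      also have "\<dots> \<le> B / \<theta> y" using zb y(2)[OF True] ty by (intro frac_le) auto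
      finally show ?thesis .
    next
      case False
      then have "u (fst z, snd z) - m \<le> - slack / 2" using z d' by (intro d(2)) (auto simp: D_def)
      then have "h z \<le> 0" unfolding h_def using slack \<theta>_nonneg[of "snd z"] by (intro divide_nonpos_nonneg) auto
      moreover have "0 \<le> B" using B[of "(0, 0)"] T by auto
      ultimately show ?thesis using ty by (meson divide_nonneg_pos order_trans)
    qed
    then show ?thesis by (intro bdd_aboveI2)
  qed
  have txD: "(t, x) \<in> D" using tx by (simp add: D_def)
  define M where "M = (SUP z\<in>D. h z)"
  have hM: "h z \<le> M" if "z \<in> D" for z unfolding M_def using bdd that by (rule cSUP_upper2) simp
  have "Mb < h (t, x)" using viol \<theta>p[OF tx(3)] by (simp add: h_def pos_less_divide_eq)
  then have MbM: "Mb < M" using hM[OF txD] by linarith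
  then have M: "0 < M" using Mb0 by linarith
  \<comment> \<open>A relative error \<open>\<zeta>\<close> in the supremum suffices, because \<open>\<theta>\<close> is at most a multiple of \<open>psi x * g1 (psi x)\<close>.\<close>
  define \<zeta> where "\<zeta> = \<epsilon> / 512 * (\<beta> * exp (- \<kappa>))"
  have \<zeta>: "0 < \<zeta>" unfolding \<zeta>_def using e \<beta> by simp
  have "M * (1 - \<zeta>) < M" using M \<zeta> by (simp add: algebra_simps)
  then have "\<exists>z\<in>D. M * (1 - \<zeta>) < h z"
    unfolding M_def using less_cSUP_iff[OF _ bdd] txD by blast
  then obtain z where z: "z \<in> D" "M * (1 - \<zeta>) < h z" by blast
  obtain t0 x0 where z0: "z = (t0, x0)" by (cases z)
  have t0: "0 < t0" "t0 < T" "norm x0 < 1" using z(1) by (auto simp: D_def z0)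
  have x0b: "x0 \<in> ball 0 1" using t0 by simp
  have up: "u (s, y) - m \<le> M * \<theta> y" if "0 < s" "s < T" "norm y < 1" for s y
    using hM[of "(s, y)"] \<theta>p[OF that(3)] that by (simp add: h_def D_def pos_divide_le_eq)
  have start: "M * \<theta> x0 - \<epsilon> * M / 512 * (psi x0 * g1 (psi x0)) < u (t0, x0) - m"
  proof -
    have "\<beta> * exp (- \<kappa>) * \<theta> x0 \<le> psi x0 * g1 (psi x0)"
      unfolding \<theta>_def using psi_pos[OF x0b] psi_le_1 by (intro times_g1_ge) auto
    then have "\<epsilon> * M / 512 * (\<beta> * exp (- \<kappa>) * \<theta> x0) \<le> \<epsilon> * M / 512 * (psi x0 * g1 (psi x0))"
      using e M by (intro mult_left_mono) auto
    moreover have "\<epsilon> * M / 512 * (\<beta> * exp (- \<kappa>) * \<theta> x0) = M * \<zeta> * \<theta> x0" by (simp add: \<zeta>_def)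
    moreover have "M * (1 - \<zeta>) * \<theta> x0 < u (t0, x0) - m"
      using z(2) \<theta>p[OF t0(3)] by (simp add: h_def z0 pos_less_divide_eq)
    moreover have "M * (1 - \<zeta>) * \<theta> x0 = M * \<theta> x0 - M * \<zeta> * \<theta> x0" by (simp add: algebra_simps)
    ultimately show ?thesis by linarith
  qed
  have "ennreal (M ^ ?p * ((\<epsilon> * \<kappa> * \<beta> * exp (- \<kappa>)) ^ ?p * (1/4) powr \<alpha> / fact CARD('n)))
      * emeasure lborel (plane_params :: (real \<times> (real^'n)) set) \<le> ennreal I"
    by (rule weighted_integral_lower_bound[where a=a and r=r and b=b and c=c, OF n K kb eps al T a r ra b c W cont gd M m slack bd up t0 start, unfolded I(1)])
  also have "ennreal (M ^ ?p * ((\<epsilon> * \<kappa> * \<beta> * exp (- \<kappa>)) ^ ?p * (1/4) powr \<alpha> / fact CARD('n)))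
      * emeasure lborel (plane_params :: (real \<times> (real^'n)) set) = ennreal (M ^ ?p * c1)"
    unfolding v(1) c1 using M e \<kappa> \<beta> by (subst ennreal_mult[symmetric]) (auto simp: mult.assoc)
  finally have "M ^ ?p * c1 \<le> I" using I(2) by simp
  then have "M ^ ?p \<le> I / c1" using c1p by (simp add: pos_le_divide_eq)
  then have "(M ^ ?p) powr ?q \<le> (I / c1) powr ?q" using M by (intro powr_mono2) auto
  also have "(M ^ ?p) powr ?q = M"
  proof -
    have "M ^ ?p = M powr (real CARD('n) + 1)" using M powr_realpow[of M ?p] by (simp add: add.commute)
    then show ?thesis using M by (simp add: powr_powr)
  qed
  finally show False using MbM by (simp add: Mb_def)
qed

end

lemma parabolic_boundary_member:
  assumes T: "0 < T" and t: "t \<in> {0..T}" "norm x \<le> 1" "t = T \<or> norm x = 1" "0 < t"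
  shows "(t, x) \<in> parabolic_boundary T"
  using t by (auto simp: parabolic_boundary_def frontier_def closure_cyl[OF T] interior_cyl)

lemma right_limit_le:
  fixes f :: "real \<Rightarrow> real"
  assumes T: "0 < T" and c: "continuous_on {0..T} f" and le: "\<And>t. 0 < t \<Longrightarrow> t < T \<Longrightarrow> f t \<le> B"
  shows "f 0 \<le> B"
proof (rule ccontr)
  assume "\<not> f 0 \<le> B"
  then have gt: "B < f 0" by simp
  have "continuous (at 0 within {0..T}) f"
    using c T by (simp add: continuous_on_eq_continuous_within)
  then have "eventually (\<lambda>t. B < f t) (at 0 within {0..T})"
    unfolding continuous_within using gt by (rule order_tendstoD(1))
  then obtain d where d: "d > 0" "\<And>t. t \<in> {0..T} \<Longrightarrow> t \<noteq> 0 \<Longrightarrow> dist t 0 < d \<Longrightarrow> B < f t"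
    unfolding eventually_at by auto
  define t where "t = min (T / 2) (d / 2)"
  have "0 < t" "t < T" "t < d" using d(1) T by (auto simp: t_def)
  then show False using d(2)[of t] le[of t] by auto
qed

theorem theorem6p1:
  fixes \<alpha> \<beta> K :: real
  assumes "CARD('n::finite) \<ge> 2"
    and "0 \<le> \<alpha>" and "\<alpha> < (real CARD('n) + 1) / 2"
    and "\<beta> = 1 / 2 - \<alpha> / (real CARD('n) + 1)"
    and "K \<ge> 0"
  shows "\<exists>N>0.
    \<forall>(T::real) (a :: real \<times> (real^'n) \<Rightarrow> real^'n^'n) (r :: real \<times> (real^'n) \<Rightarrow> real)
      (b :: real \<times> (real^'n) \<Rightarrow> real^'n) (c :: real \<times> (real^'n) \<Rightarrow> real)
      (u :: real \<times> (real^'n) \<Rightarrow> real) (ut :: real \<times> (real^'n) \<Rightarrow> real)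
      (Du :: real \<times> (real^'n) \<Rightarrow> real^'n) (D2u :: real \<times> (real^'n) \<Rightarrow> real^'n^'n).
      0 < T \<longrightarrow>
      a \<in> borel_measurable (lebesgue_on (cyl T)) \<longrightarrow>
      (\<forall>z\<in>cyl T. sym_nonneg_definite (a z)) \<longrightarrow>
      r \<in> borel_measurable (lebesgue_on (cyl T)) \<longrightarrow>
      (\<forall>z\<in>cyl T. 0 \<le> r z) \<longrightarrow>
      (\<forall>z\<in>cyl T. r z + trace (a z) > 0) \<longrightarrow>
      b \<in> borel_measurable (lebesgue_on (cyl T)) \<longrightarrow>
      (\<forall>z\<in>cyl T. norm (b z) \<le> K * smallest_eigenvalue (a z)) \<longrightarrow>
      c \<in> borel_measurable (lebesgue_on (cyl T)) \<longrightarrow>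
      (\<forall>z\<in>cyl T. 0 \<le> c z) \<longrightarrow>
      bounded (c ` cyl T) \<longrightarrow>
      u \<in> W12_loc (real CARD('n) + 1) T \<longrightarrow>
      continuous_on (closure (cyl T)) u \<longrightarrow>
      generalized_derivs T u ut Du D2u \<longrightarrow>
      (\<forall>x0\<in>ball 0 1.
        ereal (u (0, x0))
          \<le> ereal (SUP z\<in>parabolic_boundary T. pos_part (u z))
            + ereal (N * psi x0 powr \<beta>)
              * enn2ereal (ennrpow (weighted_integral \<alpha> T r a (Lop r a b c u ut Du D2u))
                                   (1 / (real CARD('n) + 1))))"
proof -
  let ?q = "1 / (real CARD('n) + 1)"
  have "\<alpha> / (real CARD('n) + 1) < 1/2"
    using assms(3) by (subst pos_divide_less_eq) auto
  moreover have "0 \<le> \<alpha> / (real CARD('n) + 1)" using assms(2) by simp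
  ultimately have \<beta>: "0 < \<beta>" "\<beta> \<le> 1/2" using assms(4) by linarith+
  define \<kappa> where "\<kappa> = (K\<^sup>2 + 8) / (8 * \<beta>)"
  have \<kappa>: "0 < \<kappa>" unfolding \<kappa>_def using \<beta> by (simp add: add_nonneg_pos)
  have kb: "\<kappa> * \<beta> = (K\<^sup>2 + 8) / 8" unfolding \<kappa>_def using \<beta> by simp
  interpret barrier \<kappa> \<beta> using \<kappa> \<beta> by unfold_locales
  define \<epsilon> where "\<epsilon> = exp (- \<kappa>) / (16 * (K + 1))"
  define c1 where "c1 = (\<epsilon> * \<kappa> * \<beta> * exp (- \<kappa>)) ^ (CARD('n) + 1) * (1/4) powr \<alpha> / fact CARD('n)
       * measure lborel (plane_params :: (real \<times> (real^'n)) set)"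
  have c1: "0 < c1"
  proof -
    have "emeasure lborel (plane_params :: (real \<times> (real^'n)) set) = ennreal (measure lborel (plane_params :: (real \<times> (real^'n)) set))"
      using emeasure_plane_params_pos(2)[where 'n='n] by (intro emeasure_eq_ennreal_measure) auto
    then have "0 < measure lborel (plane_params :: (real \<times> (real^'n)) set)"
      using emeasure_plane_params_pos(1)[where 'n='n] by simp
    moreover have "0 < \<epsilon>" unfolding \<epsilon>_def using assms(5) by simp
    ultimately show ?thesis unfolding c1_def using \<kappa> \<beta> by simp
  qed
  define N where "N = \<kappa> * (1 / c1) powr ?q"
  have N: "0 < N" unfolding N_def using \<kappa> c1 by simp
  show ?thesis
  proof (intro exI[of _ N] conjI N allI impI ballI)
    fix T :: real and a :: "real \<times> (real^'n) \<Rightarrow> real^'n^'n" and r :: "real \<times> (real^'n) \<Rightarrow> real"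
      and b :: "real \<times> (real^'n) \<Rightarrow> real^'n" and c u ut :: "real \<times> (real^'n) \<Rightarrow> real"
      and Du :: "real \<times> (real^'n) \<Rightarrow> real^'n" and D2u :: "real \<times> (real^'n) \<Rightarrow> real^'n^'n" and x0 :: "real^'n"
    assume T: "0 < T" and a: "\<forall>z\<in>cyl T. sym_nonneg_definite (a z)" and r: "\<forall>z\<in>cyl T. 0 \<le> r z"
      and ra: "\<forall>z\<in>cyl T. r z + trace (a z) > 0"
      and b: "\<forall>z\<in>cyl T. norm (b z) \<le> K * smallest_eigenvalue (a z)" and c: "\<forall>z\<in>cyl T. 0 \<le> c z"
      and W: "u \<in> W12_loc (real CARD('n) + 1) T" and cont: "continuous_on (closure (cyl T)) u"
      and gd: "generalized_derivs T u ut Du D2u" and x0: "x0 \<in> ball 0 1"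
    define WI where "WI = weighted_integral \<alpha> T r a (Lop r a b c u ut Du D2u)"
    define S where "S = (SUP z\<in>parabolic_boundary T. pos_part (u z))"
    have psi0: "0 < psi x0" using psi_pos[OF x0] .
    have Np: "0 < N * psi x0 powr \<beta>" using N psi0 by simp
    have "ereal (u (0, x0)) \<le> ereal S + ereal (N * psi x0 powr \<beta>) * enn2ereal (ennrpow WI ?q)"
    proof (cases "WI = \<infinity>")
      case True
      then have "enn2ereal (ennrpow WI ?q) = \<infinity>" by (simp add: ennrpow_def)
      moreover have "ereal (N * psi x0 powr \<beta>) * \<infinity> = \<infinity>" by (subst times_ereal.simps(2)) (use Np in force)
      ultimately show ?thesis by simp
    next
      case False
      define I where "I = enn2real WI"
      have I: "WI = ennreal I" "0 \<le> I" using False by (simp_all add: I_def less_top)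
      have cont': "continuous_on ({0..T} \<times> cball 0 1) u" using cont closure_cyl[OF T] by metis
      have bdd: "bdd_above ((\<lambda>z. pos_part (u z)) ` parabolic_boundary T)"
      proof -
        have "bounded ((\<lambda>z. pos_part (u z)) ` closure (cyl T))"
          unfolding pos_part_def closure_cyl[OF T]
          by (intro compact_imp_bounded compact_continuous_image compact_Times continuous_on_divide continuous_on_add
              continuous_on_rabs cont' continuous_on_const) auto
        then have "bdd_above ((\<lambda>z. pos_part (u z)) ` closure (cyl T))" by (rule bounded_imp_bdd_above)
        then show ?thesis by (rule bdd_above_mono) (auto simp: parabolic_boundary_def frontier_def)
      qed
      have le_S: "u z \<le> S" "0 \<le> S" if "z \<in> parabolic_boundary T" for z
      proof -
        have "pos_part (u z) \<le> S" unfolding S_def using that by (rule cSUP_upper[OF _ bdd])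
        moreover have "u z \<le> pos_part (u z)" "0 \<le> pos_part (u z)" by (auto simp: pos_part_def)
        ultimately show "u z \<le> S" "0 \<le> S" by auto
      qed
      have S0: "0 \<le> S"
        using le_S(2)[OF parabolic_boundary_member[OF T, of T 0]] T by simp
      have line: "continuous_on {0..T} (\<lambda>t. u (t, x))" if "norm x \<le> 1" for x
        by (rule continuous_on_compose2[OF cont']) (use that in \<open>auto intro!: continuous_intros\<close>)
      \<comment> \<open>The parabolic boundary omits the time \<open>0\<close>; points of the sphere at that time are reached by continuity in \<open>t\<close>.\<close>
      have bdS: "u (t, x) \<le> S" if tx: "t \<in> {0..T}" "norm x \<le> 1" "t = T \<or> norm x = 1" for t x
      proof (cases "0 < t")
        case True
        then show ?thesis by (intro le_S(1) parabolic_boundary_member T tx)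
      next
        case False
        then have t: "t = 0" "norm x = 1" using tx T by auto
        have "u (0, x) \<le> S"
          by (rule right_limit_le[OF T line]) (use t in \<open>auto intro!: le_S(1) parabolic_boundary_member T\<close>)
        then show ?thesis using t by simp
      qed
      have est: "u (0, x0) \<le> (S + slack) + (I / c1) powr ?q * \<theta> x0" if slack: "0 < slack" for slack
      proof (rule right_limit_le[OF T line])
        show "norm x0 \<le> 1" using x0 by simp
        fix t assume t: "0 < t" "t < T"
        have "u (t, x0) - (S + slack) \<le> (I / c1) powr ?q * \<theta> x0"
        proof (rule interior_estimate[OF assms(1) assms(5) kb \<epsilon>_def assms(2) assms(4) T _ _ _ _ _ W cont gd _ slack _ c1_def _ I(2) t])
          show "weighted_integral \<alpha> T r a (Lop r a b c u ut Du D2u) = ennreal I" using I(1) by (simp add: WI_def)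
          show "0 \<le> S + slack" using S0 slack by simp
          show "norm x0 < 1" using x0 by simp
          show "u (s, y) - (S + slack) \<le> - slack" if "s \<in> {0..T}" "norm y \<le> 1" "s = T \<or> norm y = 1" for s y
            using bdS[OF that] by simp
        qed (use a r ra b c in auto)
        then show "u (t, x0) \<le> (S + slack) + (I / c1) powr ?q * \<theta> x0" by simp
      qed
      have "u (0, x0) \<le> S + (I / c1) powr ?q * \<theta> x0"
        by (rule field_le_epsilon) (use est in \<open>simp add: algebra_simps\<close>)
      also have "(I / c1) powr ?q * \<theta> x0 \<le> (I / c1) powr ?q * (\<kappa> * psi x0 powr \<beta>)"
        unfolding \<theta>_def by (intro mult_left_mono g_le) auto
      also have "(I / c1) powr ?q = I powr ?q * (1 / c1) powr ?q"
        using powr_mult[of I "1 / c1" ?q] I(2) c1 by simp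
      finally have "u (0, x0) \<le> S + N * psi x0 powr \<beta> * I powr ?q"
        by (simp add: N_def ac_simps)
      moreover have "enn2ereal (ennrpow WI ?q) = ereal (I powr ?q)"
        using False by (simp add: ennrpow_def I_def enn2ereal_ennreal)
      ultimately show ?thesis by simp
    qed
    then show "ereal (u (0, x0)) \<le> ereal (SUP z\<in>parabolic_boundary T. pos_part (u z))
            + ereal (N * psi x0 powr \<beta>) * enn2ereal (ennrpow (weighted_integral \<alpha> T r a (Lop r a b c u ut Du D2u)) (1 / (real CARD('n) + 1)))"
      by (simp add: WI_def S_def)
  qed
qed

end
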